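(* Let $c=(c_n)_{n=-\infty}^\infty\subset\mathbb{H}$ be a non-trivial positive definite sequence with $c_0=1$ and with quaternionic Verblunsky coefficients $(\gamma_n)_{n=0}^\infty$. Choose orthogonal $i,j\in\mathbb{S}$ and let $\mu_i$ be the unique $q$-positive measure on $\mathbb{T}_i$ with moments $c$; let the corresponding matrix-valued measure be $M_i$, with Radon–Nikodym derivative $W_i\in L^1(\mathbb{T}_i;\mathbb{C}_i^{2\times2})$. Then $$\prod_{n=0}^\infty(1-|\gamma_n|^2)^2=\exp\left(\int_0^{2\pi}\log\det W_i(e^{i\theta})\,\frac{\mathrm{d}\theta}{2\pi}\right).$$ Moreover, for any other choice of orthogonal $i',j'\in\mathbb{S}$, with resulting matrix-valued measure $M_{i'}$ with Radon–Nikodym derivative $W_{i'}$, we have $$\int_0^{2\pi}\log\det W_i(e^{i\theta})\,\frac{\mathrm{d}\theta}{2\pi}=\int_0^{2\pi}\log\det W_{i'}(e^{i'\theta})\,\frac{\mathrm{d}\theta}{2\pi}.$$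
   Context: $\mathbb{H}$ is the quaternions, $\mathbb{S}$ the sphere of purely imaginary unit quaternions (so $i^2=-1$ for $i\in\mathbb{S}$). For $i\in\mathbb{S}$: $\mathbb{C}_i=\mathbb{R}+\mathbb{R}i$, $\mathbb{T}_i$ is its unit circle. If $i,j\in\mathbb{S}$ are orthogonal (as vectors in $\mathbb{R}^3$), every quaternion is uniquely $p=p^{(1)}+p^{(2)}j$ with $p^{(1)},p^{(2)}\in\mathbb{C}_i$, and $\chi_i(p)=\begin{bmatrix}p^{(1)}&p^{(2)}\\-\overline{p^{(2)}}&\overline{p^{(1)}}\end{bmatrix}\in\mathbb{C}_i^{2\times2}$. A bi-infinite sequence $c=(c_n)_{n\in\mathbb{Z}}$ in $\mathbb{H}$ is positive definite if for every $n\ge0$ the Toeplitz matrix $T_n(c)=[c_{\ell-k}]_{k,\ell=0}^n$ (row $k$, column $\ell$) is positive semidefinite ($\xi^*T_n(c)\xi\ge0$ for all $\xi\in\mathbb{H}^{n+1}$), and is non-trivial if moreover every $T_n(c)$ is positive definite ($\xi^*T_n(c)\xi>0$ for all nonzero $\xi$). A quaternion-valued measure $\mu_i=\mu^{(1)}+\mu^{(2)}j$ on $\mathbb{T}_i$ ($\mu^{(1)},\mu^{(2)}$ being $\mathbb{C}_i$-valued) is $q$-positive if $\mu^{(1)}$ is a positive measure, $\int_0^{2\pi} e^{in\theta}\mathrm{d}\mu^{(2)}(\theta)=-\int_0^{2\pi} e^{-in\theta}\mathrm{d}\mu^{(2)}(\theta)$ for all $n\in\mathbb{Z}$, and the corresponding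 matrix-valued measure $M_i=\begin{bmatrix}\mu^{(1)}&\mu^{(2)}\\ \overline{\mu^{(2)}}&\nu\end{bmatrix}$ is positive semidefinite-valued, where $\int_0^{2\pi} e^{in\theta}\mathrm{d}\nu(\theta)=\int_0^{2\pi} e^{-in\theta}\mathrm{d}\mu^{(1)}(\theta)$ for all $n\in\mathbb{Z}$. Its moments are $c_n=\int_0^{2\pi}e^{in\theta}\mathrm{d}\mu_i(\theta)$, $n\in\mathbb{Z}$. By the quaternionic Herglotz theorem (Alpay–Colombo–Kimsey–Sabadini), every positive definite $c$ is the moment sequence of a unique $q$-positive measure $\mu_i$ on $\mathbb{T}_i$. The measure $M_i$ is the unique positive matrix-valued measure on $\mathbb{T}_i$ with $\int_0^{2\pi}e^{in\theta}\mathrm{d}M_i(\theta)=\chi_i(c_n)$ for all $n\in\mathbb{Z}$. Its Radon–Nikodym derivative $W_i$ is the density of its absolutely continuous part: $\mathrm{d}M_i=W_i\frac{\mathrm{d}\theta}{2\pi}+\mathrm{d}M_{i,\mathrm{s}}$ (Lebesgue decomposition). Integrals of $\log\det W_i$ take values in $[-\infty,\infty)$, with $\log0=-\infty$, $\exp(-\infty)=0$. Verblunsky coefficients. For power series with right coefficients the $\star$-product is $(\sum p^ka_k)\star(\sum p^kb_k)=\sum_np^n\sum_{k=0}^na_kb_{n-k}$, and $g^{-\star}$ is the $\star$-inverse. Let $F(p)=1+2\sum_{n\ge1}p^nc_{-n}$ for $|p|<1$ (so that $F(z)=\int_0^{2\pi}\frac{1+ze^{-i\theta}}{1-ze^{-i\theta}}\mathrm{d}\mu_i(\theta)$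 for $z\in\mathbb{C}_i$, $|z|<1$), and let $f$ be the quaternionic Schur function with $F=(1+pf)\star(1-pf)^{-\star}$. The Verblunsky coefficients of $c$ are given by the quaternionic Schur algorithm: $f_0=f$, $\gamma_n=f_n(0)$, $p\,f_{n+1}(p)=(f_n-\gamma_n)\star(1-\overline{\gamma_n}\star f_n)^{-\star}(p)$; they satisfy $|\gamma_n|<1$. *)

theory Defs
  imports
    "HOL-Analysis.Analysis"
    "HOL-Computational_Algebra.Formal_Power_Series"
begin

section \<open>Quaternions\<close>

codatatype quat = Quat (qRe: real) (qI: real) (qJ: real) (qK: real)

lemma quat_eq_iff: "x = y \<longleftrightarrow> qRe x = qRe y \<and> qI x = qI y \<and> qJ x = qJ y \<and> qK x = qK y"
  by (auto intro: quat.expand)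

instantiation quat :: ab_group_add
begin

primcorec zero_quat where
  "qRe 0 = 0" | "qI 0 = 0" | "qJ 0 = 0" | "qK 0 = 0"

primcorec plus_quat where
  "qRe (x + y) = qRe x + qRe y"
| "qI (x + y) = qI x + qI y"
| "qJ (x + y) = qJ x + qJ y"
| "qK (x + y) = qK x + qK y"

primcorec uminus_quat where
  "qRe (- x) = - qRe x"
| "qI (- x) = - qI x"
| "qJ (- x) = - qJ x"
| "qK (- x) = - qK x"

primcorec minus_quat where
  "qRe (x - y) = qRe x - qRe y"
| "qI (x - y) = qI x - qI y"
| "qJ (x - y) = qJ x - qJ y"
| "qK (x - y) = qK x - qK y"

instance
  by standard (simp_all add: quat_eq_iff)

end

instantiation quat :: ring_1
begin

primcorec one_quat where
  "qRe 1 = 1" | "qI 1 = 0" | "qJ 1 = 0" | "qK 1 = 0"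

primcorec times_quat where
  "qRe (x * y) = qRe x * qRe y - qI x * qI y - qJ x * qJ y - qK x * qK y"
| "qI (x * y) = qRe x * qI y + qI x * qRe y + qJ x * qK y - qK x * qJ y"
| "qJ (x * y) = qRe x * qJ y - qI x * qK y + qJ x * qRe y + qK x * qI y"
| "qK (x * y) = qRe x * qK y + qI x * qJ y - qJ x * qI y + qK x * qRe y"

instance
  by standard (simp_all add: quat_eq_iff algebra_simps)

end

primcorec qcnj :: "quat \<Rightarrow> quat" where
  "qRe (qcnj x) = qRe x"
| "qI (qcnj x) = - qI x"
| "qJ (qcnj x) = - qJ x"
| "qK (qcnj x) = - qK x"

instantiation quat :: real_algebra_1
begin

primcorec scaleR_quat where
  "qRe (scaleR r x) = r * qRe x"
| "qI (scaleR r x) = r * qI x"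
| "qJ (scaleR r x) = r * qJ x"
| "qK (scaleR r x) = r * qK x"

instance
  by standard (simp_all add: quat_eq_iff algebra_simps)

end

lemma quat_sum_squares_eq_0_iff:
  "(qRe x)\<^sup>2 + (qI x)\<^sup>2 + (qJ x)\<^sup>2 + (qK x)\<^sup>2 = 0 \<longleftrightarrow> x = 0"
proof
  assume *: "(qRe x)\<^sup>2 + (qI x)\<^sup>2 + (qJ x)\<^sup>2 + (qK x)\<^sup>2 = 0"
  have "0 \<le> (qRe x)\<^sup>2" "0 \<le> (qI x)\<^sup>2" "0 \<le> (qJ x)\<^sup>2" "0 \<le> (qK x)\<^sup>2"
    by simp_all
  with * have "(qRe x)\<^sup>2 = 0" "(qI x)\<^sup>2 = 0" "(qJ x)\<^sup>2 = 0" "(qK x)\<^sup>2 = 0"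
    by linarith+
  then show "x = 0" by (simp add: quat_eq_iff)
qed simp

instantiation quat :: division_ring
begin

definition inverse_quat :: "quat \<Rightarrow> quat" where
  "inverse x = qcnj x /\<^sub>R ((qRe x)\<^sup>2 + (qI x)\<^sup>2 + (qJ x)\<^sup>2 + (qK x)\<^sup>2)"

definition divide_quat :: "quat \<Rightarrow> quat \<Rightarrow> quat" where
  "divide_quat x y = x * inverse y"

instance
proof
  fix x y :: quat
  define s where "s = (qRe x)\<^sup>2 + (qI x)\<^sup>2 + (qJ x)\<^sup>2 + (qK x)\<^sup>2"
  have inv: "inverse x = qcnj x /\<^sub>R s"
    by (simp add: inverse_quat_def s_def)
  have c: "qcnj x * x = of_real s" "x * qcnj x = of_real s"
    by (simp_all add: quat_eq_iff of_real_def s_def power2_eq_square)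
  {
    assume "x \<noteq> 0"
    then have "s \<noteq> 0" using quat_sum_squares_eq_0_iff[of x] by (simp add: s_def)
    then show "inverse x * x = 1" "x * inverse x = 1"
      by (simp_all add: inv c of_real_def)
  }
  show "x div y = x * inverse y" by (rule divide_quat_def)
  show "inverse 0 = (0::quat)" by (simp add: inverse_quat_def quat_eq_iff)
qed

end

instantiation quat :: real_inner
begin

definition inner_quat :: "quat \<Rightarrow> quat \<Rightarrow> real" where
  "inner_quat x y = qRe x * qRe y + qI x * qI y + qJ x * qJ y + qK x * qK y"

definition norm_quat :: "quat \<Rightarrow> real" where
  "norm_quat x = sqrt ((qRe x)\<^sup>2 + (qI x)\<^sup>2 + (qJ x)\<^sup>2 + (qK x)\<^sup>2)"

definition sgn_quat :: "quat \<Rightarrow> quat" where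
  "sgn_quat x = x /\<^sub>R norm x"

definition dist_quat :: "quat \<Rightarrow> quat \<Rightarrow> real" where
  "dist_quat x y = norm (x - y)"

definition uniformity_quat :: "(quat \<times> quat) filter" where
  "uniformity_quat = (INF e\<in>{0 <..}. principal {(x, y). dist x y < e})"

definition open_quat :: "quat set \<Rightarrow> bool" where
  "open_quat U \<longleftrightarrow> (\<forall>x\<in>U. eventually (\<lambda>(x', y). x' = x \<longrightarrow> y \<in> U) uniformity)"

instance
proof
  fix x y z :: quat and r :: real
  show "inner x y = inner y x"
    by (simp add: inner_quat_def mult.commute)
  show "inner (x + y) z = inner x z + inner y z"
    by (simp add: inner_quat_def algebra_simps)
  show "inner (scaleR r x) y = r * inner x y"
    by (simp add: inner_quat_def algebra_simps)
  show "0 \<le> inner x x"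
    by (simp add: inner_quat_def)
  show "inner x x = 0 \<longleftrightarrow> x = 0"
    using quat_sum_squares_eq_0_iff[of x] by (simp add: inner_quat_def power2_eq_square)
  show "norm x = sqrt (inner x x)"
    by (simp add: inner_quat_def norm_quat_def power2_eq_square)
qed (rule sgn_quat_def dist_quat_def open_quat_def uniformity_quat_def)+

end

instance quat :: real_normed_div_algebra
proof
  fix x y :: quat
  show "norm (x * y) = norm x * norm y"
    by (simp add: norm_quat_def real_sqrt_mult [symmetric] power2_eq_square algebra_simps)
qed

definition imag_units :: "quat set" where
  "imag_units = {u. qRe u = 0 \<and> norm u = 1}"

lemma imag_units_square:
  assumes "u \<in> imag_units"
  shows "u * u = -1"
proof -
  have "(qI u)\<^sup>2 + (qJ u)\<^sup>2 + (qK u)\<^sup>2 = 1"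
    using assms by (auto simp: imag_units_def norm_quat_def)
  then show ?thesis
    using assms by (simp add: imag_units_def quat_eq_iff power2_eq_square)
qed

text \<open>
  For an imaginary unit \<open>u\<close> the plane \<open>\<real> + \<real>u\<close> is identified with the type \<^typ>\<open>complex\<close> through the field isomorphism
  \<open>slice_emb u\<close>; its unit circle becomes \<open>sphere 0 1\<close>, and \<open>e\<^bsup>u\<theta>\<^esup>\<close> becomes \<open>cis \<theta>\<close>.
\<close>

definition slice_emb :: "quat \<Rightarrow> complex \<Rightarrow> quat" where
  "slice_emb u z = of_real (Re z) + of_real (Im z) * u"

text \<open>
  For orthogonal imaginary units \<open>u\<close>, \<open>v\<close> the quaternions \<open>1, u, v, u * v\<close> form an orthonormal
  basis, which gives the coordinates of \<open>p = p\<^sup>1 + p\<^sup>2 v\<close>.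
\<close>

definition coord1 :: "quat \<Rightarrow> quat \<Rightarrow> complex" where
  "coord1 u p = Complex (qRe p) (p \<bullet> u)"

definition coord2 :: "quat \<Rightarrow> quat \<Rightarrow> quat \<Rightarrow> complex" where
  "coord2 u v p = Complex (p \<bullet> v) (p \<bullet> (u * v))"

lemma coord_basis:
  assumes "u \<in> imag_units" "v \<in> imag_units" "orthogonal u v"
  shows "1 \<bullet> u = 0" "1 \<bullet> v = 0" "u \<bullet> v = 0" "u \<bullet> u = 1" "v \<bullet> v = 1"
    and "1 \<bullet> (u * v) = 0" "u \<bullet> (u * v) = 0" "v \<bullet> (u * v) = 0" "(u * v) \<bullet> (u * v) = 1"
proof -
  have re: "qRe u = 0" "qRe v = 0" and n: "norm u = 1" "norm v = 1"
    using assms(1,2) by (simp_all add: imag_units_def)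
  show uv: "u \<bullet> v = 0" using assms(3) by (simp add: orthogonal_def)
  show "1 \<bullet> u = 0" "1 \<bullet> v = 0" using re by (simp_all add: inner_quat_def)
  show "u \<bullet> u = 1" "v \<bullet> v = 1" using n by (simp_all add: norm_eq_1)
  show "1 \<bullet> (u * v) = 0" using uv re by (simp add: inner_quat_def)
  show "u \<bullet> (u * v) = 0" "v \<bullet> (u * v) = 0"
    using re by (simp_all add: inner_quat_def algebra_simps)
  have "norm (u * v) = 1" using n by (simp add: norm_mult)
  then show "(u * v) \<bullet> (u * v) = 1" by (simp add: norm_eq_1)
qed

lemma coord_unique:
  assumes "u \<in> imag_units" "v \<in> imag_units" "orthogonal u v"
    and "p = slice_emb u a + slice_emb u b * v"
  shows "a = coord1 u p" "b = coord2 u v p"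
proof -
  note basis = coord_basis[OF assms(1-3)]
  define w where "w = u * v"
  note basis' = basis[folded w_def]
  have p: "p = Re a *\<^sub>R 1 + Im a *\<^sub>R u + Re b *\<^sub>R v + Im b *\<^sub>R w"
    using assms(4) by (simp add: slice_emb_def of_real_def algebra_simps w_def)
  have re: "qRe x = 1 \<bullet> x" for x by (simp add: inner_quat_def)
  have one: "1 \<bullet> (1::quat) = 1" by (simp add: inner_quat_def)
  note com = basis'(3)[THEN trans[OF inner_commute]] basis'(7)[THEN trans[OF inner_commute]]
    basis'(8)[THEN trans[OF inner_commute]]
  show "a = coord1 u p"
    by (simp add: coord1_def re p inner_add_left inner_add_right complex_eq_iff basis' one com)
  show "b = coord2 u v p"
    unfolding coord2_def w_def[symmetric]
    by (simp add: p inner_add_left complex_eq_iff basis' com)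
qed

lemma coord_exists:
  assumes "u \<in> imag_units" "v \<in> imag_units" "orthogonal u v"
  shows "p = slice_emb u (coord1 u p) + slice_emb u (coord2 u v p) * v"
proof -
  note basis = coord_basis[OF assms]
  define w where "w = u * v"
  note basis' = basis[folded w_def]
  define q where "q = slice_emb u (coord1 u p) + slice_emb u (coord2 u v p) * v"
  define r where "r = p - q"
  have "coord1 u p = coord1 u q" "coord2 u v p = coord2 u v q"
    using coord_unique[OF assms q_def] by auto
  then have r: "qRe r = 0" "r \<bullet> u = 0" "r \<bullet> v = 0" "r \<bullet> w = 0"
    by (simp_all add: coord1_def coord2_def w_def r_def inner_diff_left)
  have re: "qRe u = 0" "qRe v = 0"
    using assms(1,2) by (simp_all add: imag_units_def)
  have "(r \<bullet> w)\<^sup>2 =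
      (r \<bullet> r) * ((u \<bullet> u) * (v \<bullet> v) - (u \<bullet> v)\<^sup>2) - (r \<bullet> u) * ((r \<bullet> u) * (v \<bullet> v) - (u \<bullet> v) * (r \<bullet> v))
      + (r \<bullet> v) * ((r \<bullet> u) * (u \<bullet> v) - (u \<bullet> u) * (r \<bullet> v))"
    using r(1) re by (simp add: w_def inner_quat_def power2_eq_square algebra_simps)
  then have "r \<bullet> r = 0" by (simp add: r basis)
  then show ?thesis by (simp add: r_def q_def)
qed


section \<open>Positive definite sequences\<close>

definition toeplitz_form :: "(int \<Rightarrow> quat) \<Rightarrow> nat \<Rightarrow> (nat \<Rightarrow> quat) \<Rightarrow> quat" where
  "toeplitz_form c n \<xi> = (\<Sum>k\<le>n. \<Sum>l\<le>n. qcnj (\<xi> k) * c (int l - int k) * \<xi> l)"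

definition positive_definite_seq :: "(int \<Rightarrow> quat) \<Rightarrow> bool" where
  "positive_definite_seq c \<longleftrightarrow> (\<forall>n \<xi>. toeplitz_form c n \<xi> \<in> \<real>\<^sub>\<ge>\<^sub>0)"

definition nontrivial_positive_definite_seq :: "(int \<Rightarrow> quat) \<Rightarrow> bool" where
  "nontrivial_positive_definite_seq c \<longleftrightarrow>
     positive_definite_seq c \<and>
     (\<forall>n \<xi>. (\<exists>k\<le>n. \<xi> k \<noteq> 0) \<longrightarrow> toeplitz_form c n \<xi> \<in> \<real>\<^sub>\<ge>\<^sub>0 - {0})"


section \<open>Verblunsky coefficients\<close>

text \<open>
  A power series \<open>\<Sum>p\<^sup>n a\<^sub>n\<close> with right coefficients is represented by the formal power series of its
  coefficients. Multiplication and inverse of \<^typ>\<open>quat fps\<close> are then exactly the star product and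
  the (two-sided) star inverse.
\<close>

definition caratheodory_series :: "(int \<Rightarrow> quat) \<Rightarrow> quat fps" where
  "caratheodory_series c = 1 + 2 * Abs_fps (\<lambda>n. if n = 0 then 0 else c (- int n))"

definition quat_schur_function :: "quat fps \<Rightarrow> bool" where
  "quat_schur_function f \<longleftrightarrow>
     (\<forall>p::quat. norm p < 1 \<longrightarrow>
        summable (\<lambda>n. p ^ n * fps_nth f n) \<and> norm (\<Sum>n. p ^ n * fps_nth f n) \<le> 1)"

definition schur_algorithm :: "(nat \<Rightarrow> quat fps) \<Rightarrow> (nat \<Rightarrow> quat) \<Rightarrow> bool" where
  "schur_algorithm f \<gamma> \<longleftrightarrow>
     (\<forall>n. \<gamma> n = fps_nth (f n) 0 \<and>
          fps_X * f (Suc n) =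
            (f n - fps_const (\<gamma> n)) * inverse (1 - fps_const (qcnj (\<gamma> n)) * f n))"

definition verblunsky_coefficients :: "(int \<Rightarrow> quat) \<Rightarrow> (nat \<Rightarrow> quat) \<Rightarrow> bool" where
  "verblunsky_coefficients c \<gamma> \<longleftrightarrow>
     (\<exists>f. quat_schur_function (f 0) \<and>
          caratheodory_series c = (1 + fps_X * f 0) * inverse (1 - fps_X * f 0) \<and>
          schur_algorithm f \<gamma>)"


section \<open>Vector measures and their integrals\<close>

definition vector_measure :: "'a measure \<Rightarrow> ('a set \<Rightarrow> 'b::real_normed_vector) \<Rightarrow> bool" where
  "vector_measure S \<mu> \<longleftrightarrow>
     (\<forall>A::nat \<Rightarrow> 'a set. range A \<subseteq> sets S \<longrightarrow> disjoint_family A \<longrightarrow>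
        (\<lambda>n. \<mu> (A n)) sums \<mu> (\<Union>n. A n))"

text \<open>
  A finite signed measure \<open>\<mu>\<close> on the \<open>\<sigma>\<close>-algebra of \<open>S\<close> has Jordan decomposition \<open>\<mu>\<^sup>+ - \<mu>\<^sup>-\<close> with
  \<open>\<mu>\<^sup>+(A) = sup {\<mu>(B) | B \<subseteq> A}\<close> and \<open>\<mu>\<^sup>- = (-\<mu>)\<^sup>+\<close>. The map \<^const>\<open>ennreal\<close> sends negative reals to
  \<open>0\<close>, which does not change this supremum because \<open>\<mu>\<close> vanishes on the empty set. The measure
  already carried by \<open>S\<close> plays no role.
\<close>

definition positive_variation :: "'a measure \<Rightarrow> ('a set \<Rightarrow> real) \<Rightarrow> 'a measure" where
  "positive_variation S \<mu> =
     measure_of (space S) (sets S) (\<lambda>A. SUP B\<in>{B \<in> sets S. B \<subseteq> A}. ennreal (\<mu> B))"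

definition signed_integral :: "'a measure \<Rightarrow> ('a set \<Rightarrow> real) \<Rightarrow> ('a \<Rightarrow> complex) \<Rightarrow> complex" where
  "signed_integral S \<mu> f =
     integral\<^sup>L (positive_variation S \<mu>) f -
     integral\<^sup>L (positive_variation S (\<lambda>A. - \<mu> A)) f"

definition complex_integral :: "'a measure \<Rightarrow> ('a set \<Rightarrow> complex) \<Rightarrow> ('a \<Rightarrow> complex) \<Rightarrow> complex" where
  "complex_integral S \<mu> f =
     signed_integral S (\<lambda>A. Re (\<mu> A)) f + \<i> * signed_integral S (\<lambda>A. Im (\<mu> A)) f"


section \<open>Measures on the circle\<close>

definition circle :: "complex measure" where
  "circle = restrict_space borel (sphere 0 1)"

text \<open>Normalised arc length \<open>d\<theta>/2\<pi>\<close>.\<close>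

definition angle_measure :: "real measure" where
  "angle_measure = uniform_measure lborel {0..2 * pi}"

definition arc_measure :: "complex measure" where
  "arc_measure = distr angle_measure circle cis"

text \<open>\<open>\<integral> e\<^bsup>in\<theta>\<^esup> d\<mu>(\<theta>)\<close>\<close>

definition circle_moment :: "(complex set \<Rightarrow> complex) \<Rightarrow> int \<Rightarrow> complex" where
  "circle_moment \<mu> n = complex_integral circle \<mu> (\<lambda>z. z powi n)"

definition quat_moment :: "quat \<Rightarrow> quat \<Rightarrow> (complex set \<Rightarrow> quat) \<Rightarrow> int \<Rightarrow> quat" where
  "quat_moment u v \<mu> n =
     slice_emb u (circle_moment (\<lambda>A. coord1 u (\<mu> A)) n) +
     slice_emb u (circle_moment (\<lambda>A. coord2 u v (\<mu> A)) n) * v"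

definition psd_matrix :: "complex^2^2 \<Rightarrow> bool" where
  "psd_matrix P \<longleftrightarrow> (\<forall>\<xi>::complex^2. (\<Sum>a\<in>UNIV. \<Sum>b\<in>UNIV. cnj (\<xi> $ a) * P $ a $ b * \<xi> $ b) \<in> \<real>\<^sub>\<ge>\<^sub>0)"

definition corresponding_matrix_measure ::
  "quat \<Rightarrow> quat \<Rightarrow> (complex set \<Rightarrow> quat) \<Rightarrow> (complex set \<Rightarrow> complex^2^2) \<Rightarrow> bool" where
  "corresponding_matrix_measure u v \<mu> M \<longleftrightarrow>
     (\<exists>\<nu>. vector_measure circle \<nu> \<and>
        (\<forall>n. circle_moment \<nu> n = circle_moment (\<lambda>A. coord1 u (\<mu> A)) (- n)) \<and>
        (\<forall>A\<in>sets circle. M A =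
           vector [vector [coord1 u (\<mu> A), coord2 u v (\<mu> A)],
                   vector [cnj (coord2 u v (\<mu> A)), \<nu> A]]))"

definition q_positive :: "quat \<Rightarrow> quat \<Rightarrow> (complex set \<Rightarrow> quat) \<Rightarrow> bool" where
  "q_positive u v \<mu> \<longleftrightarrow>
     vector_measure circle \<mu> \<and>
     (\<forall>A\<in>sets circle. coord1 u (\<mu> A) \<in> \<real>\<^sub>\<ge>\<^sub>0) \<and>
     (\<forall>n. circle_moment (\<lambda>A. coord2 u v (\<mu> A)) n = - circle_moment (\<lambda>A. coord2 u v (\<mu> A)) (- n)) \<and>
     (\<exists>M. corresponding_matrix_measure u v \<mu> M \<and> (\<forall>A\<in>sets circle. psd_matrix (M A)))"

text \<open>\<open>W\<close> is the density of the absolutely continuous part in the Lebesgue decomposition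
  \<open>dM = W d\<theta>/2\<pi> + dM\<^sub>s\<close>.\<close>

definition rn_derivative :: "(complex set \<Rightarrow> complex^2^2) \<Rightarrow> (complex \<Rightarrow> complex^2^2) \<Rightarrow> bool" where
  "rn_derivative M W \<longleftrightarrow>
     integrable arc_measure W \<and>
     (\<exists>Ms. vector_measure circle Ms \<and>
        (\<exists>N\<in>null_sets arc_measure. \<forall>A\<in>sets circle. A \<inter> N = {} \<longrightarrow> Ms A = 0) \<and>
        (\<forall>A\<in>sets circle. M A = set_lebesgue_integral arc_measure A W + Ms A))"


section \<open>Logarithmic integrals\<close>

definition ln_ereal :: "real \<Rightarrow> ereal" where
  "ln_ereal x = (if x > 0 then ereal (ln x) else - \<infinity>)"

definition exp_ereal :: "ereal \<Rightarrow> ereal" where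
  "exp_ereal x = (case x of ereal r \<Rightarrow> ereal (exp r) | PInfty \<Rightarrow> \<infinity> | MInfty \<Rightarrow> 0)"

text \<open>Integral of the positive part minus integral of the negative part.\<close>

definition ereal_integral :: "'a measure \<Rightarrow> ('a \<Rightarrow> ereal) \<Rightarrow> ereal" where
  "ereal_integral S f =
     enn2ereal (\<integral>\<^sup>+x. e2ennreal (f x) \<partial>S) - enn2ereal (\<integral>\<^sup>+x. e2ennreal (- f x) \<partial>S)"

text \<open>
  \<open>\<integral> log det W(e\<^bsup>i\<theta>\<^esup>) d\<theta>/2\<pi>\<close>. The density of a positive matrix measure is positive semidefinite
  almost everywhere, so its determinant is real and nonnegative there.
\<close>

definition log_det_integral :: "(complex \<Rightarrow> complex^2^2) \<Rightarrow> ereal" where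
  "log_det_integral W = ereal_integral angle_measure (\<lambda>\<theta>. ln_ereal (Re (det (W (cis \<theta>)))))"

end

theory Submission
  imports Defs "HOL-Complex_Analysis.Complex_Analysis"
begin

text \<open>
  Positive definiteness of \<open>c\<close> makes multiplication by \<open>f\<close> a strict contraction on the Toeplitz
  truncations, and the Schur algorithm preserves this. On a slice, \<open>\<chi>\<^sub>i\<close> turns the iterates
  \<open>f\<^sub>n\<close> into analytic contractive matrix functions \<open>A\<^sub>n\<close> of size two. A Schur step factors
  \<open>det (1 - A\<^sub>n A\<^sub>n\<^sup>*)\<close> as \<open>(1 - |\<gamma>\<^sub>n|\<^sup>2)\<^sup>2 det (1 - |z|\<^sup>2 A\<^sub>n\<^sub>+\<^sub>1 A\<^sub>n\<^sub>+\<^sub>1\<^sup>*)\<close> up to \<open>|d|\<^sup>2\<close>, where \<open>d\<close> is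
  analytic, zero-free and \<open>d(0) = 1\<close>, so that \<open>ln |d|\<close> has mean \<open>0\<close> on circles. Hence
  the mean of \<open>ln det (1 - r\<^sup>2 A\<^sub>0 A\<^sub>0\<^sup>*)\<close> over \<open>|z| = r\<close> tends to \<open>\<Sum> 2 ln (1 - |\<gamma>\<^sub>n|\<^sup>2)\<close> as \<open>r\<close> grows to \<open>1\<close>, and it
  equals the mean of \<open>ln det\<close> of the Poisson integral of \<open>M\<close>. By concavity of \<open>ln det\<close>
  this mean is at least the integral of \<open>ln det W\<close>; the converse bound in the limit is the upper semicontinuity
  of the entropy, obtained by testing against continuous matrix functions. The frame \<open>i, j\<close>
  does not enter the product, which gives the second claim.
\<close>

unbundle no vec_syntax
unbundle fps_syntax

section \<open>Contractive quaternionic power series\<close>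

text \<open>The Schur step relates 1 - A_n A_n^H to 1 - |z|^2 A_(n+1) A_(n+1)^H (^H is the adjoint).
  The factor |z|^2 occurs on one side only, so the means over |z| = r do not telescope. One
  direction survives by monotonicity of the determinant. In the other a correction \<delta> times
  the identity is carried along, which grows with n but vanishes for fixed n as r tends to 1. The
  two bounds therefore use opposite limits: r to 1 at fixed n bounds the entropy by every partial
  sum, while n to infinity at fixed r gives the reverse, provided \<gamma> tends to 0, which holds
  once the product is positive. Contractivity is kept as a statement on finite truncations: positive
  definiteness enters there directly and no convergence is involved. The star product lets the
  variable commute with the coefficients, so putting the central matrix z 1 for the variable turns
  it into the matrix product. In the semicontinuity step the singular part of M must not count. The
  test function is therefore nearly the inverse of the regularised density off the singular set, and
  a small multiple of the identity on it.\<close>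

lemma qcnj_simps [simp]: "qcnj 0 = 0" "qcnj 1 = 1" "qcnj (qcnj x) = x"
  "qcnj (x + y) = qcnj x + qcnj y" "qcnj (x - y) = qcnj x - qcnj y" "qcnj (- x) = - qcnj x"
  by (simp_all add: quat_eq_iff)

lemma qcnj_mult: "qcnj (x * y) = qcnj y * qcnj x"
  by (simp add: quat_eq_iff algebra_simps)

lemma inner_quat_alt: "x \<bullet> y = qRe (qcnj y * x)"
  by (simp add: inner_quat_def algebra_simps)

lemma inner_mult_left_quat: "(g * x) \<bullet> y = x \<bullet> (qcnj g * y)" for g x y :: quat
  by (simp add: inner_quat_def algebra_simps)

lemma qcnj_mult_self: "qcnj x * x = of_real ((norm x)\<^sup>2)" "x * qcnj x = of_real ((norm x)\<^sup>2)"
  by (simp_all add: quat_eq_iff norm_quat_def power2_eq_square of_real_def)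

lemma norm_qcnj [simp]: "norm (qcnj x) = norm x"
  by (simp add: norm_quat_def)

lemma qRe_commute: "qRe (x * y) = qRe (y * x)"
  by (simp add: algebra_simps)

lemma qRe_sum: "qRe (sum f A) = (\<Sum>x\<in>A. qRe (f x))"
  by (induction A rule: infinite_finite_induct) auto

lemma quat_nonneg_Reals_iff: "x \<in> \<real>\<^sub>\<ge>\<^sub>0 \<longleftrightarrow> qI x = 0 \<and> qJ x = 0 \<and> qK x = 0 \<and> qRe x \<ge> 0"
  for x :: quat
proof
  assume "x \<in> \<real>\<^sub>\<ge>\<^sub>0"
  then show "qI x = 0 \<and> qJ x = 0 \<and> qK x = 0 \<and> qRe x \<ge> 0"
    by (auto simp: nonneg_Reals_def of_real_def)
next
  assume "qI x = 0 \<and> qJ x = 0 \<and> qK x = 0 \<and> qRe x \<ge> 0"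
  then have "x = of_real (qRe x)" "qRe x \<ge> 0" by (simp_all add: quat_eq_iff of_real_def)
  then show "x \<in> \<real>\<^sub>\<ge>\<^sub>0" by (metis nonneg_Reals_of_real_iff)
qed

section \<open>Truncated power series and strict contractivity\<close>

definition tnorm :: "nat \<Rightarrow> quat fps \<Rightarrow> real" where
  "tnorm n \<xi> = (\<Sum>k\<le>n. (norm (\<xi> $ k))\<^sup>2)"

definition tinner :: "nat \<Rightarrow> quat fps \<Rightarrow> quat fps \<Rightarrow> real" where
  "tinner n \<xi> \<eta> = (\<Sum>k\<le>n. (\<xi> $ k) \<bullet> (\<eta> $ k))"

definition tvanish :: "nat \<Rightarrow> quat fps \<Rightarrow> bool" where
  "tvanish n \<xi> \<longleftrightarrow> (\<forall>k\<le>n. \<xi> $ k = 0)"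

text \<open>A finite-dimensional form of the Schur class: the first n + 1 coefficients stand for a
  vector of H^(n+1), with squared norm \<open>tnorm n\<close>, and left multiplication by
  \<open>f\<close> acts on it as a lower triangular Toeplitz matrix. All these matrices are required
  to be strict contractions.\<close>

definition strictly_contractive :: "quat fps \<Rightarrow> bool" where
  "strictly_contractive f \<longleftrightarrow> (\<forall>n \<xi>. \<not> tvanish n \<xi> \<longrightarrow> tnorm n (f * \<xi>) < tnorm n \<xi>)"

lemma tnorm_eq_tinner: "tnorm n \<xi> = tinner n \<xi> \<xi>"
  by (simp add: tnorm_def tinner_def dot_square_norm)

lemma tinner_algebra:
  "tinner n (a + b) c = tinner n a c + tinner n b c"
  "tinner n (a - b) c = tinner n a c - tinner n b c"
  "tinner n a (b + c) = tinner n a b + tinner n a c"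
  "tinner n a (b - c) = tinner n a b - tinner n a c"
  by (simp_all add: tinner_def inner_add_left inner_add_right inner_diff_left inner_diff_right
      sum.distrib sum_subtractf)

lemma tinner_commute: "tinner n a b = tinner n b a"
  by (simp add: tinner_def inner_commute)

lemma tinner_fps_const: "tinner n (fps_const g * a) b = tinner n a (fps_const (qcnj g) * b)"
  by (simp add: tinner_def inner_mult_left_quat)

lemma tnorm_fps_const: "tnorm n (fps_const g * a) = (norm g)\<^sup>2 * tnorm n a"
  by (simp add: tnorm_def norm_mult power_mult_distrib sum_distrib_left)

lemma tvanish_mult: "tvanish n \<xi> \<Longrightarrow> tvanish n (u * \<xi>)"
  by (auto simp: tvanish_def fps_mult_nth intro!: sum.neutral)

lemma tvanish_unit_mult_iff:
  assumes "u' * u = 1"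
  shows "tvanish n (u * \<xi>) \<longleftrightarrow> tvanish n \<xi>"
proof
  assume "tvanish n (u * \<xi>)"
  then have "tvanish n (u' * (u * \<xi>))" by (rule tvanish_mult)
  then show "tvanish n \<xi>" using assms by (simp add: mult.assoc [symmetric])
qed (rule tvanish_mult)

lemma tnorm_fps_X_mult: "tnorm (Suc n) (fps_X * \<xi>) = tnorm n \<xi>"
proof -
  have "tnorm (Suc n) (fps_X * \<xi>) = (\<Sum>k=0..Suc n. (norm ((fps_X * \<xi>) $ k))\<^sup>2)"
    by (simp add: tnorm_def atMost_atLeast0)
  also have "\<dots> = (\<Sum>k=0..n. (norm ((fps_X * \<xi>) $ Suc k))\<^sup>2)"
    by (subst sum.atLeast0_atMost_Suc_shift) (simp add: comp_def)
  finally show ?thesis by (simp add: tnorm_def atMost_atLeast0)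
qed

text \<open>The Cayley transform and the Schur algorithm both control \<open>fps_X * f\<close>
  instead of \<open>f\<close>. Nothing is lost: the shift moves degrees 0..n into 1..n+1, so the
  bound for \<open>f\<close> at n is the bound for \<open>fps_X * f\<close> at n + 1.\<close>

lemma strictly_contractive_from_shift:
  assumes "\<And>n \<xi>. \<not> tvanish n \<xi> \<Longrightarrow> tnorm n (fps_X * f * \<xi>) < tnorm n \<xi>"
  shows "strictly_contractive f"
  unfolding strictly_contractive_def
proof (intro allI impI)
  fix n \<xi> assume nv: "\<not> tvanish n \<xi>"
  \<comment> \<open>Cutting \<open>\<xi>\<close> off above degree n makes its norm at n + 1 equal to
    that at n; otherwise the coefficient of degree n + 1 would spoil the right-hand side.\<close>
  define \<eta> where "\<eta> = Abs_fps (\<lambda>k. if k \<le> n then \<xi> $ k else 0)"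
  have "tvanish n (f * (\<xi> - \<eta>))"
    by (rule tvanish_mult) (simp add: tvanish_def \<eta>_def)
  then have "(f * \<xi>) $ k = (f * \<eta>) $ k" if "k \<le> n" for k
    using that by (simp add: tvanish_def right_diff_distrib)
  then have "tnorm n (f * \<xi>) = tnorm n (f * \<eta>)"
    by (simp add: tnorm_def)
  also have "\<dots> = tnorm (Suc n) (fps_X * f * \<eta>)"
    by (simp add: tnorm_fps_X_mult mult.assoc)
  also have "\<dots> < tnorm (Suc n) \<eta>"
  proof (rule assms)
    show "\<not> tvanish (Suc n) \<eta>" using nv by (auto simp: tvanish_def \<eta>_def)
  qed
  also have "\<dots> = tnorm n \<xi>" by (simp add: tnorm_def \<eta>_def)
  finally show "tnorm n (f * \<xi>) < tnorm n \<xi>" .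
qed

lemma strictly_contractive_tnorm_le: "strictly_contractive f \<Longrightarrow> tnorm n (f * \<xi>) \<le> tnorm n \<xi>"
proof (cases "tvanish n \<xi>")
  case True
  then show ?thesis using tvanish_mult[OF True, of f] by (simp add: tvanish_def tnorm_def)
qed (auto simp: strictly_contractive_def intro: less_imp_le)

lemma strictly_contractive_norm_0:
  assumes "strictly_contractive f"
  shows "norm (f $ 0) < 1"
proof -
  have "tnorm 0 (f * 1) < tnorm 0 1"
    using assms unfolding strictly_contractive_def by (simp add: tvanish_def del: mult_1_right)
  then show ?thesis by (simp add: tnorm_def abs_square_less_1)
qed

lemma strictly_contractive_norm_nth_le:
  assumes "strictly_contractive f"
  shows "norm (f $ n) \<le> 1"
proof -
  have "(norm (f $ n))\<^sup>2 \<le> tnorm n (f * 1)"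
    unfolding tnorm_def by simp (rule member_le_sum, auto)
  also have "\<dots> \<le> tnorm n 1"
    by (rule strictly_contractive_tnorm_le[OF assms])
  also have "tnorm n 1 = (\<Sum>k\<le>n. if k = 0 then 1 else 0)"
    unfolding tnorm_def by (rule sum.cong) auto
  also have "\<dots> = 1" by (subst sum.delta) auto
  finally show ?thesis by (simp add: abs_square_le_1)
qed

text \<open>The Moebius identity in vector form. For \<open>\<xi> = u * \<eta>\<close> both
  \<open>tnorm n \<xi>\<close> and \<open>tnorm n (fps_X * f' * \<xi>)\<close> expand with the same
  cross term, so their difference is (1 - |\<gamma>|^2) times
  \<open>tnorm n \<eta> - tnorm n (f * \<eta>)\<close>.\<close>

lemma schur_step_strictly_contractive:
  assumes f: "strictly_contractive f" and \<gamma>: "\<gamma> = f $ 0"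
    and step: "fps_X * f' * (1 - fps_const (qcnj \<gamma>) * f) = f - fps_const \<gamma>"
  shows "strictly_contractive f'"
proof (rule strictly_contractive_from_shift)
  fix n \<xi> assume nv: "\<not> tvanish n \<xi>"
  define u where "u = 1 - fps_const (qcnj \<gamma>) * f"
  have g1: "norm \<gamma> < 1" using strictly_contractive_norm_0[OF f] \<gamma> by simp
  have u0: "u $ 0 = of_real (1 - (norm \<gamma>)\<^sup>2)"
    by (simp add: u_def \<gamma> qcnj_mult_self)
  have "(norm \<gamma>)\<^sup>2 < 1" using g1 by (simp add: abs_square_less_1)
  then have "u $ 0 \<noteq> 0" unfolding u0 of_real_eq_0_iff by simp
  then have inv: "u * inverse u = 1" "inverse u * u = 1"
    by (simp_all add: inverse_mult_eq_1 inverse_mult_eq_1')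
  define \<eta> where "\<eta> = inverse u * \<xi>"
  have \<xi>: "\<xi> = u * \<eta>" by (simp add: \<eta>_def mult.assoc [symmetric] inv)
  have nv': "\<not> tvanish n \<eta>"
    using nv tvanish_mult unfolding \<xi> by blast
  have "fps_X * f' * \<xi> = fps_X * f' * u * \<eta>"
    by (simp only: \<xi> mult.assoc)
  also have "\<dots> = f * \<eta> - fps_const \<gamma> * \<eta>"
    by (simp only: u_def step left_diff_distrib)
  finally have "fps_X * f' * \<xi> = f * \<eta> - fps_const \<gamma> * \<eta>" .
  then have 1: "tnorm n (fps_X * f' * \<xi>) =
      tnorm n (f * \<eta>) - 2 * tinner n (f * \<eta>) (fps_const \<gamma> * \<eta>) + (norm \<gamma>)\<^sup>2 * tnorm n \<eta>"
    by (simp add: tnorm_fps_const[symmetric])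
       (simp add: tnorm_eq_tinner tinner_algebra tinner_commute)
  have "\<xi> = \<eta> - fps_const (qcnj \<gamma>) * (f * \<eta>)"
    by (simp add: \<xi> u_def left_diff_distrib mult.assoc)
  moreover have "tinner n \<eta> (fps_const (qcnj \<gamma>) * (f * \<eta>)) = tinner n (f * \<eta>) (fps_const \<gamma> * \<eta>)"
    by (metis tinner_fps_const tinner_commute)
  moreover have "tnorm n (fps_const (qcnj \<gamma>) * (f * \<eta>)) = (norm \<gamma>)\<^sup>2 * tnorm n (f * \<eta>)"
    by (simp add: tnorm_fps_const)
  ultimately have 2: "tnorm n \<xi> =
      tnorm n \<eta> - 2 * tinner n (f * \<eta>) (fps_const \<gamma> * \<eta>) + (norm \<gamma>)\<^sup>2 * tnorm n (f * \<eta>)"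
    by (simp add: tnorm_eq_tinner tinner_algebra tinner_commute)
  have "tnorm n (f * \<eta>) < tnorm n \<eta>" using f nv' by (auto simp: strictly_contractive_def)
  then have "(1 - (norm \<gamma>)\<^sup>2) * (tnorm n \<eta> - tnorm n (f * \<eta>)) > 0"
    using \<open>(norm \<gamma>)\<^sup>2 < 1\<close> by simp
  then show "tnorm n (fps_X * f' * \<xi>) < tnorm n \<xi>"
    unfolding 1 2 by (simp add: algebra_simps)
qed

section \<open>From positive definiteness to contractive Schur iterates\<close>

lemma positive_definite_hermitian:
  assumes "positive_definite_seq c"
  shows "c (- n) = qcnj (c n)"
proof -
  have pos: "c (- int n) = qcnj (c (int n))" for n :: nat
  proof (cases "n = 0")
    case True
    have "toeplitz_form c 0 (\<lambda>_. 1) \<in> \<real>\<^sub>\<ge>\<^sub>0"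
      using assms by (simp add: positive_definite_seq_def)
    then show ?thesis using True
      by (simp add: toeplitz_form_def quat_nonneg_Reals_iff quat_eq_iff)
  next
    case False
    have form: "toeplitz_form c n (\<lambda>k. if k = 0 then 1 else if k = n then w else 0) =
        c 0 + c (int n) * w + (qcnj w * c (- int n) + qcnj w * c 0 * w)" for w
    proof -
      let ?\<xi> = "\<lambda>k. if k = 0 then 1 else if k = n then w else 0"
      have "toeplitz_form c n ?\<xi> = (\<Sum>k\<in>{0,n}. \<Sum>l\<le>n. qcnj (?\<xi> k) * c (int l - int k) * ?\<xi> l)"
        unfolding toeplitz_form_def by (rule sum.mono_neutral_right) auto
      also have "\<dots> = (\<Sum>k\<in>{0,n}. \<Sum>l\<in>{0,n}. qcnj (?\<xi> k) * c (int l - int k) * ?\<xi> l)"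
        by (rule sum.cong[OF refl], rule sum.mono_neutral_right) auto
      also have "\<dots> = c 0 + c (int n) * w + (qcnj w * c (- int n) + qcnj w * c 0 * w)"
        using False by simp
      finally show ?thesis .
    qed
    have "toeplitz_form c 0 (\<lambda>_. 1) \<in> \<real>\<^sub>\<ge>\<^sub>0"
      using assms by (simp add: positive_definite_seq_def)
    then have c0: "qI (c 0) = 0" "qJ (c 0) = 0" "qK (c 0) = 0"
      by (auto simp: toeplitz_form_def quat_nonneg_Reals_iff)
    have *: "c 0 + c (int n) * w + (qcnj w * c (- int n) + qcnj w * c 0 * w) \<in> \<real>\<^sub>\<ge>\<^sub>0" for w
      unfolding form[symmetric] using assms by (simp add: positive_definite_seq_def)
    \<comment> \<open>Reality of the form at w = 1 settles the imaginary components of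
      \<open>c (- int n)\<close>, and at an imaginary unit the real one.\<close>
    from *[of 1] *[of "Quat 0 1 0 0"] *[of "Quat 0 0 1 0"]
    show ?thesis
      by (simp add: quat_nonneg_Reals_iff quat_eq_iff c0 qcnj.code)
  qed
  show ?thesis
  proof (cases "n \<ge> 0")
    case True
    then show ?thesis using pos[of "nat n"] by simp
  next
    case False
    then show ?thesis using pos[of "nat (- n)"] by simp
  qed
qed

text \<open>Multiplication by the Caratheodory series is the lower triangular matrix with diagonal 1
  and entries 2 c(l - k) below it. Its Hermitian part is the Toeplitz matrix of \<open>c\<close>,
  which is why the coefficients carry the factor 2.\<close>

lemma tinner_caratheodory:
  assumes herm: "\<And>n. c (- n) = qcnj (c n)" and c0: "c 0 = 1"
  shows "tinner n (caratheodory_series c * \<xi>) \<xi> = qRe (toeplitz_form c n (fps_nth \<xi>))"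
proof -
  define s where "s k l = qRe (qcnj (\<xi> $ k) * c (int l - int k) * \<xi> $ l)" for k l
  have sym: "s k l = s l k" for k l
  proof -
    have "s l k = qRe (qcnj (qcnj (\<xi> $ l) * c (int k - int l) * \<xi> $ k))" by (simp add: s_def)
    also have "\<dots> = s k l"
      using herm[of "int k - int l"] by (simp add: qcnj_mult s_def mult.assoc del: times_quat.simps)
    finally show ?thesis by simp
  qed
  have F: "caratheodory_series c $ m = (if m = 0 then 1 else 2 * c (- int m))" for m
    by (simp add: caratheodory_series_def fps_numeral_nth numeral_fps_const)
  have row: "((caratheodory_series c * \<xi>) $ k) \<bullet> (\<xi> $ k) = s k k + 2 * (\<Sum>l<k. s k l)" for k
  proof -
    have "(caratheodory_series c * \<xi>) $ k = (\<Sum>l=0..k. caratheodory_series c $ (k - l) * \<xi> $ l)"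
      unfolding fps_mult_nth by (rule sum.reindex_bij_witness[of _ "\<lambda>i. k - i" "\<lambda>i. k - i"]) auto
    also have "\<dots> = (\<Sum>l<k. caratheodory_series c $ (k - l) * \<xi> $ l) + \<xi> $ k"
      by (simp add: F atLeast0AtMost lessThan_Suc_atMost[symmetric])
    also have "(\<Sum>l<k. caratheodory_series c $ (k - l) * \<xi> $ l) = (\<Sum>l<k. 2 * (c (int l - int k) * \<xi> $ l))"
      by (rule sum.cong) (auto simp: F of_nat_diff mult.assoc)
    also have "(\<Sum>l<k. 2 * (c (int l - int k) * \<xi> $ l)) = 2 *\<^sub>R (\<Sum>l<k. c (int l - int k) * \<xi> $ l)"
      by (simp add: scaleR_2 mult_2 sum.distrib)
    finally have "((caratheodory_series c * \<xi>) $ k) \<bullet> (\<xi> $ k) =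
        2 * (\<Sum>l<k. (c (int l - int k) * \<xi> $ l) \<bullet> (\<xi> $ k)) + (\<xi> $ k) \<bullet> (\<xi> $ k)"
      by (simp only: inner_add_left inner_scaleR_left inner_sum_left)
    moreover have "(c (int l - int k) * \<xi> $ l) \<bullet> (\<xi> $ k) = s k l" for l
      by (simp only: inner_quat_alt s_def mult.assoc)
    moreover have "(\<xi> $ k) \<bullet> (\<xi> $ k) = s k k"
      by (simp only: inner_quat_alt s_def c0 mult_1_right diff_self)
    ultimately show ?thesis by simp
  qed
  have "qRe (toeplitz_form c n (fps_nth \<xi>)) = (\<Sum>k\<le>n. \<Sum>l\<le>n. s k l)"
    by (simp add: toeplitz_form_def qRe_sum s_def del: times_quat.simps)
  \<comment> \<open>The square sum is folded along its diagonal by the symmetry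
    \<open>sym\<close>.\<close>
  also have "\<dots> = (\<Sum>k\<le>n. s k k + 2 * (\<Sum>l<k. s k l))"
  proof (induction n)
    case (Suc n)
    have "(\<Sum>k\<le>Suc n. \<Sum>l\<le>Suc n. s k l) =
        (\<Sum>k\<le>n. \<Sum>l\<le>n. s k l) + (\<Sum>k\<le>n. s k (Suc n)) + (\<Sum>l\<le>n. s (Suc n) l) + s (Suc n) (Suc n)"
      by (simp add: sum.distrib)
    also have "(\<Sum>k\<le>n. s k (Suc n)) = (\<Sum>l\<le>n. s (Suc n) l)" by (simp add: sym)
    finally show ?case using Suc by (simp add: lessThan_Suc_atMost)
  qed auto
  also have "\<dots> = tinner n (caratheodory_series c * \<xi>) \<xi>"
    by (simp add: tinner_def row)
  finally show ?thesis by simp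
qed

text \<open>The Cayley transform: with \<open>\<xi>\<close> = (1 - X f) \<eta> the series maps
  \<open>\<xi>\<close> to (1 + X f) \<eta>, and the real inner product of these two is
  \<open>tnorm n \<eta> - tnorm n (fps_X * f * \<eta>)\<close>. By non-triviality it is
  positive.\<close>

lemma strictly_contractive_initial:
  assumes c: "nontrivial_positive_definite_seq c" and c0: "c 0 = 1"
    and F: "caratheodory_series c * (1 - fps_X * f) = 1 + fps_X * f"
  shows "strictly_contractive f"
proof (rule strictly_contractive_from_shift)
  fix n \<eta> assume nv: "\<not> tvanish n \<eta>"
  define u where "u = 1 - fps_X * f"
  have pd: "positive_definite_seq c" using c by (simp add: nontrivial_positive_definite_seq_def)
  have "u $ 0 \<noteq> 0" by (simp add: u_def)
  then have inv: "inverse u * u = 1" by (simp add: inverse_mult_eq_1)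
  define \<xi> where "\<xi> = u * \<eta>"
  have "\<not> tvanish n \<xi>" using nv by (simp add: \<xi>_def tvanish_unit_mult_iff[OF inv])
  then have "toeplitz_form c n (fps_nth \<xi>) \<in> \<real>\<^sub>\<ge>\<^sub>0 - {0}"
    using c by (auto simp: nontrivial_positive_definite_seq_def tvanish_def)
  then have pos: "qRe (toeplitz_form c n (fps_nth \<xi>)) > 0"
    by (auto simp: quat_nonneg_Reals_iff quat_eq_iff)
  have "caratheodory_series c * \<xi> = (1 + fps_X * f) * \<eta>"
    by (simp only: \<xi>_def u_def mult.assoc [symmetric] F)
  then have "tinner n (caratheodory_series c * \<xi>) \<xi> =
      tinner n (\<eta> + fps_X * f * \<eta>) (\<eta> - fps_X * f * \<eta>)"
    by (simp add: \<xi>_def u_def distrib_right left_diff_distrib)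
  also have "\<dots> = tnorm n \<eta> - tnorm n (fps_X * f * \<eta>)"
    by (simp add: tnorm_eq_tinner tinner_algebra tinner_commute)
  finally show "tnorm n (fps_X * f * \<eta>) < tnorm n \<eta>"
    using pos tinner_caratheodory[OF positive_definite_hermitian[OF pd] c0, of n \<xi>] by simp
qed

text \<open>The recursion is stated with denominators cleared and the unknown \<open>f n\<close> on
  the right, so that evaluation on a slice involves only sums and products. Clearing them requires
  |\<gamma>| < 1, which the induction on contractivity supplies step by step.\<close>

lemma verblunsky_recursion:
  assumes c: "nontrivial_positive_definite_seq c" and c0: "c 0 = 1"
    and "verblunsky_coefficients c \<gamma>"
  obtains f where "\<And>n. strictly_contractive (f n)" "\<And>n. \<gamma> n = f n $ 0"
    "caratheodory_series c * (1 - fps_X * f 0) = 1 + fps_X * f 0"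
    "\<And>n. (1 + fps_X * f (Suc n) * fps_const (qcnj (\<gamma> n))) * f n = fps_const (\<gamma> n) + fps_X * f (Suc n)"
proof -
  obtain f where F: "caratheodory_series c = (1 + fps_X * f 0) * inverse (1 - fps_X * f 0)"
    and S: "schur_algorithm f \<gamma>"
    using assms(3) unfolding verblunsky_coefficients_def by blast
  have F': "caratheodory_series c * (1 - fps_X * f 0) = 1 + fps_X * f 0"
    unfolding F by (simp add: mult.assoc inverse_mult_eq_1)
  have \<gamma>: "\<gamma> n = f n $ 0" for n using S by (simp add: schur_algorithm_def)
  have step: "fps_X * f (Suc n) * (1 - fps_const (qcnj (\<gamma> n)) * f n) = f n - fps_const (\<gamma> n)"
    if "norm (\<gamma> n) < 1" for n
  proof -
    let ?u = "1 - fps_const (qcnj (\<gamma> n)) * f n"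
    have "(norm (\<gamma> n))\<^sup>2 < 1" using that by (simp add: abs_square_less_1)
    moreover have u0: "?u $ 0 = of_real (1 - (norm (\<gamma> n))\<^sup>2)"
      by (simp add: \<gamma>[symmetric] qcnj_mult_self)
    ultimately have "?u $ 0 \<noteq> 0" unfolding u0 of_real_eq_0_iff by simp
    then have "inverse ?u * ?u = 1" by (rule inverse_mult_eq_1)
    then show ?thesis using S by (simp add: schur_algorithm_def mult.assoc)
  qed
  have con: "strictly_contractive (f n)" for n
  proof (induction n)
    case 0
    show ?case by (rule strictly_contractive_initial[OF c c0 F'])
  next
    case (Suc n)
    have "norm (\<gamma> n) < 1" using strictly_contractive_norm_0[OF Suc] \<gamma> by simp
    then show ?case by (rule schur_step_strictly_contractive[OF Suc \<gamma> step])
  qed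
  have "(1 + fps_X * f (Suc n) * fps_const (qcnj (\<gamma> n))) * f n = fps_const (\<gamma> n) + fps_X * f (Suc n)" for n
  proof -
    have "norm (\<gamma> n) < 1" using strictly_contractive_norm_0[OF con] \<gamma> by simp
    from step[OF this] show ?thesis by (simp add: algebra_simps)
  qed
  then show ?thesis using that con \<gamma> F' by blast
qed

text \<open>Solving the recursion for \<open>f n\<close> shows that its coefficient of degree m + 1
  is the coefficient of degree m of \<open>f (Suc n)\<close>, up to an error of (m + 1) |\<gamma>
  n|, since all coefficients have norm at most 1. The degree thus drops while the index
  rises.\<close>

lemma schur_functions_nth_tendsto_0:
  assumes con: "\<And>n. strictly_contractive (f n)" and \<gamma>: "\<And>n. \<gamma> n = f n $ 0"
    and rec: "\<And>n. (1 + fps_X * f (Suc n) * fps_const (qcnj (\<gamma> n))) * f n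
       = fps_const (\<gamma> n) + fps_X * f (Suc n)"
    and lim: "\<gamma> \<longlonglongrightarrow> 0"
  shows "(\<lambda>n. f n $ m) \<longlonglongrightarrow> 0"
proof (induction m)
  case 0
  then show ?case using lim by (simp add: \<gamma>[symmetric])
next
  case (Suc m)
  have bound: "norm (f n $ Suc m) \<le> norm (f (Suc n) $ m) + real (Suc m) * norm (\<gamma> n)" for n
  proof -
    let ?t = "f (Suc n) * (fps_const (qcnj (\<gamma> n)) * f n)"
    have "f n = fps_const (\<gamma> n) + fps_X * (f (Suc n) - ?t)"
      using rec[of n] by (simp add: algebra_simps)
    then have "f n $ Suc m = (fps_const (\<gamma> n) + fps_X * (f (Suc n) - ?t)) $ Suc m" by simp
    then have "f n $ Suc m = f (Suc n) $ m - ?t $ m" by simp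
    then have "norm (f n $ Suc m) \<le> norm (f (Suc n) $ m) + norm (?t $ m)"
      by (simp add: norm_triangle_ineq4)
    also have "norm (?t $ m) \<le> (\<Sum>i=0..m. norm (f (Suc n) $ i * (qcnj (\<gamma> n) * f n $ (m - i))))"
      unfolding fps_mult_nth[of "f (Suc n)"] fps_mult_left_const_nth by (rule norm_sum)
    also have "\<dots> \<le> (\<Sum>i=0..m. norm (\<gamma> n))"
    proof (rule sum_mono)
      fix i
      have "norm (f (Suc n) $ i) * (norm (\<gamma> n) * norm (f n $ (m - i))) \<le> 1 * (norm (\<gamma> n) * 1)"
        by (intro mult_mono strictly_contractive_norm_nth_le con) auto
      then show "norm (f (Suc n) $ i * (qcnj (\<gamma> n) * f n $ (m - i))) \<le> norm (\<gamma> n)"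
        by (simp add: norm_mult)
    qed
    finally show ?thesis by simp
  qed
  have "(\<lambda>n. norm (f (Suc n) $ m) + real (Suc m) * norm (\<gamma> n)) \<longlonglongrightarrow> 0 + real (Suc m) * 0"
    using LIMSEQ_Suc[OF Suc] lim by (intro tendsto_intros tendsto_norm_zero)
  then show ?case
    using bound by (intro Lim_null_comparison[where f="\<lambda>n. f n $ Suc m"]) auto
qed

section \<open>Hermitian matrices of size two\<close>

text \<open>
  The triple \<open>(a, d, b)\<close> stands for the Hermitian matrix with diagonal \<open>a, d\<close> and upper right entry
  \<open>b\<close>; \<open>hpair\<close> is the trace of the product and \<open>hadj\<close> the adjugate.
\<close>

type_synonym htriple = "real \<times> real \<times> complex"

definition hdet :: "htriple \<Rightarrow> real" where
  "hdet X = fst X * fst (snd X) - (cmod (snd (snd X)))\<^sup>2"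

definition htr :: "htriple \<Rightarrow> real" where
  "htr X = fst X + fst (snd X)"

definition hpair :: "htriple \<Rightarrow> htriple \<Rightarrow> real" where
  "hpair X Y = fst X * fst Y + fst (snd X) * fst (snd Y) + 2 * Re (snd (snd X) * cnj (snd (snd Y)))"

definition hpsd :: "htriple \<Rightarrow> bool" where
  "hpsd X \<longleftrightarrow> 0 \<le> fst X \<and> 0 \<le> fst (snd X) \<and> (cmod (snd (snd X)))\<^sup>2 \<le> fst X * fst (snd X)"

definition hone :: htriple where
  "hone = (1, 1, 0)"

definition hadj :: "htriple \<Rightarrow> htriple" where
  "hadj X = (fst (snd X), fst X, - snd (snd X))"

lemma hdet_scaleR: "hdet (t *\<^sub>R X) = t\<^sup>2 * hdet X"
  by (simp add: hdet_def power2_eq_square algebra_simps)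

lemma hpsd_scaleR: "hpsd X \<Longrightarrow> t \<ge> 0 \<Longrightarrow> hpsd (t *\<^sub>R X)"
  by (auto simp: hpsd_def power_mult_distrib power2_eq_square mult.left_commute mult_left_mono mult.assoc)

lemma hpsd_hone [simp]: "hpsd hone" and hdet_hone [simp]: "hdet hone = 1" and htr_hone [simp]: "htr hone = 2"
  by (simp_all add: hpsd_def hdet_def hone_def htr_def)

lemma htr_add [simp]: "htr (X + Y) = htr X + htr Y"
  and htr_diff [simp]: "htr (X - Y) = htr X - htr Y"
  and htr_scaleR [simp]: "htr (t *\<^sub>R X) = t * htr X"
  by (simp_all add: htr_def algebra_simps)

lemma htr_nonneg: "hpsd X \<Longrightarrow> htr X \<ge> 0"
  by (simp add: hpsd_def htr_def)

lemma hdet_nonneg: "hpsd X \<Longrightarrow> hdet X \<ge> 0"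
  by (simp add: hpsd_def hdet_def)

lemma hpair_add_left: "hpair (X + Y) Z = hpair X Z + hpair Y Z"
  and hpair_scaleR_left: "hpair (t *\<^sub>R X) Z = t * hpair X Z"
  and hpair_add_right: "hpair Z (X + Y) = hpair Z X + hpair Z Y"
  and hpair_scaleR_right: "hpair Z (t *\<^sub>R X) = t * hpair Z X"
  and hpair_hone: "hpair hone X = htr X"
  by (simp_all add: hpair_def hone_def htr_def algebra_simps)

lemma hpsd_hadj: "hpsd X \<Longrightarrow> hpsd (hadj X)"
  and hdet_hadj: "hdet (hadj X) = hdet X"
  and htr_hadj: "htr (hadj X) = htr X"
  and hpair_hadj_self: "hpair (hadj X) X = 2 * hdet X"
  by (simp_all add: hpsd_def hdet_def hadj_def htr_def hpair_def mult.commute cmod_power2)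
     (simp_all add: power2_eq_square algebra_simps)

lemma hdet_add: "hdet (X + Y) = hdet X + hdet Y + hpair X (hadj Y)"
proof -
  have *: "(cmod (a + b))\<^sup>2 = (cmod a)\<^sup>2 + (cmod b)\<^sup>2 + 2 * Re (a * cnj b)" for a b
    unfolding cmod_power2 by (simp add: power2_eq_square algebra_simps)
  show ?thesis by (simp add: hdet_def hpair_def hadj_def * algebra_simps)
qed

text \<open>The arithmetic-geometric mean inequality for the eigenvalues of the product of two
  positive matrices, proved on entries: the ordinary inequality handles the diagonals and a
  Cauchy-Schwarz estimate the rest.\<close>

lemma hpair_ge:
  assumes X: "hpsd X" and Y: "hpsd Y"
  shows "2 * sqrt (hdet X * hdet Y) \<le> hpair X Y"
proof -
  obtain a d b where Xe: "X = (a, d, b)" by (cases X)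
  obtain a' d' b' where Ye: "Y = (a', d', b')" by (cases Y)
  define p q where "p = a * d" and "q = a' * d'"
  define u v where "u = cmod b" and "v = cmod b'"
  have nn: "0 \<le> a" "0 \<le> d" "0 \<le> a'" "0 \<le> d'" "u\<^sup>2 \<le> p" "v\<^sup>2 \<le> q" "0 \<le> u" "0 \<le> v"
    using X Y by (auto simp: hpsd_def Xe Ye p_def q_def u_def v_def)
  have pq: "0 \<le> p" "0 \<le> q" using nn by (auto simp: p_def q_def)
  define s where "s = sqrt ((p - u\<^sup>2) * (q - v\<^sup>2))"
  have s0: "0 \<le> s" and s2: "s\<^sup>2 = (p - u\<^sup>2) * (q - v\<^sup>2)"
    using nn by (auto simp: s_def)
  \<comment> \<open>Cauchy-Schwarz for the vectors (u, sqrt (p - u^2)) and (v, sqrt (q - v^2)),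
    whose squared lengths are p and q.\<close>
  have "u * v + s \<le> sqrt (p * q)"
  proof (rule real_le_rsqrt)
    have "2 * (u * v * s) \<le> (q - v\<^sup>2) * u\<^sup>2 + (p - u\<^sup>2) * v\<^sup>2"
    proof -
      have sq: "sqrt (q - v\<^sup>2) * sqrt (p - u\<^sup>2) = s"
        by (simp add: s_def real_sqrt_mult mult.commute)
      have "0 \<le> (sqrt (q - v\<^sup>2) * u - sqrt (p - u\<^sup>2) * v)\<^sup>2" by simp
      also have "\<dots> = (q - v\<^sup>2) * u\<^sup>2 + (p - u\<^sup>2) * v\<^sup>2 - 2 * (u * v * (sqrt (q - v\<^sup>2) * sqrt (p - u\<^sup>2)))"
        using nn by (simp add: power2_diff power_mult_distrib)
      finally show ?thesis unfolding sq by simp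
    qed
    moreover have "(u * v + s)\<^sup>2 = u\<^sup>2 * v\<^sup>2 + 2 * (u * v * s) + s\<^sup>2"
      by (simp add: power2_sum power_mult_distrib)
    ultimately show "(u * v + s)\<^sup>2 \<le> p * q"
      unfolding s2 by (simp add: algebra_simps)
  qed
  moreover have "2 * sqrt (p * q) \<le> a * a' + d * d'"
  proof -
    have "p * q = (a * a') * (d * d')" by (simp add: p_def q_def)
    then show ?thesis using arith_geo_mean_sqrt[of "a * a'" "d * d'"] nn by simp
  qed
  moreover have "Re (b * cnj b') \<ge> - (u * v)"
    using complex_Re_le_cmod[of "- (b * cnj b')"] by (simp add: norm_mult u_def v_def)
  ultimately have "2 * s \<le> a * a' + d * d' + 2 * Re (b * cnj b')" by linarith
  then show ?thesis by (simp add: hpair_def hdet_def Xe Ye s_def p_def q_def u_def v_def)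
qed

lemma hpair_nonneg: "hpsd X \<Longrightarrow> hpsd Y \<Longrightarrow> hpair X Y \<ge> 0"
  using hpair_ge[of X Y] hdet_nonneg[of X] hdet_nonneg[of Y]
  by (meson mult_nonneg_nonneg order_trans real_sqrt_ge_zero zero_le_numeral)

lemma hdet_add_ge: "hpsd X \<Longrightarrow> hpsd Y \<Longrightarrow> hdet X + hdet Y \<le> hdet (X + Y)"
  using hpair_nonneg[of X "hadj Y"] hpsd_hadj[of Y] by (simp add: hdet_add)

lemma hpsd_add: "hpsd X \<Longrightarrow> hpsd Y \<Longrightarrow> hpsd (X + Y)"
  using hdet_add_ge[of X Y] hdet_nonneg[of X] hdet_nonneg[of Y]
  by (auto simp: hpsd_def hdet_def)

lemma hdet_mono:
  assumes "hpsd X" "hpsd (Y - X)" shows "hdet X \<le> hdet Y"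
  using hdet_add_ge[OF assms] hdet_nonneg[OF assms(2)] by simp

lemma hpsd_htr_bound: "hpsd X \<Longrightarrow> hpsd (htr X *\<^sub>R hone - X)"
  by (auto simp: hpsd_def htr_def hone_def algebra_simps)

text \<open>The tangent bound expressing concavity of ln det. Equality holds when \<open>Y\<close>
  is the inverse of \<open>X\<close>, so ln det is the minimum of the right-hand sides; every later
  comparison of entropies chooses a suitable \<open>Y\<close>.\<close>

lemma ln_hdet_le:
  assumes X: "hpsd X" "hdet X > 0" and Y: "hpsd Y" "hdet Y > 0"
  shows "ln (hdet X) \<le> hpair Y X - 2 - ln (hdet Y)"
proof -
  define s where "s = sqrt (hdet Y * hdet X)"
  have s: "s > 0" "s\<^sup>2 = hdet Y * hdet X" using assms by (auto simp: s_def)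
  have "ln (hdet X) + ln (hdet Y) = ln (s\<^sup>2)" unfolding s(2) using assms by (simp add: ln_mult_pos)
  also have "\<dots> = 2 * ln s" unfolding ln_realpow by simp
  also have "\<dots> \<le> 2 * (s - 1)" using ln_le_minus_one[OF s(1)] by simp
  finally have "ln (hdet X) + ln (hdet Y) \<le> 2 * s - 2" by simp
  moreover have "2 * s \<le> hpair Y X" unfolding s_def by (rule hpair_ge) (use assms in auto)
  ultimately show ?thesis by simp
qed

lemma hpsd_quadratic_form:
  assumes "\<And>x y :: complex. 0 \<le> (cmod x)\<^sup>2 * a + (cmod y)\<^sup>2 * d + 2 * Re (x * b * cnj y)"
  shows "hpsd (a, d, b)"
proof -
  have a: "0 \<le> a" using assms[of 1 0] by simp
  have d: "0 \<le> d" using assms[of 0 1] by simp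
  \<comment> \<open>The form at x = cnj b, y = -t. Below, t = |b|^2 / d is the minimiser for d > 0,
    and t = a + 1 yields a negative value if d = 0 and b is not 0.\<close>
  have 1: "0 \<le> (cmod b)\<^sup>2 * a + t\<^sup>2 * d - 2 * (t * (cmod b)\<^sup>2)" for t :: real
    using assms[of "cnj b" "- of_real t"]
    unfolding cmod_power2 by (simp add: power2_eq_square algebra_simps)
  have "(cmod b)\<^sup>2 \<le> a * d"
  proof (cases "d = 0")
    case True
    show ?thesis
    proof (rule ccontr)
      assume "\<not> ?thesis"
      then have "(cmod b)\<^sup>2 > 0" using True by simp
      then show False using 1[of "a + 1"] True a by (simp add: algebra_simps)
          (smt (verit) mult_nonneg_nonneg zero_le_power2 zero_less_power2 norm_eq_zero)
    qed
  next
    case False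
    then have d: "d > 0" using d by simp
    show ?thesis
      using 1[of "(cmod b)\<^sup>2 / d"] d by (cases "b = 0") (auto simp: field_simps power2_eq_square a)
  qed
  with a d show ?thesis by (simp add: hpsd_def)
qed

section \<open>Complex matrices of size two\<close>

text \<open>
  The type \<open>complex^2^2\<close> is not used here because its multiplication \<open>*\<close> is entrywise.
\<close>

codatatype m2 = M2 (m11: complex) (m12: complex) (m21: complex) (m22: complex)

lemma m2_eq_iff: "x = y \<longleftrightarrow> m11 x = m11 y \<and> m12 x = m12 y \<and> m21 x = m21 y \<and> m22 x = m22 y"
  by (auto intro: m2.expand)

instantiation m2 :: ring_1
begin

primcorec zero_m2 where
  "m11 0 = 0" | "m12 0 = 0" | "m21 0 = 0" | "m22 0 = 0"

primcorec one_m2 where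
  "m11 1 = 1" | "m12 1 = 0" | "m21 1 = 0" | "m22 1 = 1"

primcorec plus_m2 where
  "m11 (x + y) = m11 x + m11 y"
| "m12 (x + y) = m12 x + m12 y"
| "m21 (x + y) = m21 x + m21 y"
| "m22 (x + y) = m22 x + m22 y"

primcorec uminus_m2 where
  "m11 (- x) = - m11 x"
| "m12 (- x) = - m12 x"
| "m21 (- x) = - m21 x"
| "m22 (- x) = - m22 x"

primcorec minus_m2 where
  "m11 (x - y) = m11 x - m11 y"
| "m12 (x - y) = m12 x - m12 y"
| "m21 (x - y) = m21 x - m21 y"
| "m22 (x - y) = m22 x - m22 y"

primcorec times_m2 where
  "m11 (x * y) = m11 x * m11 y + m12 x * m21 y"
| "m12 (x * y) = m11 x * m12 y + m12 x * m22 y"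
| "m21 (x * y) = m21 x * m11 y + m22 x * m21 y"
| "m22 (x * y) = m21 x * m12 y + m22 x * m22 y"

instance
  by standard (simp_all add: m2_eq_iff algebra_simps)

end

primcorec madj :: "m2 \<Rightarrow> m2" where
  "m11 (madj x) = cnj (m11 x)"
| "m12 (madj x) = cnj (m21 x)"
| "m21 (madj x) = cnj (m12 x)"
| "m22 (madj x) = cnj (m22 x)"

definition mdet :: "m2 \<Rightarrow> complex" where
  "mdet x = m11 x * m22 x - m12 x * m21 x"

definition mscalar :: "complex \<Rightarrow> m2" where
  "mscalar c = M2 c 0 0 c"

text \<open>The Hermitian part (x + x^H) / 2 encoded as a triple; on Hermitian matrices it is
  inverse to \<open>hmat\<close>.\<close>

definition hpart :: "m2 \<Rightarrow> htriple" where
  "hpart x = (Re (m11 x), Re (m22 x), (m12 x + cnj (m21 x)) / 2)"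

definition hgram :: "m2 \<Rightarrow> htriple" where
  "hgram x = hpart (x * madj x)"

definition hmat :: "htriple \<Rightarrow> m2" where
  "hmat X = M2 (of_real (fst X)) (snd (snd X)) (cnj (snd (snd X))) (of_real (fst (snd X)))"

definition hcong :: "m2 \<Rightarrow> htriple \<Rightarrow> htriple" where
  "hcong u X = hpart (u * hmat X * madj u)"

lemma madj_simps [simp]: "madj (x + y) = madj x + madj y" "madj (x - y) = madj x - madj y"
  "madj (x * y) = madj y * madj x" "madj 1 = 1" "madj (madj x) = x" "madj (mscalar c) = mscalar (cnj c)"
  by (simp_all add: m2_eq_iff mscalar_def)

lemma mscalar_commute: "x * mscalar c = mscalar c * x"
  by (simp add: m2_eq_iff mscalar_def)

lemma mscalar_mult: "mscalar c * mscalar d = mscalar (c * d)"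
  by (simp add: m2_eq_iff mscalar_def)

lemma mscalar_eq_1 [simp]: "mscalar 1 = 1"
  by (simp add: m2_eq_iff mscalar_def)

lemma hpart_simps: "hpart (x + y) = hpart x + hpart y" "hpart (x - y) = hpart x - hpart y"
  "hpart (mscalar (of_real t) * x) = t *\<^sub>R hpart x" "hpart 1 = hone" "hpart (hmat X) = X"
  "hpart (madj x) = hpart x"
  by (simp_all add: hpart_def mscalar_def hone_def hmat_def complex_eq_iff add_divide_distrib
      diff_divide_distrib right_diff_distrib distrib_left)

lemma hmat_simps: "hmat (X + Y) = hmat X + hmat Y" "hmat (X - Y) = hmat X - hmat Y"
   "hmat (t *\<^sub>R X) = mscalar (of_real t) * hmat X" "hmat hone = 1"
  by (simp_all add: m2_eq_iff mscalar_def hone_def hmat_def scaleR_conv_of_real)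

lemma madj_eq_selfD:
  assumes "madj x = x"
  shows "Im (m11 x) = 0" "Im (m22 x) = 0" "m21 x = cnj (m12 x)"
proof -
  have "m11 (madj x) = m11 x" "m22 (madj x) = m22 x" "m21 (madj x) = m21 x"
    by (simp_all only: assms)
  then show "Im (m11 x) = 0" "Im (m22 x) = 0" "m21 x = cnj (m12 x)"
    unfolding madj.simps by (simp_all add: complex_eq_iff)
qed

lemma hmat_hpart:
  assumes "madj x = x"
  shows "hmat (hpart x) = x"
  by (simp add: madj_eq_selfD[OF assms] m2_eq_iff hmat_def hpart_def complex_eq_iff)

lemma hcong_add: "hcong u (X + Y) = hcong u X + hcong u Y"
  and hcong_diff: "hcong u (X - Y) = hcong u X - hcong u Y"
  by (simp_all add: hcong_def hmat_simps hpart_simps algebra_simps)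

lemma hcong_scaleR: "hcong u (t *\<^sub>R X) = t *\<^sub>R hcong u X"
proof -
  have "u * (mscalar (of_real t) * hmat X) * madj u = mscalar (of_real t) * (u * hmat X * madj u)"
    by (simp only: mult.assoc [symmetric] mscalar_commute)
  then show ?thesis by (simp add: hcong_def hmat_simps hpart_simps)
qed

lemma hcong_hone: "hcong u hone = hgram u"
  by (simp add: hcong_def hmat_simps hgram_def)

lemma hcong_hgram: "hcong u (hgram x) = hgram (u * x)"
  by (simp add: hcong_def hgram_def hmat_hpart mult.assoc)

lemma madj_hmat [simp]: "madj (hmat X) = hmat X"
  by (simp add: hmat_def m2_eq_iff)

text \<open>Congruence commutes with taking adjoints, hence with x + x^H. The identity is doubled so
  that no division of matrices is needed.\<close>

lemma hcong_hpart: "hcong u (hpart x) = hpart (u * x * madj u)"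
proof -
  have "hmat (hpart x) + hmat (hpart x) = x + madj x"
    by (simp add: m2_eq_iff hmat_def hpart_def complex_eq_iff)
  then have "u * (hmat (hpart x) + hmat (hpart x)) * madj u = u * (x + madj x) * madj u" by simp
  then have "hpart (u * hmat (hpart x) * madj u + u * hmat (hpart x) * madj u) =
     hpart (u * x * madj u + madj (u * x * madj u))"
    by (simp add: algebra_simps)
  then have "2 *\<^sub>R hpart (u * hmat (hpart x) * madj u) = 2 *\<^sub>R hpart (u * x * madj u)"
    unfolding hpart_simps by (simp add: scaleR_2)
  then show ?thesis by (simp add: hcong_def)
qed

text \<open>Multiplicativity of the complex determinant, transferred to triples because a
  self-adjoint matrix has determinant equal to the real number \<open>hdet\<close>.\<close>

lemma hdet_hcong: "hdet (hcong u X) = (cmod (mdet u))\<^sup>2 * hdet X"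
proof -
  let ?Y = "u * hmat X * madj u"
  have selfadj: "madj ?Y = ?Y" by (simp add: mult.assoc)
  have det: "mdet y = of_real (hdet (hpart y))" if "madj y = y" for y
  proof -
    show ?thesis
      unfolding mdet_def hdet_def hpart_def fst_conv snd_conv cmod_power2
      by (simp add: complex_eq_iff power2_eq_square madj_eq_selfD[OF that])
  qed
  have mult: "mdet (x * y) = mdet x * mdet y" for x y by (simp add: mdet_def algebra_simps)
  have "of_real (hdet (hpart ?Y)) = mdet ?Y" by (simp add: det[OF selfadj])
  also have "\<dots> = mdet u * cnj (mdet u) * mdet (hmat X)"
    by (simp add: mult) (simp add: mdet_def)
  also have "mdet (hmat X) = of_real (hdet X)"
    by (subst det) (simp_all add: hpart_simps)
  also have "mdet u * cnj (mdet u) = of_real ((cmod (mdet u))\<^sup>2)"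
    unfolding complex_norm_square ..
  finally show ?thesis unfolding hcong_def by (simp only: of_real_mult[symmetric] of_real_eq_iff)
qed

lemma hgram_eq: "hgram x = ((cmod (m11 x))\<^sup>2 + (cmod (m12 x))\<^sup>2, (cmod (m21 x))\<^sup>2 + (cmod (m22 x))\<^sup>2,
    m11 x * cnj (m21 x) + m12 x * cnj (m22 x))"
  unfolding cmod_power2 by (simp add: hgram_def hpart_def power2_eq_square complex_eq_iff)

lemma hpsd_hgram: "hpsd (hgram x)"
proof -
  have "hdet (hgram x) = (cmod (mdet x))\<^sup>2"
    using hdet_hcong[of x hone] by (simp add: hcong_hone)
  then have "hdet (hgram x) \<ge> 0" by simp
  then show ?thesis by (simp add: hpsd_def hdet_def hgram_eq)
qed

lemma htr_hgram: "htr (hgram x) = (cmod (m11 x))\<^sup>2 + (cmod (m12 x))\<^sup>2 + (cmod (m21 x))\<^sup>2 + (cmod (m22 x))\<^sup>2"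
  by (simp add: hgram_eq htr_def)

lemma htr_hgram_le:
  assumes "cmod (m11 x) \<le> k" "cmod (m12 x) \<le> k" "cmod (m21 x) \<le> k" "cmod (m22 x) \<le> k"
  shows "htr (hgram x) \<le> 4 * k\<^sup>2"
proof -
  have "(cmod (m11 x))\<^sup>2 \<le> k\<^sup>2" "(cmod (m12 x))\<^sup>2 \<le> k\<^sup>2" "(cmod (m21 x))\<^sup>2 \<le> k\<^sup>2" "(cmod (m22 x))\<^sup>2 \<le> k\<^sup>2"
    using assms by (auto intro!: power_mono)
  then show ?thesis by (simp add: htr_hgram)
qed

text \<open>Since 1 - t C C^H = (1 - t) 1 + t (1 - C C^H), shrinking a contraction gives a
  determinant bound that does not depend on it.\<close>

lemma hpsd_scaled_diff:
  assumes "hpsd (hone - hgram C)" "0 \<le> t" "t \<le> 1"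
  shows "hpsd (hone - t *\<^sub>R hgram C - (1 - t) *\<^sub>R hone)" "hpsd (hone - t *\<^sub>R hgram C)"
    "hdet (hone - t *\<^sub>R hgram C) \<ge> (1 - t)\<^sup>2" "hdet (hone - hgram C) \<le> hdet (hone - t *\<^sub>R hgram C)"
proof -
  have eq: "hone - t *\<^sub>R hgram C - (1 - t) *\<^sub>R hone = t *\<^sub>R (hone - hgram C)"
    by (simp add: algebra_simps)
  show 1: "hpsd (hone - t *\<^sub>R hgram C - (1 - t) *\<^sub>R hone)"
    unfolding eq using assms by (intro hpsd_scaleR)
  have 2: "hpsd ((1 - t) *\<^sub>R hone)" using assms by (intro hpsd_scaleR) auto
  show "hpsd (hone - t *\<^sub>R hgram C)"
    using hpsd_add[OF 1 2] by simp
  show "hdet (hone - t *\<^sub>R hgram C) \<ge> (1 - t)\<^sup>2"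
    using hdet_mono[OF 2 1] by (simp add: hdet_scaleR)
  have "hone - t *\<^sub>R hgram C - (hone - hgram C) = (1 - t) *\<^sub>R hgram C" by (simp add: algebra_simps)
  then have "hpsd (hone - t *\<^sub>R hgram C - (hone - hgram C))"
    using assms by (simp add: hpsd_scaleR hpsd_hgram)
  from hdet_mono[OF assms(1) this] show "hdet (hone - hgram C) \<le> hdet (hone - t *\<^sub>R hgram C)" .
qed

section \<open>One Schur step for contractive matrices at a fixed point\<close>

locale matrix_schur_step =
  fixes A B g :: m2 and z :: complex and s :: real
  assumes g: "g * madj g = mscalar (of_real s)" "madj g * g = mscalar (of_real s)"
    and s: "0 \<le> s" "s < 1" and z: "cmod z < 1"
    and A: "hpsd (hone - hgram A)" and B: "hpsd (hone - hgram B)"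
    and step: "(1 + mscalar z * B * madj g) * A = g + mscalar z * B"
begin

definition "u = 1 + mscalar z * B * madj g"
definition "v = g + mscalar z * B"

text \<open>The cross terms of u u^H and v v^H coincide, and the remaining ones combine because g
  g^H and g^H g are the scalar \<open>s\<close>. As u A = v, the left side is also u (1 - A A^H)
  u^H, which gives the determinant identity \<open>step_eq\<close>.\<close>

lemma gram_u_minus_v: "hgram u - hgram v = (1 - s) *\<^sub>R (hone - (cmod z)\<^sup>2 *\<^sub>R hgram B)"
proof -
  have zz: "mscalar z * mscalar (cnj z) = mscalar (of_real ((cmod z)\<^sup>2))"
    unfolding mscalar_mult complex_norm_square ..
  have c1: "mscalar z * B * madj g * (g * (madj B * mscalar (cnj z))) =
     mscalar (of_real s) * (mscalar (of_real ((cmod z)\<^sup>2)) * (B * madj B))"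
  proof -
    have "mscalar z * B * madj g * (g * (madj B * mscalar (cnj z))) =
        mscalar z * (B * (mscalar (of_real s) * madj B) * mscalar (cnj z))"
      by (simp only: mult.assoc flip: g(2))
    also have "\<dots> = mscalar (of_real s) * ((mscalar z * mscalar (cnj z)) * (B * madj B))"
      by (metis mscalar_commute mult.assoc)
    finally show ?thesis by (simp only: zz)
  qed
  have c2: "mscalar z * B * (madj B * mscalar (cnj z)) = mscalar (of_real ((cmod z)\<^sup>2)) * (B * madj B)"
    by (metis mscalar_commute mult.assoc zz)
  have "u * madj u - v * madj v =
     1 + mscalar z * B * madj g * (g * (madj B * mscalar (cnj z)))
      - g * madj g - mscalar z * B * (madj B * mscalar (cnj z))"
    by (simp add: u_def v_def algebra_simps)
  also have "\<dots> = mscalar (of_real (1 - s)) * (1 - mscalar (of_real ((cmod z)\<^sup>2)) * (B * madj B))"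
    unfolding c1 c2 g by (simp add: m2_eq_iff mscalar_def algebra_simps)
  finally have "hpart (u * madj u - v * madj v) =
     hpart (mscalar (of_real (1 - s)) * (1 - mscalar (of_real ((cmod z)\<^sup>2)) * (B * madj B)))"
    by (rule arg_cong)
  then show ?thesis by (simp only: hgram_def hpart_simps)
qed

lemma hcong_u_hgram_A: "hcong u (hgram A) = hgram v"
  using step by (simp add: hcong_hgram u_def v_def)

lemma step_eq: "(cmod (mdet u))\<^sup>2 * hdet (hone - hgram A) = (1 - s)\<^sup>2 * hdet (hone - (cmod z)\<^sup>2 *\<^sub>R hgram B)"
  by (simp add: hdet_hcong[symmetric] hcong_diff hcong_hone hcong_u_hgram_A gram_u_minus_v hdet_scaleR)


lemma z2: "0 \<le> (cmod z)\<^sup>2" "(cmod z)\<^sup>2 < 1"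
  using z by (auto simp: abs_square_less_1)

lemma pos_B: "hdet (hone - (cmod z)\<^sup>2 *\<^sub>R hgram B) > 0"
  using hpsd_scaled_diff(3)[OF B, of "(cmod z)\<^sup>2"] z2
  by (smt (verit) zero_less_power)

text \<open>The right side of \<open>step_eq\<close> is positive because |z| < 1 and s < 1. Absence
  of zeros is what allows ln |det u| to be averaged to 0 over circles.\<close>

lemma mdet_u_nonzero: "mdet u \<noteq> 0"
proof
  assume "mdet u = 0"
  then have "(1 - s)\<^sup>2 * hdet (hone - (cmod z)\<^sup>2 *\<^sub>R hgram B) = 0"
    using step_eq by simp
  then show False using s pos_B by simp
qed

text \<open>In \<open>step_eq\<close> the factor |z|^2 is missing in front of A A^H. Inserting it
  only increases the determinant, and then both sides have the same shape, ready for
  iteration.\<close>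

lemma step_lower:
  "2 * ln (1 - s) + ln (hdet (hone - (cmod z)\<^sup>2 *\<^sub>R hgram B))
    \<le> ln (hdet (hone - (cmod z)\<^sup>2 *\<^sub>R hgram A)) + 2 * ln (cmod (mdet u))"
proof -
  have "hdet (hone - hgram A) * (cmod (mdet u))\<^sup>2 > 0"
    using step_eq pos_B s by (simp add: mult.commute)
  then have A0: "hdet (hone - hgram A) > 0"
    using mdet_u_nonzero by (simp add: zero_less_mult_iff)
  have "ln ((cmod (mdet u))\<^sup>2 * hdet (hone - hgram A)) = 2 * ln (cmod (mdet u)) + ln (hdet (hone - hgram A))"
    using mdet_u_nonzero A0 by (simp add: ln_mult_pos ln_realpow)
  moreover have "ln ((1 - s)\<^sup>2 * hdet (hone - (cmod z)\<^sup>2 *\<^sub>R hgram B)) =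
      2 * ln (1 - s) + ln (hdet (hone - (cmod z)\<^sup>2 *\<^sub>R hgram B))"
    using s pos_B by (simp add: ln_mult_pos ln_realpow)
  moreover have "ln (hdet (hone - hgram A)) \<le> ln (hdet (hone - (cmod z)\<^sup>2 *\<^sub>R hgram A))"
    using hpsd_scaled_diff(4)[OF A, of "(cmod z)\<^sup>2"] z2 A0 by simp
  ultimately show ?thesis using step_eq by simp
qed

text \<open>Here the missing factor acts in the wrong direction. The excess of (1 + \<delta>) 1 -
  |z|^2 A A^H over 1 - A A^H is \<delta> 1 + (1 - |z|^2) A A^H. Congruence by u turns it into
  \<delta> u u^H + (1 - |z|^2) v v^H, at most k (\<delta> + 1 - |z|^2) times the identity; dividing
  by 1 - s gives \<delta>'.\<close>

lemma step_upper:
  assumes "htr (hgram u) \<le> k" "htr (hgram v) \<le> k" and \<delta>: "0 \<le> \<delta>"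
    and \<delta>': "\<delta>' = k * (\<delta> + (1 - (cmod z)\<^sup>2)) / (1 - s)"
  shows "ln (hdet ((1 + \<delta>) *\<^sub>R hone - (cmod z)\<^sup>2 *\<^sub>R hgram A)) + 2 * ln (cmod (mdet u))
    \<le> 2 * ln (1 - s) + ln (hdet ((1 + \<delta>') *\<^sub>R hone - (cmod z)\<^sup>2 *\<^sub>R hgram B))"
proof -
  let ?r = "(cmod z)\<^sup>2"
  let ?A = "(1 + \<delta>) *\<^sub>R hone - ?r *\<^sub>R hgram A"
  let ?B = "(1 + \<delta>') *\<^sub>R hone - ?r *\<^sub>R hgram B"
  have A1: "hpsd (\<delta> *\<^sub>R hone)" using \<delta> by (simp add: hpsd_scaleR)
  have A2: "?A - (hone - ?r *\<^sub>R hgram A) = \<delta> *\<^sub>R hone" by (simp add: algebra_simps)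
  have A0: "hdet ?A > 0" 
  proof -
    have "hdet (hone - ?r *\<^sub>R hgram A) \<le> hdet ?A"
      using hpsd_scaled_diff(2)[OF A, of ?r] z2 A1 by (intro hdet_mono) (auto simp: A2)
    then show ?thesis using hpsd_scaled_diff(3)[OF A, of ?r] z2
      by (smt (verit) zero_less_power)
  qed
  have psdA: "hpsd ?A"
    using hpsd_add[OF A1, of "hone - ?r *\<^sub>R hgram A"] hpsd_scaled_diff(2)[OF A, of ?r] z2
    by (simp add: algebra_simps)
  have c: "hcong u ?A = (1 - s) *\<^sub>R (hone - ?r *\<^sub>R hgram B) + \<delta> *\<^sub>R hgram u + (1 - ?r) *\<^sub>R hgram v"
    unfolding gram_u_minus_v[symmetric]
    by (simp add: hcong_add hcong_diff hcong_scaleR hcong_hone hcong_u_hgram_A algebra_simps)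
  have psdc: "hpsd (hcong u ?A)"
    unfolding c using hpsd_scaled_diff(2)[OF B, of ?r] z2 s \<delta>
    by (intro hpsd_add hpsd_scaleR hpsd_hgram) auto
  \<comment> \<open>A positive matrix is at most its trace times the identity.\<close>
  have k: "hpsd (k *\<^sub>R hone - hgram w)" if "htr (hgram w) \<le> k" for w
  proof -
    have "k *\<^sub>R hone - hgram w = (htr (hgram w) *\<^sub>R hone - hgram w) + (k - htr (hgram w)) *\<^sub>R hone"
      by (simp add: algebra_simps)
    moreover have "hpsd ((k - htr (hgram w)) *\<^sub>R hone)" using that by (simp add: hpsd_scaleR)
    ultimately show ?thesis using hpsd_add[OF hpsd_htr_bound[OF hpsd_hgram, of w]] by metis
  qed
  have "(1 - s) * \<delta>' = k * (\<delta> + (1 - ?r))" using s by (simp add: \<delta>')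
  moreover have "(1 - s) *\<^sub>R ?B = (1 - s) *\<^sub>R (hone - ?r *\<^sub>R hgram B) + ((1 - s) * \<delta>') *\<^sub>R hone"
    by (simp add: scaleR_add_left scaleR_diff_right scaleR_add_right)
  ultimately have "(1 - s) *\<^sub>R ?B = (1 - s) *\<^sub>R (hone - ?r *\<^sub>R hgram B) + (k * (\<delta> + (1 - ?r))) *\<^sub>R hone"
    by simp
  then have "(1 - s) *\<^sub>R ?B - hcong u ?A = \<delta> *\<^sub>R (k *\<^sub>R hone - hgram u) + (1 - ?r) *\<^sub>R (k *\<^sub>R hone - hgram v)"
    unfolding c by (simp add: algebra_simps)
  then have "hpsd ((1 - s) *\<^sub>R ?B - hcong u ?A)"
    using k assms(1,2) z2 \<delta> by (simp add: hpsd_add hpsd_scaleR)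
  from hdet_mono[OF psdc this]
  have le: "(cmod (mdet u))\<^sup>2 * hdet ?A \<le> (1 - s)\<^sup>2 * hdet ?B"
    by (simp add: hdet_hcong hdet_scaleR)
  have pos: "(cmod (mdet u))\<^sup>2 * hdet ?A > 0" using A0 mdet_u_nonzero by simp
  then have B0: "hdet ?B > 0" using le s
    by (smt (verit) mult_nonneg_nonpos zero_le_power2)
  have "ln ((cmod (mdet u))\<^sup>2 * hdet ?A) \<le> ln ((1 - s)\<^sup>2 * hdet ?B)"
    using le pos by simp
  then show ?thesis
    using A0 B0 mdet_u_nonzero s by (simp add: ln_mult_pos ln_realpow)
qed

end

text \<open>For y = z A the Hermitian part of (1 + y) (1 - y^H) is 1 - y y^H, because y - y^H is
  skew. This ties the Poisson integral of the measure to the first Schur function.\<close>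

lemma hcong_caratheodory:
  assumes "(1 - mscalar z * A) * F = 1 + mscalar z * A"
  shows "hcong (1 - mscalar z * A) (hpart F) = hone - (cmod z)\<^sup>2 *\<^sub>R hgram A"
proof -
  have zz: "mscalar z * mscalar (cnj z) = mscalar (of_real ((cmod z)\<^sup>2))"
    unfolding mscalar_mult complex_norm_square ..
  let ?y = "mscalar z * A"
  have "?y * madj ?y = mscalar z * (A * madj A) * mscalar (cnj z)"
    by (simp add: mult.assoc)
  also have "\<dots> = mscalar (cnj z) * (mscalar z * (A * madj A))"
    by (rule mscalar_commute)
  also have "\<dots> = mscalar (of_real ((cmod z)\<^sup>2)) * (A * madj A)"
    by (simp only: zz[symmetric] mscalar_mult mult.assoc[symmetric] mult.commute[of "cnj z"])
  finally have yy: "?y * madj ?y = mscalar (of_real ((cmod z)\<^sup>2)) * (A * madj A)" .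
  have "hcong (1 - ?y) (hpart F) = hpart ((1 - ?y) * F * madj (1 - ?y))" by (rule hcong_hpart)
  also have "\<dots> = hpart ((1 + ?y) * (1 - madj ?y))" using assms by simp
  also have "(1 + ?y) * (1 - madj ?y) = 1 + ?y - madj ?y - ?y * madj ?y"
    by (simp only: distrib_right right_diff_distrib mult_1_left mult_1_right) (simp only: add_diff_eq diff_diff_eq diff_add_eq)
  also have "hpart \<dots> = hone - (cmod z)\<^sup>2 *\<^sub>R hgram A"
    unfolding yy by (simp only: hpart_simps hgram_def) simp
  finally show ?thesis .
qed

section \<open>Coordinates in a frame and the map \<open>\<chi>\<^sub>i\<close>\<close>

locale slice_frame =
  fixes i j :: quat
  assumes i: "i \<in> imag_units" and j: "j \<in> imag_units" and ij: "orthogonal i j"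
begin

lemma slice_emb_simps:
  "slice_emb i (a + b) = slice_emb i a + slice_emb i b"
  "slice_emb i (a - b) = slice_emb i a - slice_emb i b"
  "slice_emb i (a * b) = slice_emb i a * slice_emb i b"
  "slice_emb i (cnj a) = qcnj (slice_emb i a)"
  "slice_emb i 0 = 0" "slice_emb i 1 = 1"
proof -
  have re: "qRe i = 0" using i by (simp add: imag_units_def)
  have ii: "of_real x * i * (of_real y * i) = - of_real (x * y)" for x y
    using imag_units_square[OF i] by (simp add: of_real_def)
  show "slice_emb i (a + b) = slice_emb i a + slice_emb i b"
    "slice_emb i (a - b) = slice_emb i a - slice_emb i b"
    by (simp_all add: slice_emb_def algebra_simps)
  show "slice_emb i (a * b) = slice_emb i a * slice_emb i b"
    by (simp add: slice_emb_def algebra_simps ii) (simp add: of_real_def imag_units_square[OF i] algebra_simps)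
  show "slice_emb i (cnj a) = qcnj (slice_emb i a)"
    by (simp add: slice_emb_def quat_eq_iff of_real_def re)
  show "slice_emb i 0 = 0" "slice_emb i 1 = 1" by (simp_all add: slice_emb_def)
qed

lemma slice_emb_power: "slice_emb i (a ^ n) = slice_emb i a ^ n"
  by (induction n) (simp_all add: slice_emb_simps)

lemma unit_slice_emb: "j * slice_emb i a = slice_emb i (cnj a) * j"
proof -
  have re: "qRe i = 0" "qRe j = 0" using i j by (simp_all add: imag_units_def)
  have "i \<bullet> j = 0" using ij by (simp add: orthogonal_def)
  then have "j * i = - (i * j)"
    using re by (simp add: quat_eq_iff inner_quat_def algebra_simps)
  then show ?thesis
    by (simp add: slice_emb_def algebra_simps) (simp add: of_real_def)
qed

definition c1 :: "quat \<Rightarrow> complex" where "c1 = coord1 i"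
definition c2 :: "quat \<Rightarrow> complex" where "c2 = coord2 i j"

lemma coords: "p = slice_emb i (c1 p) + slice_emb i (c2 p) * j"
  unfolding c1_def c2_def by (rule coord_exists[OF i j ij])

lemma coords_eqI: "p = slice_emb i a + slice_emb i b * j \<Longrightarrow> c1 p = a \<and> c2 p = b"
  unfolding c1_def c2_def using coord_unique[OF i j ij] by metis

lemma coords_of [simp]: "c1 (slice_emb i a + slice_emb i b * j) = a" "c2 (slice_emb i a + slice_emb i b * j) = b"
  using coords_eqI by blast+

lemma coords_slice [simp]: "c1 (slice_emb i a) = a" "c2 (slice_emb i a) = 0"
  using coords_of[of a 0] by (simp_all add: slice_emb_simps)

lemma coords_add [simp]: "c1 (p + q) = c1 p + c1 q" "c2 (p + q) = c2 p + c2 q"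
  "c1 (p - q) = c1 p - c1 q" "c2 (p - q) = c2 p - c2 q"
  "c1 0 = 0" "c2 0 = 0"  "c1 1 = 1" "c2 1 = 0"
proof -
  show "c1 (p + q) = c1 p + c1 q" "c2 (p + q) = c2 p + c2 q"
  "c1 (p - q) = c1 p - c1 q" "c2 (p - q) = c2 p - c2 q" "c1 0 = 0" "c2 0 = 0"
    by (simp_all add: c1_def c2_def coord1_def coord2_def complex_eq_iff inner_add_left inner_diff_left)
  show "c1 1 = 1" "c2 1 = 0" using coords_slice[of 1] by (simp_all add: slice_emb_simps)
qed

lemma coords_mult:
  "c1 (p * q) = c1 p * c1 q - c2 p * cnj (c2 q)" "c2 (p * q) = c1 p * c2 q + c2 p * cnj (c1 q)"
proof -
  have swap: "slice_emb i b * j * slice_emb i c = slice_emb i b * slice_emb i (cnj c) * j" for b c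
    by (simp only: mult.assoc unit_slice_emb)
  have jj: "slice_emb i b * j * j = - slice_emb i b" for b
    using imag_units_square[OF j] by (simp add: mult.assoc)
  have "p * q = (slice_emb i (c1 p) + slice_emb i (c2 p) * j) * (slice_emb i (c1 q) + slice_emb i (c2 q) * j)"
    using coords by metis
  also have "\<dots> = slice_emb i (c1 p) * slice_emb i (c1 q) + slice_emb i (c1 p) * slice_emb i (c2 q) * j
     + slice_emb i (c2 p) * j * slice_emb i (c1 q) + slice_emb i (c2 p) * j * slice_emb i (c2 q) * j"
    by (simp only: distrib_left distrib_right mult.assoc add_ac)
  also have "\<dots> = slice_emb i (c1 p * c1 q - c2 p * cnj (c2 q)) + slice_emb i (c1 p * c2 q + c2 p * cnj (c1 q)) * j"
    unfolding swap by (simp only: jj slice_emb_simps(1-3) distrib_right)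
       (simp add: algebra_simps imag_units_square[OF j])
  finally show "c1 (p * q) = c1 p * c1 q - c2 p * cnj (c2 q)" "c2 (p * q) = c1 p * c2 q + c2 p * cnj (c1 q)"
    using coords_eqI by blast+
qed

lemma coords_qcnj: "c1 (qcnj p) = cnj (c1 p)" "c2 (qcnj p) = - c2 p"
proof -
  have "qcnj p = qcnj (slice_emb i (c1 p) + slice_emb i (c2 p) * j)"
    using coords by metis
  also have "\<dots> = slice_emb i (cnj (c1 p)) + qcnj j * slice_emb i (cnj (c2 p))"
    by (simp only: qcnj_simps qcnj_mult slice_emb_simps)
  also have "qcnj j = - j" using j by (simp add: quat_eq_iff imag_units_def)
  also have "- j * slice_emb i (cnj (c2 p)) = slice_emb i (- c2 p) * j"
    using unit_slice_emb[of "cnj (c2 p)"] slice_emb_simps(2)[of 0 "c2 p"] by (simp add: slice_emb_simps)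
  finally show "c1 (qcnj p) = cnj (c1 p)" "c2 (qcnj p) = - c2 p"
    using coords_eqI by blast+
qed

lemma qRe_eq: "qRe p = Re (c1 p)"
  by (simp add: c1_def coord1_def)

lemma inner_eq: "p \<bullet> q = Re (c1 p * cnj (c1 q) + c2 p * cnj (c2 q))"
  by (simp only: inner_quat_alt qRe_commute[of "qcnj q"] qRe_eq coords_mult coords_qcnj) simp

lemma norm_eq: "(norm p)\<^sup>2 = (cmod (c1 p))\<^sup>2 + (cmod (c2 p))\<^sup>2"
  unfolding power2_norm_eq_inner[of p] inner_eq cmod_power2 by (simp add: power2_eq_square)

lemma cmod_coords_le: "cmod (c1 p) \<le> norm p" "cmod (c2 p) \<le> norm p"
proof -
  show "cmod (c1 p) \<le> norm p" by (rule power2_le_imp_le) (simp_all add: norm_eq)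
  show "cmod (c2 p) \<le> norm p" by (rule power2_le_imp_le) (simp_all add: norm_eq)
qed

text \<open>This is \<open>\<chi>\<^sub>i\<close> for the fixed frame; row vectors (x, y) correspond
  to quaternions through its first row.\<close>

definition qmat :: "quat \<Rightarrow> m2" where
  "qmat p = M2 (c1 p) (c2 p) (- cnj (c2 p)) (cnj (c1 p))"

lemma qmat_simps: "qmat (p + q) = qmat p + qmat q" "qmat (p - q) = qmat p - qmat q"
  "qmat (p * q) = qmat p * qmat q" "qmat 1 = 1" "qmat 0 = 0" "qmat (qcnj p) = madj (qmat p)"
  by (simp_all add: m2_eq_iff qmat_def coords_mult coords_qcnj)

lemma qmat_mult_madj:
  "qmat p * madj (qmat p) = mscalar (of_real ((norm p)\<^sup>2))"
  "madj (qmat p) * qmat p = mscalar (of_real ((norm p)\<^sup>2))"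
  by (auto simp: m2_eq_iff qmat_def mscalar_def norm_eq mult.commute complex_norm_square simp del: of_real_power)

section \<open>Quaternionic power series evaluated on a slice\<close>

definition qentry :: "(m2 \<Rightarrow> complex) \<Rightarrow> quat fps \<Rightarrow> complex fps" where
  "qentry e f = Abs_fps (\<lambda>n. e (qmat (f $ n)))"

definition qconv :: "quat fps \<Rightarrow> bool" where
  "qconv f \<longleftrightarrow> (\<forall>e\<in>{m11, m12, m21, m22}. fps_conv_radius (qentry e f) \<ge> 1)"

text \<open>The sum of z^n \<open>\<chi>\<^sub>i\<close> (a_n). For non-real z this is not
  \<open>\<chi>\<^sub>i\<close> of a quaternion in general: the second row also carries powers of z
  and not of its conjugate. This keeps all four entries holomorphic, and because z 1 is central the
  star product becomes the matrix product.\<close>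

definition qeval :: "quat fps \<Rightarrow> complex \<Rightarrow> m2" where
  "qeval f z = M2 (eval_fps (qentry m11 f) z) (eval_fps (qentry m12 f) z)
     (eval_fps (qentry m21 f) z) (eval_fps (qentry m22 f) z)"

lemma fps_conv_radius_ge_1:
  assumes "\<And>n. norm (F $ n) \<le> K"
  shows "fps_conv_radius (F :: complex fps) \<ge> 1"
proof -
  show ?thesis
    unfolding fps_conv_radius_def
  proof (rule conv_radius_geI_ex')
    fix r :: real assume r: "0 < r" "ereal r < 1"
    show "summable (\<lambda>n. F $ n * of_real r ^ n)"
    proof (rule summable_comparison_test')
      show "summable (\<lambda>n. K * r ^ n)" using r by (intro summable_mult summable_geometric) simp
      show "norm (F $ n * of_real r ^ n) \<le> K * r ^ n" if "n \<ge> 0" for n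
        using assms[of n] r by (simp add: norm_mult norm_power mult_right_mono)
    qed
  qed
qed

lemma qconvI:
  assumes "\<And>n. norm (f $ n) \<le> K"
  shows "qconv f"
proof -
  have "fps_conv_radius (qentry e f) \<ge> 1" if "e \<in> {m11, m12, m21, m22}" for e
  proof (rule fps_conv_radius_ge_1)
    show "norm (qentry e f $ n) \<le> K" for n
      using that order_trans[OF cmod_coords_le(1) assms[of n]] order_trans[OF cmod_coords_le(2) assms[of n]]
      by (auto simp: qentry_def qmat_def)
  qed
  then show ?thesis by (simp add: qconv_def)
qed

lemma qentry_add: "e \<in> {m11, m12, m21, m22} \<Longrightarrow> qentry e (f + g) = qentry e f + qentry e g"
  and qentry_diff: "e \<in> {m11, m12, m21, m22} \<Longrightarrow> qentry e (f - g) = qentry e f - qentry e g"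
  by (auto simp: qentry_def fps_eq_iff qmat_simps)

lemma e_sum: "e \<in> {m11, m12, m21, m22} \<Longrightarrow> e (qmat (sum h A)) = (\<Sum>x\<in>A. e (qmat (h x)))"
  by (induction A rule: infinite_finite_induct) (auto simp: qmat_simps)

lemma qentry_mult:
  "qentry m11 (f * g) = qentry m11 f * qentry m11 g + qentry m12 f * qentry m21 g"
  "qentry m12 (f * g) = qentry m11 f * qentry m12 g + qentry m12 f * qentry m22 g"
  "qentry m21 (f * g) = qentry m21 f * qentry m11 g + qentry m22 f * qentry m21 g"
  "qentry m22 (f * g) = qentry m21 f * qentry m12 g + qentry m22 f * qentry m22 g"
  by (simp_all add: fps_eq_iff qentry_def fps_mult_nth e_sum qmat_simps sum.distrib)

lemma radius_add: "fps_conv_radius F \<ge> 1 \<Longrightarrow> fps_conv_radius G \<ge> 1 \<Longrightarrow> fps_conv_radius (F + G :: complex fps) \<ge> 1"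
  and radius_diff: "fps_conv_radius F \<ge> 1 \<Longrightarrow> fps_conv_radius G \<ge> 1 \<Longrightarrow> fps_conv_radius (F - G :: complex fps) \<ge> 1"
  and radius_mult: "fps_conv_radius F \<ge> 1 \<Longrightarrow> fps_conv_radius G \<ge> 1 \<Longrightarrow> fps_conv_radius (F * G :: complex fps) \<ge> 1"
  by (meson fps_conv_radius_add fps_conv_radius_diff fps_conv_radius_mult min.boundedI order_trans)+

lemma qconv_add: "qconv f \<Longrightarrow> qconv g \<Longrightarrow> qconv (f + g)"
  and qconv_diff: "qconv f \<Longrightarrow> qconv g \<Longrightarrow> qconv (f - g)"
  and qconv_mult: "qconv f \<Longrightarrow> qconv g \<Longrightarrow> qconv (f * g)"
  by (simp_all add: qconv_def qentry_add qentry_diff qentry_mult radius_add radius_diff radius_mult)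

lemma qconv_const: "qconv (fps_const p)" and qconv_X: "qconv fps_X" and qconv_1: "qconv 1"
proof -
  show "qconv (fps_const p)" by (rule qconvI[of _ "norm p"]) auto
  show "qconv fps_X" by (rule qconvI[of _ 1]) (auto simp: fps_X_def)
  show "qconv 1" by (rule qconvI[of _ 1]) auto
qed

lemma qeval_const: "qeval (fps_const p) z = qmat p" and qeval_X: "qeval fps_X z = mscalar z"
  and qeval_1: "qeval 1 z = 1"
proof -
  have 1: "e \<in> {m11, m12, m21, m22} \<Longrightarrow> qentry e (fps_const p) = fps_const (e (qmat p))" for e p
    by (auto simp: qentry_def fps_eq_iff qmat_simps)
  show c: "qeval (fps_const p) z = qmat p" for p by (simp add: qeval_def 1 m2_eq_iff)
  show "qeval 1 z = 1" using c[of 1] by (simp add: qmat_simps)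
  have "qentry m11 fps_X = fps_X" "qentry m22 fps_X = fps_X" "qentry m12 fps_X = 0" "qentry m21 fps_X = 0"
    by (auto simp: qentry_def fps_eq_iff qmat_simps fps_X_def)
  then show "qeval fps_X z = mscalar z" by (simp add: qeval_def mscalar_def)
qed

lemma less_radius: "norm (z :: complex) < 1 \<Longrightarrow> fps_conv_radius F \<ge> 1 \<Longrightarrow> ereal (norm z) < fps_conv_radius F"
  by (metis less_ereal.simps(1) one_ereal_def order_less_le_trans)

lemma qeval_add: "qconv f \<Longrightarrow> qconv g \<Longrightarrow> norm z < 1 \<Longrightarrow> qeval (f + g) z = qeval f z + qeval g z"
  and qeval_diff: "qconv f \<Longrightarrow> qconv g \<Longrightarrow> norm z < 1 \<Longrightarrow> qeval (f - g) z = qeval f z - qeval g z"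
  by (simp_all add: qeval_def m2_eq_iff qentry_add qentry_diff qconv_def eval_fps_add eval_fps_diff less_radius)

lemma qeval_mult: "qconv f \<Longrightarrow> qconv g \<Longrightarrow> norm z < 1 \<Longrightarrow> qeval (f * g) z = qeval f z * qeval g z"
  by (simp add: qeval_def m2_eq_iff qentry_mult qconv_def eval_fps_add eval_fps_mult less_radius radius_mult)

lemma holomorphic_qeval:
  assumes "qconv f" "e \<in> {m11, m12, m21, m22}"
  shows "(\<lambda>z. e (qeval f z)) holomorphic_on ball 0 1"
proof -
  have "eval_fps (qentry e f) holomorphic_on ball 0 1"
  proof (rule holomorphic_on_eval_fps)
    show "ball (0 :: complex) 1 \<subseteq> eball 0 (fps_conv_radius (qentry e f))"
    proof (rule subsetI)
      fix x :: complex assume "x \<in> ball 0 1"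
      then have "ereal (cmod x) < fps_conv_radius (qentry e f)"
        using assms by (intro less_radius) (auto simp: qconv_def)
      then show "x \<in> eball 0 (fps_conv_radius (qentry e f))"
        unfolding in_eball_iff dist_0_norm .
    qed
  qed
  then show ?thesis using assms(2) by (auto simp: qeval_def)
qed

lemma strictly_contractive_qconv: "strictly_contractive f \<Longrightarrow> qconv f"
  by (rule qconvI[of _ 1]) (rule strictly_contractive_norm_nth_le)

lemma qentry_sums:
  assumes "qconv f" "e \<in> {m11, m12, m21, m22}" "norm z < 1"
  shows "(\<lambda>n. z ^ n * e (qmat (f $ n))) sums e (qeval f z)"
    and "summable (\<lambda>n. norm (z ^ n * e (qmat (f $ n))))"
proof -
  have r: "ereal (norm z) < fps_conv_radius (qentry e f)"
    using assms less_radius by (auto simp: qconv_def)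
  have *: "(\<lambda>n. qentry e f $ n * z ^ n) = (\<lambda>n. z ^ n * e (qmat (f $ n)))"
    by (simp add: qentry_def mult.commute fun_eq_iff)
  show "(\<lambda>n. z ^ n * e (qmat (f $ n))) sums e (qeval f z)"
    using sums_eval_fps[OF r] assms(2) unfolding * by (auto simp: qeval_def)
  show "summable (\<lambda>n. norm (z ^ n * e (qmat (f $ n))))"
    using abs_summable_in_conv_radius[of z "fps_nth (qentry e f)"] r
    by (simp add: fps_conv_radius_def qentry_def mult.commute)
qed

text \<open>
  Testing the contraction property on \<open>\<xi>\<^sub>m = q z\<^sup>*\<^sup>m\<close> against \<open>\<eta>\<^sub>m = p\<^sup>* z\<^sup>*\<^sup>m\<close> produces the
  Cauchy product of a geometric series with the series of \<open>f\<close>, because \<open>Re (a b) = Re (b a)\<close>.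
\<close>

lemma strictly_contractive_row:
  fixes x y z :: complex
  assumes f: "strictly_contractive f" and z: "norm z < 1"
  defines "A \<equiv> qeval f z"
  shows "(cmod (x * m11 A + y * m21 A))\<^sup>2 + (cmod (x * m12 A + y * m22 A))\<^sup>2 \<le> (cmod x)\<^sup>2 + (cmod y)\<^sup>2"
proof -
  define h1 h2 where "h1 = x * m11 A + y * m21 A" and "h2 = x * m12 A + y * m22 A"
  \<comment> \<open>The row (x, y) and its image (x, y) A are read as the quaternions
    \<open>p\<close> and \<open>h\<close>: right multiplication by a coefficient of f acts on rows
    through \<open>qmat\<close>.\<close>
  define p where "p = slice_emb i x + slice_emb i y * j"
  define h where "h = slice_emb i h1 + slice_emb i h2 * j"
  define w where "w = slice_emb i z"
  define \<rho> where "\<rho> = (cmod z)\<^sup>2"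
  have \<rho>: "0 \<le> \<rho>" "\<rho> < 1" using z by (auto simp: \<rho>_def abs_square_less_1)
  have w: "norm w = cmod z" using norm_eq[of w] by (simp add: w_def)
  define t where "t k = (w ^ k * p * f $ k) \<bullet> h" for k
  have cp: "c1 p = x" "c2 p = y" "c1 h = h1" "c2 h = h2" by (simp_all only: p_def h_def coords_of)
  have cw: "c1 (w ^ k) = z ^ k" "c2 (w ^ k) = 0" for k by (simp_all add: w_def slice_emb_power[symmetric])
  have t_alt: "t k = Re ((x * (z ^ k * m11 (qmat (f $ k))) + y * (z ^ k * m21 (qmat (f $ k)))) * cnj h1
     + (x * (z ^ k * m12 (qmat (f $ k))) + y * (z ^ k * m22 (qmat (f $ k)))) * cnj h2)" for k
    unfolding t_def inner_eq coords_mult cp cw qmat_def by (simp add: algebra_simps)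
  note qs = qentry_sums[OF strictly_contractive_qconv[OF f] _ z]
  have tsums: "t sums (norm h)\<^sup>2"
  proof -
    have "(\<lambda>k. (x * (z ^ k * m11 (qmat (f $ k))) + y * (z ^ k * m21 (qmat (f $ k)))) * cnj h1
     + (x * (z ^ k * m12 (qmat (f $ k))) + y * (z ^ k * m22 (qmat (f $ k)))) * cnj h2) sums
      ((x * m11 A + y * m21 A) * cnj h1 + (x * m12 A + y * m22 A) * cnj h2)"
      unfolding A_def by (intro sums_add sums_mult sums_mult2 qs) auto
    from sums_Re[OF this] show ?thesis
      unfolding t_alt[symmetric] h1_def[symmetric] h2_def[symmetric] norm_eq cp cmod_power2
      by (simp add: power2_eq_square)
  qed
  have tabs: "summable (\<lambda>k. norm (t k))"
  proof (rule summable_comparison_test')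
    let ?s = "\<lambda>k. (cmod x * norm (z ^ k * m11 (qmat (f $ k))) + cmod y * norm (z ^ k * m21 (qmat (f $ k)))) * cmod h1
     + (cmod x * norm (z ^ k * m12 (qmat (f $ k))) + cmod y * norm (z ^ k * m22 (qmat (f $ k)))) * cmod h2"
    show "summable ?s"
      by (intro summable_add summable_mult summable_mult2 qs) auto
    show "norm (norm (t k)) \<le> ?s k" if "k \<ge> 0" for k
      unfolding t_alt real_norm_def abs_abs
      by (rule order_trans[OF abs_Re_le_cmod], rule order_trans[OF norm_triangle_ineq], unfold norm_mult[of _ "cnj _"],
        unfold complex_mod_cnj, intro add_mono mult_right_mono order_trans[OF norm_triangle_ineq])
        (auto simp: norm_mult)
  qed
  have prod: "(\<lambda>m. \<Sum>k\<le>m. t k * \<rho> ^ (m - k)) sums ((norm h)\<^sup>2 * (1 / (1 - \<rho>)))"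
  proof -
    have g: "(\<lambda>k. \<rho> ^ k) sums (1 / (1 - \<rho>))" using \<rho> by (intro geometric_sums) simp
    have "summable (\<lambda>k. norm (\<rho> ^ k))" using \<rho> by (simp add: norm_power summable_geometric)
    from Cauchy_product_sums[OF tabs this] show ?thesis
      using tsums g by (simp add: sums_iff)
  qed
  have bound: "(\<Sum>m\<le>N. \<Sum>k\<le>m. t k * \<rho> ^ (m - k)) \<le> ((norm h)\<^sup>2 + (norm p)\<^sup>2) / 2 * (\<Sum>m\<le>N. \<rho> ^ m)" for N
  proof -
    define \<xi> where "\<xi> = Abs_fps (\<lambda>m. qcnj h * qcnj w ^ m)"
    define \<eta> where "\<eta> = Abs_fps (\<lambda>m. qcnj p * qcnj w ^ m)"
    have ww: "qcnj w ^ n * w ^ n = of_real (\<rho> ^ n)" for n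
    proof -
      have com: "qcnj w * w = of_real \<rho>" by (simp add: qcnj_mult_self w \<rho>_def)
      show ?thesis
      proof (induction n)
        case (Suc n)
        have "qcnj w ^ Suc n * w ^ Suc n = qcnj w * (qcnj w ^ n * w ^ n) * w"
          by (simp only: power_Suc[of "qcnj w"] power_Suc2[of w] mult.assoc)
        also have "\<dots> = of_real (\<rho> ^ n) * (qcnj w * w)"
          unfolding Suc by (simp add: of_real_def)
        also have "\<dots> = of_real (\<rho> ^ Suc n)"
          by (simp only: com of_real_mult[symmetric] power_Suc2)
        finally show ?case .
      qed simp
    qed
    \<comment> \<open>Cyclicity brings the power of \<open>qcnj w\<close> next to w^(m - k), and
      their product is the real number \<rho>^(m - k).\<close>
    have entry: "(f $ k * \<xi> $ (m - k)) \<bullet> (\<eta> $ m) = t k * \<rho> ^ (m - k)" if "k \<le> m" for k m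
    proof -
      have pw: "qcnj (qcnj w ^ n) = w ^ n" for n
        by (induction n) (simp_all add: qcnj_mult power_commutes)
      have "(f $ k * \<xi> $ (m - k)) \<bullet> (\<eta> $ m) = qRe ((w ^ m * p) * (f $ k * (qcnj h * qcnj w ^ (m - k))))"
        by (simp add: inner_quat_alt \<xi>_def \<eta>_def qcnj_mult pw del: times_quat.simps)
      also have "\<dots> = qRe (((w ^ m * p) * f $ k * qcnj h) * qcnj w ^ (m - k))"
        by (simp only: mult.assoc)
      also have "\<dots> = qRe (qcnj w ^ (m - k) * ((w ^ m * p) * f $ k * qcnj h))"
        by (rule qRe_commute)
      also have "w ^ m = w ^ (m - k) * w ^ k" using that by (simp flip: power_add)
      also have "qcnj w ^ (m - k) * ((w ^ (m - k) * w ^ k * p) * f $ k * qcnj h) =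
          (qcnj w ^ (m - k) * w ^ (m - k)) * (w ^ k * p * f $ k * qcnj h)"
        by (simp only: mult.assoc)
      also have "qRe \<dots> = \<rho> ^ (m - k) * qRe (w ^ k * p * f $ k * qcnj h)"
        unfolding ww by (simp add: of_real_def)
      also have "qRe (w ^ k * p * f $ k * qcnj h) = t k"
        unfolding t_def inner_quat_alt by (rule qRe_commute)
      finally show ?thesis by simp
    qed
    have "(\<Sum>m\<le>N. \<Sum>k\<le>m. t k * \<rho> ^ (m - k)) = tinner N (f * \<xi>) \<eta>"
      unfolding tinner_def fps_mult_nth inner_sum_left atLeast0AtMost
      by (intro sum.cong refl) (simp add: entry)
    also have "\<dots> \<le> (tnorm N (f * \<xi>) + tnorm N \<eta>) / 2"
    proof -
      have "0 \<le> tnorm N (f * \<xi> - \<eta>)" by (simp add: tnorm_def sum_nonneg)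
      then show ?thesis by (simp add: tnorm_eq_tinner tinner_algebra tinner_commute)
    qed
    also have "\<dots> \<le> (tnorm N \<xi> + tnorm N \<eta>) / 2"
      using strictly_contractive_tnorm_le[OF f, of N \<xi>] by simp
    also have "\<dots> = ((norm h)\<^sup>2 + (norm p)\<^sup>2) / 2 * (\<Sum>m\<le>N. \<rho> ^ m)"
      by (simp add: tnorm_def \<xi>_def \<eta>_def norm_mult norm_power power_mult_distrib w \<rho>_def
          power_mult[symmetric] mult.commute sum_distrib_left[symmetric] algebra_simps add_divide_distrib)
    finally show ?thesis .
  qed
  have "(norm h)\<^sup>2 * (1 / (1 - \<rho>)) \<le> ((norm h)\<^sup>2 + (norm p)\<^sup>2) / 2 * (1 / (1 - \<rho>))"
  proof (rule LIMSEQ_le)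
    show "(\<lambda>N. \<Sum>m\<le>N. \<Sum>k\<le>m. t k * \<rho> ^ (m - k)) \<longlonglongrightarrow> (norm h)\<^sup>2 * (1 / (1 - \<rho>))"
      using prod by (simp add: sums_def_le)
    have "(\<lambda>k. \<rho> ^ k) sums (1 / (1 - \<rho>))" using \<rho> by (intro geometric_sums) simp
    then show "(\<lambda>N. ((norm h)\<^sup>2 + (norm p)\<^sup>2) / 2 * (\<Sum>m\<le>N. \<rho> ^ m)) \<longlonglongrightarrow> ((norm h)\<^sup>2 + (norm p)\<^sup>2) / 2 * (1 / (1 - \<rho>))"
      unfolding sums_def_le by (rule tendsto_mult_left)
    show "\<exists>N. \<forall>n\<ge>N. (\<Sum>m\<le>n. \<Sum>k\<le>m. t k * \<rho> ^ (m - k)) \<le> ((norm h)\<^sup>2 + (norm p)\<^sup>2) / 2 * (\<Sum>m\<le>n. \<rho> ^ m)"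
      using bound by blast
  qed
  \<comment> \<open>Both sides carry the full geometric series 1 / (1 - \<rho>), which cancels.
    Having taken the image \<open>h\<close> itself as a test direction, the polarised inequality
    collapses to norm h \<le> norm p.\<close>
  then have "(norm h)\<^sup>2 \<le> ((norm h)\<^sup>2 + (norm p)\<^sup>2) / 2"
    by (rule mult_right_le_imp_le) (use \<rho> in simp)
  then have "(norm h)\<^sup>2 \<le> (norm p)\<^sup>2" by simp
  then show ?thesis by (simp add: norm_eq cp h1_def h2_def)
qed

lemma strictly_contractive_hpsd:
  assumes "strictly_contractive f" "norm z < 1"
  shows "hpsd (hone - hgram (qeval f z))"
proof -
  let ?A = "qeval f z"
  have "hpsd (1 - ((cmod (m11 ?A))\<^sup>2 + (cmod (m12 ?A))\<^sup>2), 1 - ((cmod (m21 ?A))\<^sup>2 + (cmod (m22 ?A))\<^sup>2),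
      - (m11 ?A * cnj (m21 ?A) + m12 ?A * cnj (m22 ?A)))"
  proof (rule hpsd_quadratic_form)
    fix x y :: complex
    have *: "(cmod (a + b))\<^sup>2 = (cmod a)\<^sup>2 + (cmod b)\<^sup>2 + 2 * Re (a * cnj b)" for a b
      unfolding cmod_power2 by (simp add: power2_eq_square algebra_simps)
    show "0 \<le> (cmod x)\<^sup>2 * (1 - ((cmod (m11 ?A))\<^sup>2 + (cmod (m12 ?A))\<^sup>2)) +
       (cmod y)\<^sup>2 * (1 - ((cmod (m21 ?A))\<^sup>2 + (cmod (m22 ?A))\<^sup>2)) +
       2 * Re (x * - (m11 ?A * cnj (m21 ?A) + m12 ?A * cnj (m22 ?A)) * cnj y)"
      using strictly_contractive_row[OF assms, of x y]
      unfolding * norm_mult power_mult_distrib by (simp add: algebra_simps)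
  qed
  then show ?thesis by (simp add: hgram_eq hone_def)
qed

end

section \<open>Circle means and the Schur recursion\<close>

lemma space_circle [simp]: "space circle = sphere 0 1"
  by (simp add: circle_def space_restrict_space)

lemma sets_arc_measure [simp, measurable_cong]: "sets arc_measure = sets circle"
  and space_arc_measure [simp]: "space arc_measure = sphere 0 1"
  by (simp_all add: arc_measure_def)

lemma sets_angle_measure [simp, measurable_cong]: "sets angle_measure = sets borel"
  and space_angle_measure [simp]: "space angle_measure = UNIV"
  by (simp_all add: angle_measure_def)

lemma measurable_cis [measurable]: "cis \<in> angle_measure \<rightarrow>\<^sub>M circle"
proof -
  have "cis \<in> borel_measurable borel"
    by (intro borel_measurable_continuous_onI continuous_intros)
  then show ?thesis
    unfolding circle_def by (intro measurable_restrict_space2) (auto simp: measurable_def)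
qed

lemma measurable_circle_continuous:
  fixes f :: "complex \<Rightarrow> 'a :: topological_space"
  assumes "continuous_on (sphere 0 1) f"
  shows "f \<in> borel_measurable circle"
  unfolding circle_def using assms by (rule borel_measurable_continuous_on_restrict)

lemma emeasure_angle_measure_UNIV: "emeasure angle_measure UNIV = 1"
proof -
  have "emeasure lborel {0..2 * pi} \<noteq> 0" "emeasure lborel {0..2 * pi} \<noteq> \<infinity>"
    by simp_all
  then show ?thesis
    unfolding angle_measure_def by (subst emeasure_uniform_measure) (auto simp: ennreal_divide_self)
qed

lemma emeasure_arc_measure_space: "emeasure arc_measure (sphere 0 1) = 1"
proof -
  have "cis -` sphere 0 1 = UNIV" by auto
  moreover have "sphere 0 1 \<in> sets circle" using sets.top[of circle] by simp
  ultimately show ?thesis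
    unfolding arc_measure_def by (subst emeasure_distr) (auto simp: emeasure_angle_measure_UNIV)
qed

lemma finite_measure_arc: "finite_measure arc_measure"
  by (rule finite_measureI) (simp add: emeasure_arc_measure_space)

lemma measure_arc_space: "measure arc_measure (sphere 0 1) = 1"
  by (simp add: measure_def emeasure_arc_measure_space)

lemma continuous_circle_bounded:
  fixes f :: "complex \<Rightarrow> 'a :: real_normed_vector"
  assumes "continuous_on (sphere 0 1) f"
  obtains B where "\<And>x. x \<in> sphere 0 1 \<Longrightarrow> norm (f x) \<le> B"
proof -
  have "bounded (f ` sphere 0 1)"
    using assms by (intro compact_imp_bounded compact_continuous_image) auto
  then show ?thesis using that unfolding bounded_iff by blast
qed

lemma integrable_arc_continuous:
  fixes f :: "complex \<Rightarrow> 'a :: {banach, second_countable_topology}"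
  assumes "continuous_on (sphere 0 1) f"
  shows "integrable arc_measure f"
proof -
  obtain B where "\<And>x. x \<in> sphere 0 1 \<Longrightarrow> norm (f x) \<le> B"
    using continuous_circle_bounded[OF assms] by blast
  then show ?thesis
    using measurable_circle_continuous[OF assms]
    by (intro finite_measure.integrable_const_bound[OF finite_measure_arc, of _ B])
       (auto intro!: AE_I2)
qed

lemma integral_arc_measure_eq:
  fixes f :: "complex \<Rightarrow> 'a :: {banach, second_countable_topology}"
  assumes "continuous_on (sphere 0 1) f"
  shows "integral\<^sup>L arc_measure f = (1 / (2 * pi)) *\<^sub>R (LINT \<theta>:{0..2 * pi}|lborel. f (cis \<theta>))"
proof -
  have fm: "f \<in> borel_measurable circle" by (rule measurable_circle_continuous[OF assms])
  have "continuous_on UNIV (\<lambda>\<theta>. f (cis \<theta>))"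
    by (rule continuous_on_compose2[OF assms]) (auto intro: continuous_intros)
  then have m: "(\<lambda>\<theta>. f (cis \<theta>)) \<in> borel_measurable borel" by (rule borel_measurable_continuous_onI)
  have "integral\<^sup>L arc_measure f = (LINT \<theta>|angle_measure. f (cis \<theta>))"
    unfolding arc_measure_def by (rule integral_distr) (use fm in measurable)
  also have "angle_measure = density lborel (\<lambda>x. ennreal (indicator {0..2*pi} x / (2 * pi)))"
    unfolding angle_measure_def uniform_measure_def
    by (intro arg_cong[where f="density lborel"] ext)
       (auto simp: indicator_def divide_ennreal[symmetric] ennreal_1[symmetric] simp del: ennreal_1)
  also have "(LINT \<theta>|density lborel (\<lambda>x. ennreal (indicator {0..2*pi} x / (2 * pi))). f (cis \<theta>)) =
      (LINT \<theta>|lborel. (indicator {0..2*pi} \<theta> / (2 * pi)) *\<^sub>R f (cis \<theta>))"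
    using m by (intro integral_density) auto
  also have "\<dots> = (LINT \<theta>|lborel. (1 / (2 * pi)) *\<^sub>R (indicator {0..2*pi} \<theta> *\<^sub>R f (cis \<theta>)))"
    by (intro Bochner_Integration.integral_cong) auto
  also have "\<dots> = (1 / (2 * pi)) *\<^sub>R (LINT \<theta>:{0..2 * pi}|lborel. f (cis \<theta>))"
    unfolding set_lebesgue_integral_def by (rule integral_scaleR_right) 
  finally show ?thesis .
qed

lemma scale_sphere_subset:
  assumes "0 \<le> r" "r < 1"
  shows "(\<lambda>w. of_real r * w) ` sphere (0::complex) 1 \<subseteq> ball 0 1"
  using assms by (auto simp: norm_mult)

lemma continuous_on_scaled_circle:
  assumes "continuous_on (ball 0 1) g" "0 \<le> r" "r < 1"
  shows "continuous_on (sphere 0 1) (\<lambda>w :: complex. g (of_real r * w))"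
  using scale_sphere_subset[OF assms(2,3)]
  by (intro continuous_on_compose2[OF assms(1)] continuous_intros) auto

lemma circle_mean_value:
  assumes g: "g holomorphic_on ball 0 1" and r: "0 \<le> r" "r < 1"
  shows "(LINT w|arc_measure. g (of_real r * w)) = g 0"
proof (cases "r = 0")
  case True
  then show ?thesis by (simp add: measure_arc_space)
next
  case False
  then have r0: "r > 0" using r by simp
  have cont: "continuous_on (sphere 0 1) (\<lambda>w. g (of_real r * w))"
    by (intro continuous_on_scaled_circle holomorphic_on_imp_continuous_on g r)
  have "cball 0 r \<subseteq> ball (0::complex) 1" using r by auto
  then have "((\<lambda>u. g u / (u - 0)) has_contour_integral (2 * of_real pi * \<i> * g 0)) (circlepath 0 r)"
    using r0 holomorphic_on_subset[OF g order_trans[OF ball_subset_cball]]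
    by (intro Cauchy_integral_circlepath holomorphic_on_imp_continuous_on holomorphic_on_subset[OF g])
      auto
  then have "((\<lambda>t. g (0 + of_real r * cis t) / (0 + of_real r * cis t - 0) * of_real r * \<i> * cis t)
       has_integral (2 * of_real pi * \<i> * g 0)) {0..2*pi}"
    unfolding circlepath_def by (subst (asm) has_contour_integral_part_circlepath_iff) auto
  then have "((\<lambda>t. \<i> * g (of_real r * cis t)) has_integral (\<i> * (2 * of_real pi * g 0))) {0..2*pi}"
    by (rule has_integral_eq_rhs[OF has_integral_eq[rotated]]) (use r0 in auto)
  then have hi: "((\<lambda>t. g (of_real r * cis t)) has_integral (2 * of_real pi * g 0)) {0..2*pi}"
    using has_integral_mult_right[of "\<lambda>t. \<i> * g (of_real r * cis t)" "\<i> * (2 * of_real pi * g 0)" "{0..2*pi}" "- \<i>"]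
    by (simp add: mult.assoc[symmetric])
  have "continuous_on {0..2*pi} (\<lambda>t. g (of_real r * cis t))"
    by (rule continuous_on_compose2[OF cont]) (auto intro: continuous_intros)
  then have "set_integrable lborel {0..2*pi} (\<lambda>t. g (of_real r * cis t))"
    by (rule borel_integrable_atLeastAtMost')
  from set_borel_integral_eq_integral(2)[OF this]
  have "(LINT t:{0..2*pi}|lborel. g (of_real r * cis t)) = 2 * of_real pi * g 0"
    using hi by (simp add: integral_unique)
  then show ?thesis
    unfolding integral_arc_measure_eq[OF cont] by (simp add: scaleR_conv_of_real)
qed

text \<open>On the disc a zero-free holomorphic function has a logarithm h, and ln |g| = Re h is
  averaged by the mean value property; the normalisation at 0 makes Re (h 0) vanish.\<close>

lemma circle_mean_ln_norm:
  assumes g: "g holomorphic_on ball 0 1" and nz: "\<And>z. cmod z < 1 \<Longrightarrow> g z \<noteq> 0"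
    and g0: "cmod (g 0) = 1" and r: "0 \<le> r" "r < 1"
  shows "(LINT w|arc_measure. ln (cmod (g (of_real r * w)))) = 0"
proof -
  obtain h where h: "h holomorphic_on ball 0 1" "\<And>z. z \<in> ball 0 1 \<Longrightarrow> g z = exp (h z)"
    using contractible_imp_holomorphic_log[OF g convex_imp_contractible] nz by (metis convex_ball mem_ball_0)
  have ln: "ln (cmod (g z)) = Re (h z)" if "cmod z < 1" for z
    using h(2)[of z] that by simp
  have cont: "continuous_on (sphere 0 1) (\<lambda>w. h (of_real r * w))"
    by (intro continuous_on_scaled_circle holomorphic_on_imp_continuous_on h r)
  have "(LINT w|arc_measure. ln (cmod (g (of_real r * w)))) = (LINT w|arc_measure. Re (h (of_real r * w)))"
    using r by (intro Bochner_Integration.integral_cong refl ln) (auto simp: norm_mult)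
  also have "\<dots> = Re (LINT w|arc_measure. h (of_real r * w))"
    by (rule integral_Re[OF integrable_arc_continuous[OF cont]])
  also have "\<dots> = Re (h 0)" by (simp add: circle_mean_value[OF h(1) r])
  also have "\<dots> = 0" using ln[of 0] g0 by simp
  finally show ?thesis .
qed

lemma hpsd_contraction_entries:
  assumes "hpsd (hone - hgram B)" "e \<in> {m11, m12, m21, m22}"
  shows "cmod (e B) \<le> 1"
proof -
  have "(cmod (m11 B))\<^sup>2 + (cmod (m12 B))\<^sup>2 \<le> 1" "(cmod (m21 B))\<^sup>2 + (cmod (m22 B))\<^sup>2 \<le> 1"
    using assms(1) by (auto simp: hpsd_def hone_def hgram_eq)
  moreover have "0 \<le> (cmod (x B))\<^sup>2" for x by simp
  note this[of m11] this[of m12] this[of m21] this[of m22]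
  ultimately have "(cmod (e B))\<^sup>2 \<le> 1\<^sup>2"
    using assms(2) unfolding insert_iff empty_iff power_one by (elim disjE FalseE; hypsubst; linarith)
  then show ?thesis by (rule power2_le_imp_le) simp
qed

section \<open>The entropy along the Schur algorithm\<close>

locale schur_recursion = slice_frame +
  fixes f :: "nat \<Rightarrow> quat fps" and \<gamma> :: "nat \<Rightarrow> quat"
  assumes con: "\<And>n. strictly_contractive (f n)" and \<gamma>: "\<And>n. \<gamma> n = f n $ 0"
    and rec: "\<And>n. (1 + fps_X * f (Suc n) * fps_const (qcnj (\<gamma> n))) * f n
       = fps_const (\<gamma> n) + fps_X * f (Suc n)"
begin

definition "A n z = qeval (f n) z"
definition "s n = (norm (\<gamma> n))\<^sup>2"

lemma s_bounds: "0 \<le> s n" "s n < 1"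
  using strictly_contractive_norm_0[OF con, of n] \<gamma>[of n] by (auto simp: s_def abs_square_less_1)

lemma step: 
  assumes z: "cmod z < 1"
  shows "matrix_schur_step (A n z) (A (Suc n) z) (qmat (\<gamma> n)) z (s n)"
proof
  note qc = strictly_contractive_qconv[OF con] qconv_add qconv_mult qconv_const qconv_X qconv_1
  show "(1 + mscalar z * A (Suc n) z * madj (qmat (\<gamma> n))) * A n z = qmat (\<gamma> n) + mscalar z * A (Suc n) z"
    using arg_cong[OF rec[of n], of "\<lambda>h. qeval h z"] z
    by (simp add: qeval_add qeval_mult qeval_const qeval_X qeval_1 qc A_def qmat_simps)
qed (use z s_bounds con in \<open>simp_all add: qmat_mult_madj s_def A_def strictly_contractive_hpsd\<close>)

text \<open>Only used with |z| = r. The summand \<delta> absorbs the excess produced by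
  \<open>step_upper\<close>.\<close>

definition "hG n r \<delta> z = (1 + \<delta>) *\<^sub>R hone - r\<^sup>2 *\<^sub>R hgram (A n z)"

definition "E n r \<delta> = (LINT w|arc_measure. ln (hdet (hG n r \<delta> (of_real r * w))))"

lemma hpsd_A: "cmod z < 1 \<Longrightarrow> hpsd (hone - hgram (A n z))"
  using con by (simp add: A_def strictly_contractive_hpsd)

lemma hG_bounds:
  assumes z: "cmod z < 1" and r: "0 \<le> r" "r < 1" and \<delta>: "0 \<le> \<delta>"
  shows "hpsd (hG n r \<delta> z)" "0 < hdet (hG n r \<delta> z)" "hdet (hG n r \<delta> z) \<le> (1 + \<delta>)\<^sup>2"
proof -
  have r2: "0 \<le> r\<^sup>2" "r\<^sup>2 < 1" using r by (auto simp: abs_square_less_1)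
  have eq: "hG n r \<delta> z - (hone - r\<^sup>2 *\<^sub>R hgram (A n z)) = \<delta> *\<^sub>R hone"
    by (simp add: hG_def algebra_simps)
  have p: "hpsd (hone - r\<^sup>2 *\<^sub>R hgram (A n z))" "0 < hdet (hone - r\<^sup>2 *\<^sub>R hgram (A n z))"
    using hpsd_scaled_diff[OF hpsd_A[OF z], of "r\<^sup>2"] r2
    by (auto intro: order.strict_trans2[of 0 "(1 - r\<^sup>2)\<^sup>2"])
  have d: "hpsd (hG n r \<delta> z - (hone - r\<^sup>2 *\<^sub>R hgram (A n z)))"
    unfolding eq using \<delta> by (simp add: hpsd_scaleR)
  show P: "hpsd (hG n r \<delta> z)" using hpsd_add[OF p(1) d] by simp
  show "0 < hdet (hG n r \<delta> z)" using hdet_mono[OF p(1) d] p(2) by simp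
  have "(1 + \<delta>) *\<^sub>R hone - hG n r \<delta> z = r\<^sup>2 *\<^sub>R hgram (A n z)" by (simp add: hG_def)
  then have "hpsd ((1 + \<delta>) *\<^sub>R hone - hG n r \<delta> z)" using r2 by (simp add: hpsd_scaleR hpsd_hgram)
  from hdet_mono[OF P this] show "hdet (hG n r \<delta> z) \<le> (1 + \<delta>)\<^sup>2" by (simp add: hdet_scaleR)
qed

lemma continuous_A:
  assumes "e \<in> {m11, m12, m21, m22}"
  shows "continuous_on (ball 0 1) (\<lambda>z. e (A n z))"
  unfolding A_def
  by (intro holomorphic_on_imp_continuous_on holomorphic_qeval strictly_contractive_qconv con assms)

lemma integrable_E:
  assumes r: "0 \<le> r" "r < 1" and \<delta>: "0 \<le> \<delta>"
  shows "integrable arc_measure (\<lambda>w. ln (hdet (hG n r \<delta> (of_real r * w))))"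
proof (rule integrable_arc_continuous, rule continuous_on_scaled_circle[OF _ r])
  have "continuous_on (ball 0 1) (\<lambda>z. hdet (hG n r \<delta> z))"
  proof -
    have c: "continuous_on (ball 0 1) (\<lambda>z. m11 (A n z))" "continuous_on (ball 0 1) (\<lambda>z. m12 (A n z))"
      "continuous_on (ball 0 1) (\<lambda>z. m21 (A n z))" "continuous_on (ball 0 1) (\<lambda>z. m22 (A n z))"
      by (rule continuous_A, simp)+
    show ?thesis
      unfolding hdet_def hG_def hgram_eq by (intro continuous_intros c)
  qed
  then show "continuous_on (ball 0 1) (\<lambda>z. ln (hdet (hG n r \<delta> z)))"
    using hG_bounds(2)[OF _ r \<delta>, of _ n] by (intro continuous_on_ln) force+
qed

definition "U n z = 1 + mscalar z * A (Suc n) z * madj (qmat (\<gamma> n))"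

text \<open>\<open>U n 0\<close> is the identity and the Schur step excludes zeros of the
  determinant, so the factor by which neighbouring iterates differ disappears from the
  means.\<close>

lemma mean_ln_U:
  assumes r: "0 \<le> r" "r < 1"
  shows "(LINT w|arc_measure. ln (cmod (mdet (U n (of_real r * w))))) = 0"
    and "integrable arc_measure (\<lambda>w. ln (cmod (mdet (U n (of_real r * w)))))"
proof -
  have h: "(\<lambda>z. e (A (Suc n) z)) holomorphic_on ball 0 1" if "e \<in> {m11, m12, m21, m22}" for e
    unfolding A_def by (intro holomorphic_qeval strictly_contractive_qconv con that)
  have hol: "(\<lambda>z. mdet (U n z)) holomorphic_on ball 0 1"
    unfolding mdet_def U_def mscalar_def
    by simp (intro holomorphic_intros h, auto)
  have nz: "mdet (U n z) \<noteq> 0" if "cmod z < 1" for z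
    using matrix_schur_step.mdet_u_nonzero[OF step[OF that, of n]] matrix_schur_step.u_def[OF step[OF that, of n]]
    by (simp add: U_def)
  show "(LINT w|arc_measure. ln (cmod (mdet (U n (of_real r * w))))) = 0"
    by (rule circle_mean_ln_norm[OF hol nz _ r]) (simp_all add: U_def mdet_def mscalar_def)
  show "integrable arc_measure (\<lambda>w. ln (cmod (mdet (U n (of_real r * w)))))"
    using nz by (intro integrable_arc_continuous continuous_on_scaled_circle[of "\<lambda>z. ln (cmod (mdet (U n z)))"] r
       continuous_on_ln continuous_on_norm holomorphic_on_imp_continuous_on[OF hol]) auto
qed

lemma E_lower:
  assumes r: "0 \<le> r" "r < 1"
  shows "2 * ln (1 - s n) + E (Suc n) r 0 \<le> E n r 0"
proof -
  interpret arc: finite_measure arc_measure by (rule finite_measure_arc)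
  have "2 * ln (1 - s n) + E (Suc n) r 0 =
      (LINT w|arc_measure. 2 * ln (1 - s n) + ln (hdet (hG (Suc n) r 0 (of_real r * w))))"
    unfolding E_def using integrable_E[OF r, of 0 "Suc n"]
    by (subst Bochner_Integration.integral_add) (auto simp: measure_arc_space)
  also have "\<dots> \<le> (LINT w|arc_measure. ln (hdet (hG n r 0 (of_real r * w))) + 2 * ln (cmod (mdet (U n (of_real r * w)))))"
  proof (rule integral_mono)
    fix w assume "w \<in> space arc_measure"
    then have z: "cmod (of_real r * w) = r" using r by (simp add: norm_mult)
    interpret st: matrix_schur_step "A n (of_real r * w)" "A (Suc n) (of_real r * w)" "qmat (\<gamma> n)" "of_real r * w" "s n"
      by (rule step) (use z r in simp)
    show "2 * ln (1 - s n) + ln (hdet (hG (Suc n) r 0 (of_real r * w)))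
       \<le> ln (hdet (hG n r 0 (of_real r * w))) + 2 * ln (cmod (mdet (U n (of_real r * w))))"
      using st.step_lower unfolding z hG_def U_def st.u_def by simp
  qed (use integrable_E[OF r, of 0] mean_ln_U(2)[OF r] in auto)
  also have "\<dots> = E n r 0"
    unfolding E_def using integrable_E[OF r, of 0 n] mean_ln_U[OF r, of n]
    by (subst Bochner_Integration.integral_add) auto
  finally show ?thesis .
qed

lemma E_upper:
  assumes r: "0 \<le> r" "r < 1" and \<delta>: "0 \<le> \<delta>"
    and \<delta>': "\<delta>' = 36 * (\<delta> + (1 - r\<^sup>2)) / (1 - s n)"
  shows "E n r \<delta> \<le> 2 * ln (1 - s n) + E (Suc n) r \<delta>'"
proof -
  interpret arc: finite_measure arc_measure by (rule finite_measure_arc)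
  have "r\<^sup>2 < 1" using r by (simp add: abs_square_less_1)
  then have \<delta>'0: "0 \<le> \<delta>'" using s_bounds[of n] \<delta> by (simp add: \<delta>')
  have "E n r \<delta> = (LINT w|arc_measure. ln (hdet (hG n r \<delta> (of_real r * w))) + 2 * ln (cmod (mdet (U n (of_real r * w)))))"
    unfolding E_def using integrable_E[OF r \<delta>, of n] mean_ln_U[OF r, of n]
    by (subst Bochner_Integration.integral_add) auto
  also have "\<dots> \<le> (LINT w|arc_measure. 2 * ln (1 - s n) + ln (hdet (hG (Suc n) r \<delta>' (of_real r * w))))"
  proof (rule integral_mono)
    fix w assume "w \<in> space arc_measure"
    then have z: "cmod (of_real r * w) = r" using r by (simp add: norm_mult)
    let ?z = "of_real r * w"
    interpret st: matrix_schur_step "A n ?z" "A (Suc n) ?z" "qmat (\<gamma> n)" ?z "s n"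
      by (rule step) (use z r in simp)
    have B: "cmod (e (A (Suc n) ?z)) \<le> 1" if "e \<in> {m11, m12, m21, m22}" for e
      by (rule hpsd_contraction_entries[OF hpsd_A that]) (use z r in simp)
    have G: "cmod (e (qmat (\<gamma> n))) \<le> 1" if "e \<in> {m11, m12, m21, m22}" for e
    proof -
      have "norm (\<gamma> n) \<le> 1" using strictly_contractive_norm_0[OF con, of n] \<gamma>[of n] by simp
      then show ?thesis using that cmod_coords_le[of "\<gamma> n"] by (auto simp: qmat_def)
    qed
    have zw: "cmod ?z \<le> 1" using z r by simp
    have pb: "cmod (?z * a * b) \<le> 1" "cmod (?z * a) \<le> 1" if "cmod a \<le> 1" "cmod b \<le> 1" for a b
    proof -
      have "cmod ?z * cmod a \<le> 1 * 1" using zw that by (intro mult_mono) auto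
      then show 1: "cmod (?z * a) \<le> 1" unfolding norm_mult by simp
      have "cmod (?z * a) * cmod b \<le> 1 * 1" using 1 that by (intro mult_mono) auto
      then show "cmod (?z * a * b) \<le> 1" unfolding norm_mult by simp
    qed
    have tri: "cmod (a + b) \<le> x + y" if "cmod a \<le> x" "cmod b \<le> y" for a b x y
      using that norm_triangle_ineq[of a b] by linarith
    have B4: "cmod (m11 (A (Suc n) ?z)) \<le> 1" "cmod (m12 (A (Suc n) ?z)) \<le> 1" "cmod (m21 (A (Suc n) ?z)) \<le> 1" "cmod (m22 (A (Suc n) ?z)) \<le> 1"
      by (rule B, simp)+
    have G4: "cmod (m11 (qmat (\<gamma> n))) \<le> 1" "cmod (m12 (qmat (\<gamma> n))) \<le> 1" "cmod (m21 (qmat (\<gamma> n))) \<le> 1" "cmod (m22 (qmat (\<gamma> n))) \<le> 1"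
      by (rule G, simp)+
    have prod: "cmod (e (mscalar ?z * A (Suc n) ?z * madj (qmat (\<gamma> n)))) \<le> 1 + 1" if "e \<in> {m11, m12, m21, m22}" for e
      using that by (auto simp only: insert_iff empty_iff times_m2.simps madj.simps complex_mod_cnj norm_zero zero_le_one mscalar_def m2.sel mult_zero_left add_0_left add_0_right
          intro!: tri pb B4 G4)
    have prod2: "cmod (e (mscalar ?z * A (Suc n) ?z)) \<le> 1" if "e \<in> {m11, m12, m21, m22}" for e
      using that by (auto simp only: insert_iff empty_iff times_m2.simps madj.simps complex_mod_cnj norm_zero zero_le_one mscalar_def m2.sel mult_zero_left add_0_left add_0_right
          intro!: pb(2)[where b=0] B4)
    have P4: "cmod (m11 (mscalar ?z * A (Suc n) ?z * madj (qmat (\<gamma> n)))) \<le> 1 + 1" "cmod (m12 (mscalar ?z * A (Suc n) ?z * madj (qmat (\<gamma> n)))) \<le> 1 + 1" "cmod (m21 (mscalar ?z * A (Suc n) ?z * madj (qmat (\<gamma> n)))) \<le> 1 + 1" "cmod (m22 (mscalar ?z * A (Suc n) ?z * madj (qmat (\<gamma> n)))) \<le> 1 + 1"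
      by (rule prod, simp)+
    have Q4: "cmod (m11 (mscalar ?z * A (Suc n) ?z)) \<le> 1" "cmod (m12 (mscalar ?z * A (Suc n) ?z)) \<le> 1" "cmod (m21 (mscalar ?z * A (Suc n) ?z)) \<le> 1" "cmod (m22 (mscalar ?z * A (Suc n) ?z)) \<le> 1"
      by (rule prod2, simp)+
    \<comment> \<open>Each entry of z B g^H is a sum of two terms of modulus at most 1, and adding
      the identity gives the bound 3. The squared entries then sum to at most 4 * 3^2 = 36, the
      constant of the statement.\<close>
    have "htr (hgram st.u) \<le> 4 * (1 + (1 + 1))\<^sup>2"
      unfolding st.u_def by (rule htr_hgram_le; unfold plus_m2.simps; rule tri; (rule P4 | simp))
    then have u: "htr (hgram st.u) \<le> 36" by simp
    have "htr (hgram st.v) \<le> 4 * (1 + 1)\<^sup>2"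
      unfolding st.v_def by (rule htr_hgram_le; unfold plus_m2.simps; rule tri; (rule Q4 | rule G4))
    then have v: "htr (hgram st.v) \<le> 36" by simp
    have "\<delta>' = 36 * (\<delta> + (1 - (cmod ?z)\<^sup>2)) / (1 - s n)" unfolding z by (rule \<delta>')
    from st.step_upper[OF u v \<delta> this]
    show "ln (hdet (hG n r \<delta> ?z)) + 2 * ln (cmod (mdet (U n ?z)))
        \<le> 2 * ln (1 - s n) + ln (hdet (hG (Suc n) r \<delta>' ?z))"
      unfolding z hG_def U_def st.u_def by simp
  qed (use integrable_E[OF r \<delta>] integrable_E[OF r \<delta>'0] mean_ln_U(2)[OF r] in auto)
  also have "\<dots> = 2 * ln (1 - s n) + E (Suc n) r \<delta>'"
    unfolding E_def using integrable_E[OF r \<delta>'0, of "Suc n"]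
    by (subst Bochner_Integration.integral_add) (auto simp: measure_arc_space)
  finally show ?thesis .
qed

text \<open>The correction accumulated by n upper steps. It tends to 0 with r for each n but not
  uniformly in n, so in the upper estimate n has to stay fixed while r tends to 1.\<close>

fun \<Delta> :: "nat \<Rightarrow> real \<Rightarrow> real" where
  "\<Delta> 0 r = 0"
| "\<Delta> (Suc n) r = 36 * (\<Delta> n r + (1 - r\<^sup>2)) / (1 - s n)"

lemma \<Delta>_nonneg: "0 \<le> r \<Longrightarrow> r < 1 \<Longrightarrow> 0 \<le> \<Delta> n r"
proof (induction n)
  case (Suc n)
  have "r\<^sup>2 < 1" using Suc.prems by (simp add: abs_square_less_1)
  then show ?case using Suc s_bounds[of n] by simp
qed simp

lemma \<Delta>_tendsto: "(\<Delta> n \<longlongrightarrow> 0) (at_left 1)"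
proof (induction n)
  case (Suc n)
  have "((\<lambda>r. 36 * (\<Delta> n r + (1 - r\<^sup>2)) / (1 - s n)) \<longlongrightarrow> 36 * (0 + (1 - 1\<^sup>2)) / (1 - s n)) (at_left 1)"
    by (intro tendsto_intros Suc) (use s_bounds[of n] in auto)
  then show ?case by simp
qed simp

text \<open>After n steps the remaining entropy is bounded trivially: the matrix is at most (1 +
  \<open>\<Delta> n r\<close>) times the identity.\<close>

lemma E_0_upper:
  assumes r: "0 \<le> r" "r < 1"
  shows "E 0 r 0 \<le> (\<Sum>k<n. 2 * ln (1 - s k)) + 2 * ln (1 + \<Delta> n r)"
proof -
  have "E 0 r 0 \<le> (\<Sum>k<n. 2 * ln (1 - s k)) + E n r (\<Delta> n r)"
  proof (induction n)
    case (Suc n)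
    from E_upper[OF r \<Delta>_nonneg[OF r, of n] refl, of n] Suc show ?case by simp
  qed simp
  also have "E n r (\<Delta> n r) \<le> (LINT w|arc_measure. 2 * ln (1 + \<Delta> n r))"
    unfolding E_def
  proof (rule integral_mono)
    interpret arc: finite_measure arc_measure by (rule finite_measure_arc)
    show "integrable arc_measure (\<lambda>w. 2 * ln (1 + \<Delta> n r))" by simp
    fix w assume "w \<in> space arc_measure"
    then have z: "cmod (of_real r * w) < 1" using r by (simp add: norm_mult)
    note b = hG_bounds[OF z r \<Delta>_nonneg[OF r, of n], of n]
    have "ln (hdet (hG n r (\<Delta> n r) (of_real r * w))) \<le> ln ((1 + \<Delta> n r)\<^sup>2)"
      using b by (intro ln_mono) auto
    then show "ln (hdet (hG n r (\<Delta> n r) (of_real r * w))) \<le> 2 * ln (1 + \<Delta> n r)"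
      by (simp add: ln_realpow)
  qed (rule integrable_E[OF r \<Delta>_nonneg[OF r]])
  finally show ?thesis by (simp add: measure_arc_space)
qed

text \<open>At fixed r the remainder \<open>E n r 0\<close> tends to 0 from below: every coefficient
  of \<open>f n\<close> tends to 0 and is bounded by 1, so by Tannery's theorem \<open>A n\<close>
  tends to 0 uniformly on |z| = r.\<close>

lemma E_0_lower:
  assumes r: "0 \<le> r" "r < 1" and lim: "\<gamma> \<longlonglongrightarrow> 0"
    and L: "\<And>n. L \<le> (\<Sum>k<n. 2 * ln (1 - s k))"
  shows "L \<le> E 0 r 0"
proof -
  define e where "e n = (\<Sum>m. r ^ m * norm (f n $ m))" for n
  have bnd: "norm (r ^ m * norm (f n $ m)) \<le> r ^ m" for n m
    using strictly_contractive_norm_nth_le[OF con, of n m] r by (simp add: mult_left_le)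
  have sm: "summable (\<lambda>m. r ^ m * norm (f n $ m))" for n
    by (rule summable_comparison_test'[where g="\<lambda>m. r ^ m"]) (use r bnd in auto)
  have "(\<lambda>n. \<Sum>m. r ^ m * norm (f n $ m)) \<longlonglongrightarrow> (\<Sum>m. r ^ m * 0)"
  proof (rule conjunct2[OF conjunct2[OF tannerys_theorem]])
    show "(\<lambda>n. r ^ m * norm (f n $ m)) \<longlonglongrightarrow> r ^ m * 0" for m
      by (intro tendsto_intros tendsto_norm_zero schur_functions_nth_tendsto_0[OF con \<gamma> rec lim])
    show "\<forall>\<^sub>F (m, n) in sequentially \<times>\<^sub>F sequentially. norm (r ^ m * norm (f n $ m)) \<le> r ^ m"
      using bnd by (auto intro!: always_eventually)
    show "summable (\<lambda>m. r ^ m)" using r by simp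
  qed simp
  then have e0: "e \<longlonglongrightarrow> 0" by (simp add: e_def[abs_def])
  have chain: "L + E n r 0 \<le> E 0 r 0" for n
  proof -
    have "(\<Sum>k<n. 2 * ln (1 - s k)) + E n r 0 \<le> E 0 r 0"
    proof (induction n)
      case (Suc n)
      from E_lower[OF r, of n] Suc show ?case by simp
    qed simp
    then show ?thesis using L[of n] by simp
  qed
  have ev: "\<forall>\<^sub>F n in sequentially. L + 2 * ln (1 - 4 * (e n)\<^sup>2) \<le> E 0 r 0"
  proof -
    have "(\<lambda>n. 4 * (e n)\<^sup>2) \<longlonglongrightarrow> 4 * 0\<^sup>2" by (intro tendsto_intros e0)
    then have "\<forall>\<^sub>F n in sequentially. 4 * (e n)\<^sup>2 < 1" by (rule order_tendstoD) simp
    then show ?thesis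
    proof eventually_elim
      case (elim n)
      have "(LINT w|arc_measure. 2 * ln (1 - 4 * (e n)\<^sup>2)) \<le> E n r 0"
        unfolding E_def
      proof (rule integral_mono)
        interpret arc: finite_measure arc_measure by (rule finite_measure_arc)
        show "integrable arc_measure (\<lambda>w. 2 * ln (1 - 4 * (e n)\<^sup>2))" by simp
        fix w assume "w \<in> space arc_measure"
        then have z: "cmod (of_real r * w) = r" using r by (simp add: norm_mult)
        let ?z = "of_real r * w"
        have en: "cmod (x (A n ?z)) \<le> e n" if x: "x \<in> {m11, m12, m21, m22}" for x
        proof -
          have zz: "cmod ?z < 1" using z r by simp
          note q = qentry_sums[OF strictly_contractive_qconv[OF con] x zz, of n]
          have "x (A n ?z) = (\<Sum>m. ?z ^ m * x (qmat (f n $ m)))"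
            using q(1) by (simp add: sums_iff A_def)
          also have "cmod \<dots> \<le> (\<Sum>m. cmod (?z ^ m * x (qmat (f n $ m))))"
            by (rule summable_norm[OF q(2)])
          also have "\<dots> \<le> e n"
            unfolding e_def
          proof (rule suminf_le[OF _ q(2) sm])
            fix m
            have "cmod (x (qmat (f n $ m))) \<le> norm (f n $ m)"
              using x cmod_coords_le[of "f n $ m"] by (auto simp: qmat_def)
            then show "cmod (?z ^ m * x (qmat (f n $ m))) \<le> r ^ m * norm (f n $ m)"
              using r z by (simp only: norm_mult[of "?z ^ m"] norm_power mult_left_mono zero_le_power)
          qed
          finally show ?thesis .
        qed
        have tr: "htr (hgram (A n ?z)) \<le> 4 * (e n)\<^sup>2" by (rule htr_hgram_le) (auto intro!: en)
        let ?t = "4 * (e n)\<^sup>2"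
        have r2: "0 \<le> r\<^sup>2" "r\<^sup>2 \<le> 1" using r by (auto simp: abs_square_le_1)
        \<comment> \<open>With t a bound for the trace of A A^H, the matrix 1 - r^2 A A^H exceeds (1
          - t) 1 by three visibly positive terms.\<close>
        have eq: "hG n r 0 ?z - (1 - ?t) *\<^sub>R hone = (htr (hgram (A n ?z)) *\<^sub>R hone - hgram (A n ?z))
           + ((?t - htr (hgram (A n ?z))) *\<^sub>R hone + (1 - r\<^sup>2) *\<^sub>R hgram (A n ?z))"
          by (simp add: hG_def algebra_simps)
        have "hpsd (hG n r 0 ?z - (1 - ?t) *\<^sub>R hone)"
          unfolding eq using tr r2
          by (intro hpsd_add hpsd_scaleR hpsd_htr_bound hpsd_hgram) auto
        moreover have "hpsd ((1 - ?t) *\<^sub>R hone)" using elim by (simp add: hpsd_scaleR)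
        ultimately have "(1 - ?t)\<^sup>2 \<le> hdet (hG n r 0 ?z)"
          using hdet_mono[of "(1 - ?t) *\<^sub>R hone" "hG n r 0 ?z"] by (simp add: hdet_scaleR)
        then have "ln ((1 - ?t)\<^sup>2) \<le> ln (hdet (hG n r 0 ?z))"
          using elim by (intro ln_mono) auto
        then show "2 * ln (1 - ?t) \<le> ln (hdet (hG n r 0 ?z))" by (simp add: ln_realpow)
      qed (rule integrable_E[OF r], simp)
      then show ?case using chain[of n] by (simp add: measure_arc_space)
    qed
  qed
  have "(\<lambda>n. L + 2 * ln (1 - 4 * (e n)\<^sup>2)) \<longlonglongrightarrow> L + 2 * ln (1 - 4 * 0\<^sup>2)"
    by (intro tendsto_intros e0) auto
  from tendsto_upperbound[OF this ev] show ?thesis by simp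
qed

end

section \<open>Vector measures and densities\<close>

lemma vector_measure_sums:
  assumes "vector_measure S \<mu>" "\<And>n. A n \<in> sets S" "disjoint_family A"
  shows "(\<lambda>n. \<mu> (A n)) sums \<mu> (\<Union>n. A n)"
  using assms unfolding vector_measure_def by blast

lemma vector_measure_empty:
  assumes "vector_measure S \<mu>" shows "\<mu> {} = 0"
proof -
  have "(\<lambda>n. \<mu> {}) sums \<mu> (\<Union>n::nat. {})"
    by (rule vector_measure_sums[OF assms]) (auto simp: disjoint_family_on_def)
  then have "(\<lambda>n::nat. \<mu> {}) \<longlonglongrightarrow> 0" by (rule sums_summable[THEN summable_LIMSEQ_zero])
  then show ?thesis by (simp add: LIMSEQ_const_iff)
qed

lemma vector_measure_Un:
  assumes \<mu>: "vector_measure S \<mu>" and A: "A \<in> sets S" and B: "B \<in> sets S" and "A \<inter> B = {}"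
  shows "\<mu> (A \<union> B) = \<mu> A + \<mu> B"
proof -
  define C :: "nat \<Rightarrow> 'a set" where "C n = (if n = 0 then A else if n = 1 then B else {})" for n
  have "(\<lambda>n. \<mu> (C n)) sums \<mu> (\<Union>n. C n)"
    by (rule vector_measure_sums[OF \<mu>]) (use A B assms(4) in \<open>auto simp: C_def disjoint_family_on_def\<close>)
  moreover have "(\<Union>n. C n) = A \<union> B"
    by (auto simp: C_def split: if_splits)
  moreover have "(\<lambda>n. \<mu> (C n)) sums (\<Sum>n\<in>{0, 1}. \<mu> (C n))"
    by (rule sums_finite) (auto simp: C_def vector_measure_empty[OF \<mu>])
  ultimately have "\<mu> (A \<union> B) = (\<Sum>n\<in>{0, 1}. \<mu> (C n))" by (simp add: sums_unique2)
  then show ?thesis by (simp add: C_def)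
qed

lemma vector_measure_Diff:
  assumes \<mu>: "vector_measure S \<mu>" and "A \<in> sets S" "B \<in> sets S" "B \<subseteq> A"
  shows "\<mu> (A - B) = \<mu> A - \<mu> B"
proof -
  have "\<mu> ((A - B) \<union> B) = \<mu> (A - B) + \<mu> B" by (rule vector_measure_Un[OF \<mu>]) (use assms in auto)
  moreover have "(A - B) \<union> B = A" using assms by auto
  ultimately show ?thesis by simp
qed

lemma vector_measure_linear:
  assumes "vector_measure S \<mu>" "bounded_linear T"
  shows "vector_measure S (\<lambda>A. T (\<mu> A))"
  unfolding vector_measure_def
  by (intro allI impI bounded_linear.sums[OF assms(2)] vector_measure_sums[OF assms(1)]) auto

lemma vector_measure_add:
  assumes "vector_measure S \<mu>" "vector_measure S \<nu>"
  shows "vector_measure S (\<lambda>A. \<mu> A + \<nu> A)"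
  unfolding vector_measure_def
  by (intro allI impI sums_add vector_measure_sums[OF assms(1)] vector_measure_sums[OF assms(2)]) auto

lemma vector_measure_measure:
  assumes "finite_measure M" "sets M = sets S"
  shows "vector_measure S (measure M)"
  unfolding vector_measure_def
  by (intro allI impI finite_measure.finite_measure_UNION[OF assms(1)]) (use assms(2) in auto)

section \<open>Countably additive set functions: boundedness, variations, densities\<close>

lemma nonneg_vector_measure:
  assumes \<mu>: "vector_measure S \<mu>" and nn: "\<And>A. A \<in> sets S \<Longrightarrow> 0 \<le> \<mu> A"
  obtains M where "finite_measure M" "sets M = sets S" "space M = space S"
    "\<And>A. A \<in> sets S \<Longrightarrow> measure M A = \<mu> A"
proof
  define M where "M = measure_of (space S) (sets S) (\<lambda>A. ennreal (\<mu> A))"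
  have em: "emeasure M A = ennreal (\<mu> A)" if "A \<in> sets S" for A
    unfolding M_def
  proof (rule emeasure_measure_of_sigma[OF sets.sigma_algebra_axioms _ _ that])
    show "positive (sets S) (\<lambda>A. ennreal (\<mu> A))"
      by (simp add: positive_def vector_measure_empty[OF \<mu>])
    show "countably_additive (sets S) (\<lambda>A. ennreal (\<mu> A))"
    proof (rule countably_additiveI)
      fix A :: "nat \<Rightarrow> 'a set" assume A: "range A \<subseteq> sets S" "disjoint_family A"
      then have "(\<lambda>n. \<mu> (A n)) sums \<mu> (\<Union>n. A n)" by (intro vector_measure_sums[OF \<mu>]) auto
      then show "(\<Sum>n. ennreal (\<mu> (A n))) = ennreal (\<mu> (\<Union>n. A n))"
        using A nn by (intro suminf_ennreal_eq) auto
    qed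
  qed
  show s: "sets M = sets S" "space M = space S" by (simp_all add: M_def)
  show "finite_measure M" by (rule finite_measureI) (simp add: s em)
  show "measure M A = \<mu> A" if "A \<in> sets S" for A
    using em[OF that] nn[OF that] by (simp add: measure_def)
qed

text \<open>Call a set bad if \<mu> is unbounded on its measurable subsets. A bad set loses a piece
  of mass at least 1 in absolute value and leaves a bad set. Were the whole space bad, iteration
  would produce disjoint pieces whose masses are summable but do not tend to 0.\<close>

lemma vector_measure_bounded:
  fixes \<mu> :: "'a set \<Rightarrow> real"
  assumes \<mu>: "vector_measure S \<mu>"
  obtains K where "\<And>A. A \<in> sets S \<Longrightarrow> \<bar>\<mu> A\<bar> \<le> K"
proof -
  define bad where "bad A \<longleftrightarrow> A \<in> sets S \<and> (\<forall>K. \<exists>B\<in>sets S. B \<subseteq> A \<and> \<bar>\<mu> B\<bar> > K)" for A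
  have step: "\<exists>A'. bad A' \<and> A' \<subseteq> A \<and> 1 \<le> \<bar>\<mu> (A - A')\<bar>" if A: "bad A" for A
  proof -
    have As: "A \<in> sets S" using A by (simp add: bad_def)
    \<comment> \<open>The bound makes both |\<mu> B| and |\<mu> (A - B)| exceed 1, so it does not
      matter which half stays bad.\<close>
    obtain B where B: "B \<in> sets S" "B \<subseteq> A" "\<bar>\<mu> B\<bar> > \<bar>\<mu> A\<bar> + 1"
      using A unfolding bad_def by blast
    have d: "\<mu> (A - B) = \<mu> A - \<mu> B" by (rule vector_measure_Diff[OF \<mu> As B(1,2)])
    have "bad B \<or> bad (A - B)"
    proof (rule ccontr)
      assume "\<not> (bad B \<or> bad (A - B))"
      then obtain K1 K2 where K1: "\<And>C. C \<in> sets S \<Longrightarrow> C \<subseteq> B \<Longrightarrow> \<bar>\<mu> C\<bar> \<le> K1"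
        and K2: "\<And>C. C \<in> sets S \<Longrightarrow> C \<subseteq> A - B \<Longrightarrow> \<bar>\<mu> C\<bar> \<le> K2"
        using As B(1) unfolding bad_def by (metis linorder_not_less sets.Diff)
      obtain C where C: "C \<in> sets S" "C \<subseteq> A" "\<bar>\<mu> C\<bar> > K1 + K2"
        using A unfolding bad_def by blast
      have "\<mu> ((C \<inter> B) \<union> (C - B)) = \<mu> (C \<inter> B) + \<mu> (C - B)"
        by (rule vector_measure_Un[OF \<mu>]) (use B C in auto)
      moreover have "(C \<inter> B) \<union> (C - B) = C" by blast
      ultimately have "\<mu> C = \<mu> (C \<inter> B) + \<mu> (C - B)" by simp
      moreover have "\<bar>\<mu> (C \<inter> B)\<bar> \<le> K1" using B C by (intro K1) auto
      moreover have "\<bar>\<mu> (C - B)\<bar> \<le> K2" using B C by (intro K2) auto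
      ultimately show False using C(3) by linarith
    qed
    then show ?thesis
    proof
      assume "bad B"
      moreover have "1 \<le> \<bar>\<mu> (A - B)\<bar>" using B(3) d by linarith
      ultimately show ?thesis using B(2) by blast
    next
      assume b: "bad (A - B)"
      have "A - (A - B) = B" using B(2) by blast
      then have "1 \<le> \<bar>\<mu> (A - (A - B))\<bar>" using B(3) by simp
      then show ?thesis using b by blast
    qed
  qed
  have "\<not> bad (space S)"
  proof
    assume "bad (space S)"
    then obtain A where A: "\<And>n. bad (A n)" "\<And>n. A (Suc n) \<subseteq> A n \<and> 1 \<le> \<bar>\<mu> (A n - A (Suc n))\<bar>"
      using dependent_nat_choice[of "\<lambda>_. bad" "\<lambda>_ A A'. A' \<subseteq> A \<and> 1 \<le> \<bar>\<mu> (A - A')\<bar>"] step by metis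
    have dec: "decseq A" using A(2) by (intro decseq_SucI) auto
    have "(\<lambda>n. \<mu> (A n - A (Suc n))) sums \<mu> (\<Union>n. A n - A (Suc n))"
    proof (rule vector_measure_sums[OF \<mu>])
      show "A n - A (Suc n) \<in> sets S" for n using A(1) by (auto simp: bad_def)
      have "(A m - A (Suc m)) \<inter> (A n - A (Suc n)) = {}" if "m < n" for m n
        using decseqD[OF dec, of "Suc m" n] that by auto
      then show "disjoint_family (\<lambda>n. A n - A (Suc n))"
        unfolding disjoint_family_on_def by (metis inf_commute nat_neq_iff)
    qed
    then have "(\<lambda>n. \<mu> (A n - A (Suc n))) \<longlonglongrightarrow> 0" by (rule sums_summable[THEN summable_LIMSEQ_zero])
    then have "\<forall>\<^sub>F n in sequentially. \<bar>\<mu> (A n - A (Suc n))\<bar> < 1"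
      by (intro order_tendstoD(2)[of _ 0]) (auto intro: tendsto_rabs_zero)
    then show False using A(2) by (auto simp: eventually_sequentially not_less[symmetric])
  qed
  then obtain K where K: "\<And>B. B \<in> sets S \<Longrightarrow> B \<subseteq> space S \<Longrightarrow> \<bar>\<mu> B\<bar> \<le> K"
    unfolding bad_def by (metis linorder_not_less sets.top)
  show ?thesis by (rule that, rule K) (auto dest: sets.sets_into_space)
qed

text \<open>Joining subsets of disjoint sets shows that the supremum is superadditive; cutting a
  subset B of the union into the pieces B \<inter> A n shows that it is countably
  subadditive.\<close>

lemma positive_variation_measure:
  fixes \<mu> :: "'a set \<Rightarrow> real"
  assumes \<mu>: "vector_measure S \<mu>"
  defines "P \<equiv> (\<lambda>A. SUP B\<in>{B \<in> sets S. B \<subseteq> A}. ennreal (\<mu> B))"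
  shows "positive (sets S) P" "countably_additive (sets S) P"
proof -
  note \<mu>0 = vector_measure_empty[OF \<mu>]
  have PE: "P A = (SUP B\<in>{B \<in> sets S. B \<subseteq> A}. ennreal (\<mu> B))" for A
    by (simp add: P_def)
  have le_P: "ennreal (\<mu> B) \<le> P A" if "B \<in> sets S" "B \<subseteq> A" for A B
    unfolding P_def by (rule SUP_upper) (use that in auto)
  have mono: "P A \<le> P B" if "A \<subseteq> B" for A B
    unfolding P_def by (rule SUP_subset_mono) (use that in auto)
  show "positive (sets S) P"
  proof -
    have "{B \<in> sets S. B \<subseteq> {}} = {{}}" by auto
    then show ?thesis unfolding positive_def PE by (simp add: \<mu>0)
  qed
  have plus: "P A + P B \<le> P (A \<union> B)" if A: "A \<in> sets S" and B: "B \<in> sets S" and "A \<inter> B = {}" for A B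
  proof -
    have 1: "ennreal (\<mu> C) + ennreal (\<mu> D) \<le> P (A \<union> B)"
      if C: "C \<in> sets S" "C \<subseteq> A" and D: "D \<in> sets S" "D \<subseteq> B" for C D
    proof -
      \<comment> \<open>\<open>ennreal\<close> truncates negative values to 0, so a subset of
        negative mass is dropped instead of joined.\<close>
      consider "\<mu> C \<le> 0" | "\<mu> D \<le> 0" | "0 \<le> \<mu> C" "0 \<le> \<mu> D" by linarith
      then show ?thesis
      proof cases
        case 1
        then show ?thesis using le_P[OF D(1), of "A \<union> B"] D by (auto simp: ennreal_neg)
      next
        case 2
        then show ?thesis using le_P[OF C(1), of "A \<union> B"] C by (auto simp: ennreal_neg)
      next
        case 3
        then have "ennreal (\<mu> C) + ennreal (\<mu> D) = ennreal (\<mu> C + \<mu> D)" by simp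
        also have "\<mu> C + \<mu> D = \<mu> (C \<union> D)"
          by (rule vector_measure_Un[OF \<mu>, symmetric]) (use C D \<open>A \<inter> B = {}\<close> in auto)
        finally show ?thesis using le_P[of "C \<union> D" "A \<union> B"] C D by auto
      qed
    qed
    have ne: "{B' \<in> sets S. B' \<subseteq> X} \<noteq> {}" for X by (auto intro!: exI[of _ "{}"])
    have "P A + ennreal (\<mu> D) \<le> P (A \<union> B)" if "D \<in> sets S" "D \<subseteq> B" for D
      unfolding PE[of A] ennreal_SUP_add_left[OF ne, symmetric]
      by (rule SUP_least) (use 1 that in auto)
    then have "(SUP D\<in>{D \<in> sets S. D \<subseteq> B}. P A + ennreal (\<mu> D)) \<le> P (A \<union> B)"
      by (intro SUP_least) auto
    then show ?thesis
      unfolding PE[of B] using ennreal_SUP_add_right[OF ne, of "P A" "\<lambda>D. ennreal (\<mu> D)" B] by simp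
  qed
  show "countably_additive (sets S) P"
  proof (rule countably_additiveI)
    fix A :: "nat \<Rightarrow> 'a set" assume A: "range A \<subseteq> sets S" "disjoint_family A" "\<Union> (range A) \<in> sets S"
    have As: "A n \<in> sets S" for n using A by auto
    show "(\<Sum>n. P (A n)) = P (\<Union> (range A))"
    proof (rule antisym)
      have "(\<Sum>n<N. P (A n)) \<le> P (\<Union>n<N. A n)" for N
      proof (induction N)
        case (Suc N)
        have "(\<Union>n<N. A n) \<inter> A N = {}"
          using A(2) unfolding disjoint_family_on_def by (auto, metis disjoint_iff less_irrefl)
        then have "P (\<Union>n<N. A n) + P (A N) \<le> P ((\<Union>n<N. A n) \<union> A N)"
          by (intro plus) (use As in auto)
        then show ?case using Suc by (simp add: lessThan_Suc Un_commute add.commute)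
           (meson add_left_mono order_trans)
      qed simp
      then have "(\<Sum>n<N. P (A n)) \<le> P (\<Union> (range A))" for N
        by (rule order_trans) (rule mono, auto)
      then show "(\<Sum>n. P (A n)) \<le> P (\<Union> (range A))" by (intro suminf_le_const) auto
    next
      show "P (\<Union> (range A)) \<le> (\<Sum>n. P (A n))"
        unfolding PE[of "\<Union> (range A)"]
      proof (rule SUP_least, clarify)
        fix B assume B: "B \<in> sets S" "B \<subseteq> \<Union> (range A)"
        have "(\<lambda>n. \<mu> (B \<inter> A n)) sums \<mu> (\<Union>n. B \<inter> A n)"
          by (rule vector_measure_sums[OF \<mu>]) (use A B As in \<open>auto simp: disjoint_family_on_def\<close>)
        moreover have "(\<Union>n. B \<inter> A n) = B" using B by auto
        ultimately have "(\<lambda>N. \<Sum>n<N. \<mu> (B \<inter> A n)) \<longlonglongrightarrow> \<mu> B" by (simp add: sums_def)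
        then have lim: "(\<lambda>N. ennreal (\<Sum>n<N. \<mu> (B \<inter> A n))) \<longlonglongrightarrow> ennreal (\<mu> B)"
          by (rule tendsto_ennrealI)
        have sub: "ennreal (a + b) \<le> ennreal a + ennreal b" for a b
        proof -
          have "ennreal (a + b) \<le> ennreal (max 0 a + max 0 b)" by (rule ennreal_leI) auto
          then show ?thesis by (auto simp: max_def ennreal_neg split: if_splits)
        qed
        have "ennreal (\<Sum>n<N. \<mu> (B \<inter> A n)) \<le> (\<Sum>n<N. P (A n))" for N
        proof (induction N)
          case (Suc N)
          have "ennreal (\<Sum>n<Suc N. \<mu> (B \<inter> A n)) \<le> ennreal (\<Sum>n<N. \<mu> (B \<inter> A n)) + ennreal (\<mu> (B \<inter> A N))"
            by (simp add: sub)
          also have "\<dots> \<le> (\<Sum>n<N. P (A n)) + P (A N)"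
            by (intro add_mono Suc le_P) (use B As in auto)
          finally show ?case by simp
        qed simp
        also have "(\<Sum>n<N. P (A n)) \<le> (\<Sum>n. P (A n))" for N by (rule sum_le_suminf) auto
        finally show "ennreal (\<mu> B) \<le> (\<Sum>n. P (A n))"
          using lim by (intro LIMSEQ_le_const2[OF lim]) auto
      qed
    qed
  qed
qed

text \<open>\<open>L\<close> is the total variation, the sum of the positive variations of \<mu> and
  -\<mu>. It is finite because \<mu> is bounded.\<close>

lemma vector_measure_dominated:
  fixes \<mu> :: "'a set \<Rightarrow> real"
  assumes \<mu>: "vector_measure S \<mu>"
  obtains L where "finite_measure L" "sets L = sets S" "\<And>A. A \<in> sets S \<Longrightarrow> \<bar>\<mu> A\<bar> \<le> measure L A"
proof -
  define P where "P \<mu> A = (SUP B\<in>{B \<in> sets S. B \<subseteq> A}. ennreal (\<mu> B))" for \<mu> :: "'a set \<Rightarrow> real" and A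
  have \<mu>': "vector_measure S (\<lambda>A. - \<mu> A)"
    using vector_measure_linear[OF \<mu> bounded_linear_minus[OF bounded_linear_ident]] .
  note pos = positive_variation_measure[OF \<mu>, folded P_def] positive_variation_measure[OF \<mu>', folded P_def]
  obtain K where K: "\<And>A. A \<in> sets S \<Longrightarrow> \<bar>\<mu> A\<bar> \<le> K" using vector_measure_bounded[OF \<mu>] by blast
  have fin: "P \<mu> A \<le> ennreal K" "P (\<lambda>A. - \<mu> A) A \<le> ennreal K" for A
    unfolding P_def by (rule SUP_least, use K in \<open>auto intro!: ennreal_leI simp: abs_le_iff\<close>)+
  define L where "L = measure_of (space S) (sets S) (\<lambda>A. P \<mu> A + P (\<lambda>A. - \<mu> A) A)"
  have em: "emeasure L A = P \<mu> A + P (\<lambda>A. - \<mu> A) A" if "A \<in> sets S" for A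
    unfolding L_def
  proof (rule emeasure_measure_of_sigma[OF sets.sigma_algebra_axioms _ _ that])
    show "positive (sets S) (\<lambda>A. P \<mu> A + P (\<lambda>A. - \<mu> A) A)" using pos by (simp add: positive_def)
    show "countably_additive (sets S) (\<lambda>A. P \<mu> A + P (\<lambda>A. - \<mu> A) A)"
      using pos by (auto simp: countably_additive_def suminf_add[symmetric])
  qed
  show ?thesis
  proof (rule that)
    show s: "sets L = sets S" by (simp add: L_def)
    have sp: "space L = space S" by (simp add: L_def)
    have lt: "emeasure L A < \<infinity>" if "A \<in> sets S" for A
      unfolding em[OF that] using fin[of A] by (auto intro: le_less_trans)
    show f: "finite_measure L" by (rule finite_measureI) (use lt[of "space S"] in \<open>auto simp: sp\<close>)
    fix A assume A: "A \<in> sets S"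
    have "ennreal \<bar>\<mu> A\<bar> \<le> emeasure L A"
    proof (cases "\<mu> A \<ge> 0")
      case True
      have "ennreal (\<mu> A) \<le> P \<mu> A" unfolding P_def by (rule SUP_upper) (use A in auto)
      then show ?thesis using True by (simp add: em[OF A] add_increasing2)
    next
      case False
      have "ennreal (- \<mu> A) \<le> P (\<lambda>A. - \<mu> A) A" unfolding P_def by (rule SUP_upper) (use A in auto)
      then show ?thesis using False by (simp add: em[OF A] add_increasing)
    qed
    then show "\<bar>\<mu> A\<bar> \<le> measure L A"
      using finite_measure.emeasure_eq_measure[OF f, of A] by (simp add: ennreal_le_iff)
  qed
qed

text \<open>Domination makes \<mu> + L a nonnegative measure that is absolutely continuous with
  respect to L. The Radon-Nikodym density of the sum, minus 1, is the density of \<mu>.\<close>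

lemma dominated_vector_measure_density:
  fixes \<mu> :: "'a set \<Rightarrow> real"
  assumes \<mu>: "vector_measure S \<mu>" and L: "finite_measure L" "sets L = sets S"
    and dom: "\<And>A. A \<in> sets S \<Longrightarrow> \<bar>\<mu> A\<bar> \<le> measure L A"
  obtains h :: "'a \<Rightarrow> real" where "integrable L h" "\<And>A. A \<in> sets S \<Longrightarrow> \<mu> A = set_lebesgue_integral L A h"
proof -
  interpret L: finite_measure L by fact
  obtain N where N: "finite_measure N" "sets N = sets S" "space N = space S"
    and mN: "\<And>A. A \<in> sets S \<Longrightarrow> measure N A = \<mu> A + measure L A"
    using nonneg_vector_measure[OF vector_measure_add[OF \<mu> vector_measure_measure[OF L]]] dom
    by (smt (verit))
  interpret N: finite_measure N by fact
  have ac: "absolutely_continuous L N"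
    unfolding absolutely_continuous_def
  proof
    fix A assume A: "A \<in> null_sets L"
    then have "A \<in> sets S" "measure L A = 0" using L(2) by (auto simp: measure_eq_0_null_sets)
    then have "measure N A = 0" using mN[of A] dom[of A] by simp
    then show "A \<in> null_sets N" using \<open>A \<in> sets S\<close> N(2) by (simp add: null_setsI N.emeasure_eq_measure)
  qed
  have sN: "sets N = sets L" using N(2) L(2) by simp
  obtain D where D: "D \<in> borel_measurable L" "AE x in L. RN_deriv L N x = ennreal (D x)" "\<And>x. 0 \<le> D x"
    using L.real_RN_deriv[OF N(1) ac sN] by blast
  have "density L (\<lambda>x. ennreal (D x)) = density L (RN_deriv L N)"
    by (rule density_cong) (use D in auto)
  also have "\<dots> = N" by (rule L.density_RN_deriv[OF ac sN])
  finally have dN: "density L (\<lambda>x. ennreal (D x)) = N" .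
  have em: "(\<integral>\<^sup>+x\<in>A. ennreal (D x) \<partial>L) = ennreal (measure N A)" if "A \<in> sets L" for A
    using D(1) that by (simp add: dN[symmetric] emeasure_density[symmetric])
       (simp add: dN N.emeasure_eq_measure)
  have Dint: "integrable L D"
  proof (rule integrableI_nonneg)
    show "(\<integral>\<^sup>+x. ennreal (D x) \<partial>L) < \<infinity>"
      using em[of "space L"] by (simp cong: nn_integral_cong)
  qed (use D in auto)
  show ?thesis
  proof (rule that)
    show "integrable L (\<lambda>x. D x - 1)" using Dint by simp
    fix A assume A: "A \<in> sets S"
    then have AL: "A \<in> sets L" using L(2) by simp
    have "set_lebesgue_integral L A D = enn2real (\<integral>\<^sup>+x\<in>A. ennreal (D x) \<partial>L)"
      unfolding set_lebesgue_integral_def using D AL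
      by (subst integral_eq_nn_integral)
         (auto intro!: arg_cong[where f=enn2real] nn_integral_cong simp: indicator_def)
    then have "measure N A = set_lebesgue_integral L A D"
      by (simp add: em[OF AL])
    moreover have "set_lebesgue_integral L A (\<lambda>x. D x - 1) = set_lebesgue_integral L A D - measure L A"
    proof -
      have "integrable L (\<lambda>x. indicator A x *\<^sub>R D x)" by (rule integrable_mult_indicator[OF AL Dint])
      moreover have "integrable L (\<lambda>x. indicator A x :: real)"
        using AL by (intro integrable_real_indicator) (auto simp: L.emeasure_eq_measure)
      ultimately have "(LINT x|L. indicator A x *\<^sub>R D x - indicator A x) =
          (LINT x|L. indicator A x *\<^sub>R D x) - (LINT x|L. indicator A x)"
        by (rule Bochner_Integration.integral_diff)
      then show ?thesis
        using AL sets.sets_into_space[OF AL]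
        by (simp add: set_lebesgue_integral_def algebra_simps Int_absorb2)
    qed
    ultimately show "\<mu> A = set_lebesgue_integral L A (\<lambda>x. D x - 1)"
      using mN[OF A] by simp
  qed
qed

text \<open>The supremum over subsets of A is attained at the part of A where h > 0. Hence the
  variations in \<open>signed_integral\<close> have the positive parts of h and -h as densities, and
  moments turn into ordinary integrals.\<close>

lemma positive_variation_density:
  fixes h :: "'a \<Rightarrow> real"
  assumes L: "sets L = sets S" and h: "integrable L h"
    and \<mu>: "\<And>A. A \<in> sets S \<Longrightarrow> \<mu> A = set_lebesgue_integral L A h"
  shows "positive_variation S \<mu> = density L (\<lambda>x. ennreal (h x))"
proof -
  have sp: "space L = space S" using sets_eq_imp_space_eq[OF L] .
  have hm [measurable]: "h \<in> borel_measurable L" using h by auto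
  have eq: "(SUP B\<in>{B \<in> sets S. B \<subseteq> A}. ennreal (\<mu> B)) = emeasure (density L (\<lambda>x. ennreal (h x))) A"
    if A: "A \<in> sets S" for A
  proof (rule antisym)
    have AL [measurable]: "A \<in> sets L" using A L by simp
    show "(SUP B\<in>{B \<in> sets S. B \<subseteq> A}. ennreal (\<mu> B)) \<le> emeasure (density L (\<lambda>x. ennreal (h x))) A"
    proof (rule SUP_least, clarify)
      fix B assume B: "B \<in> sets S" "B \<subseteq> A"
      have BL [measurable]: "B \<in> sets L" using B L by simp
      have int: "integrable L (\<lambda>x. indicator B x * h x)"
        using integrable_mult_indicator[OF BL h] by simp
      have "\<mu> B = (LINT x|L. indicator B x * h x)"
        by (simp add: \<mu>[OF B(1)] set_lebesgue_integral_def)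
      also have "\<dots> \<le> (LINT x|L. max 0 (indicator B x * h x))"
        using int by (intro integral_mono integrable_max) auto
      finally have "ennreal (\<mu> B) \<le> ennreal (LINT x|L. max 0 (indicator B x * h x))" by (rule ennreal_leI)
      also have "\<dots> = (\<integral>\<^sup>+x. ennreal (max 0 (indicator B x * h x)) \<partial>L)"
        using int by (intro nn_integral_eq_integral[symmetric] integrable_max) auto
      also have "\<dots> \<le> (\<integral>\<^sup>+x. ennreal (h x) * indicator A x \<partial>L)"
        using B(2) by (intro nn_integral_mono) (auto simp: indicator_def max_def ennreal_neg)
      also have "\<dots> = emeasure (density L (\<lambda>x. ennreal (h x))) A"
        by (subst emeasure_density) auto
      finally show "ennreal (\<mu> B) \<le> emeasure (density L (\<lambda>x. ennreal (h x))) A" .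
    qed
    define B where "B = A \<inter> {x \<in> space L. h x > 0}"
    have BL [measurable]: "B \<in> sets L" unfolding B_def by measurable
    have int: "integrable L (\<lambda>x. indicator B x * h x)"
      using integrable_mult_indicator[OF BL h] by simp
    have "emeasure (density L (\<lambda>x. ennreal (h x))) A = (\<integral>\<^sup>+x. ennreal (h x) * indicator A x \<partial>L)"
      by (subst emeasure_density) auto
    also have "\<dots> = (\<integral>\<^sup>+x. ennreal (indicator B x * h x) \<partial>L)"
      by (intro nn_integral_cong) (auto simp: indicator_def B_def ennreal_neg)
    also have "\<dots> = ennreal (LINT x|L. indicator B x * h x)"
      using int by (intro nn_integral_eq_integral) (auto simp: B_def indicator_def)
    also have "\<dots> = ennreal (\<mu> B)"
      using BL L by (subst \<mu>) (auto simp: set_lebesgue_integral_def)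
    also have "\<dots> \<le> (SUP B\<in>{B \<in> sets S. B \<subseteq> A}. ennreal (\<mu> B))"
      using BL L by (intro SUP_upper) (auto simp: B_def)
    finally show "emeasure (density L (\<lambda>x. ennreal (h x))) A \<le> (SUP B\<in>{B \<in> sets S. B \<subseteq> A}. ennreal (\<mu> B))" .
  qed
  have "positive_variation S \<mu> = measure_of (space S) (sets S) (emeasure (density L (\<lambda>x. ennreal (h x))))"
    unfolding positive_variation_def
    by (rule measure_of_eq[OF sets.space_closed]) (simp add: eq sets.sigma_sets_eq)
  also have "\<dots> = density L (\<lambda>x. ennreal (h x))"
    using measure_of_of_measure[of "density L (\<lambda>x. ennreal (h x))"] by (simp add: L sp)
  finally show ?thesis .
qed

lemma integrable_scaleR_bounded:
  fixes g :: "'a \<Rightarrow> real" and f :: "'a \<Rightarrow> 'b :: {banach, second_countable_topology}"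
  assumes g: "integrable L g" and f: "f \<in> borel_measurable L" "\<And>x. x \<in> space L \<Longrightarrow> norm (f x) \<le> B"
  shows "integrable L (\<lambda>x. g x *\<^sub>R f x)"
proof (rule Bochner_Integration.integrable_bound)
  show "integrable L (\<lambda>x. B * g x)" using g by simp
  show "(\<lambda>x. g x *\<^sub>R f x) \<in> borel_measurable L" using g f by auto
  show "AE x in L. norm (g x *\<^sub>R f x) \<le> norm (B * g x)"
  proof (rule AE_I2)
    fix x assume "x \<in> space L"
    then have "norm (f x) \<le> \<bar>B\<bar>" using f(2)[of x] by linarith
    then have "norm (f x) * \<bar>g x\<bar> \<le> \<bar>B\<bar> * \<bar>g x\<bar>" by (rule mult_right_mono) simp
    then show "norm (g x *\<^sub>R f x) \<le> norm (B * g x)"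
      by (simp add: abs_mult mult.commute)
  qed
qed

lemma signed_integral_density:
  fixes h :: "'a \<Rightarrow> real" and f :: "'a \<Rightarrow> complex"
  assumes L: "sets L = sets S" and h: "integrable L h"
    and \<mu>: "\<And>A. A \<in> sets S \<Longrightarrow> \<mu> A = set_lebesgue_integral L A h"
    and f: "f \<in> borel_measurable L" "\<And>x. x \<in> space L \<Longrightarrow> norm (f x) \<le> B"
  shows "signed_integral S \<mu> f = (LINT x|L. h x *\<^sub>R f x)"
proof -
  have int: "integrable L (\<lambda>x. g x *\<^sub>R f x)" if "integrable L g" for g :: "'a \<Rightarrow> real"
    by (rule integrable_scaleR_bounded[OF that f])
  have pos: "integral\<^sup>L (density L (\<lambda>x. ennreal (g x))) f = (LINT x|L. max 0 (g x) *\<^sub>R f x)"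
    if "integrable L g" for g
  proof -
    have "density L (\<lambda>x. ennreal (g x)) = density L (\<lambda>x. ennreal (max 0 (g x)))"
      by (rule arg_cong[where f="density L"]) (auto simp: fun_eq_iff max_def ennreal_neg)
    then show ?thesis using that f by (simp add: integral_density)
  qed
  have h': "integrable L (\<lambda>x. - h x)" using h by simp
  have \<mu>': "- \<mu> A = set_lebesgue_integral L A (\<lambda>x. - h x)" if "A \<in> sets S" for A
    by (simp add: \<mu>[OF that] set_lebesgue_integral_def)
  have "signed_integral S \<mu> f = (LINT x|L. max 0 (h x) *\<^sub>R f x) - (LINT x|L. max 0 (- h x) *\<^sub>R f x)"
  proof -
    have "positive_variation S \<mu> = density L (\<lambda>x. ennreal (h x))"
      using \<mu> by (rule positive_variation_density[OF L h])
    moreover have "positive_variation S (\<lambda>A. - \<mu> A) = density L (\<lambda>x. ennreal (- h x))"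
      using \<mu>' by (rule positive_variation_density[OF L h'])
    ultimately show ?thesis by (simp only: signed_integral_def pos[OF h] pos[OF h'])
  qed
  also have "\<dots> = (LINT x|L. max 0 (h x) *\<^sub>R f x - max 0 (- h x) *\<^sub>R f x)"
    by (intro Bochner_Integration.integral_diff[symmetric] int integrable_max h h') simp_all
  also have "\<dots> = (LINT x|L. h x *\<^sub>R f x)"
    by (intro Bochner_Integration.integral_cong) (auto simp: max_def)
  finally show ?thesis .
qed

lemma complex_integral_density:
  fixes h :: "'a \<Rightarrow> complex"
  assumes L: "sets L = sets S" and h: "integrable L h"
    and \<mu>: "\<And>A. A \<in> sets S \<Longrightarrow> \<mu> A = set_lebesgue_integral L A h"
    and f: "f \<in> borel_measurable L" "\<And>x. x \<in> space L \<Longrightarrow> norm (f x) \<le> B"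
  shows "complex_integral S \<mu> f = (LINT x|L. h x * f x)"
proof -
  have int: "integrable L (\<lambda>x. indicator A x *\<^sub>R h x)" if "A \<in> sets S" for A
    using that L h by (intro integrable_mult_indicator) auto
  have re: "Re (\<mu> A) = set_lebesgue_integral L A (\<lambda>x. Re (h x))"
    and im: "Im (\<mu> A) = set_lebesgue_integral L A (\<lambda>x. Im (h x))" if "A \<in> sets S" for A
    using integral_Re[OF int[OF that]] integral_Im[OF int[OF that]]
    by (simp_all add: \<mu>[OF that] set_lebesgue_integral_def)
  have fh: "integrable L (\<lambda>x. g x *\<^sub>R f x)" if "integrable L g" for g :: "'a \<Rightarrow> real"
    by (rule integrable_scaleR_bounded[OF that f])
  have "complex_integral S \<mu> f = (LINT x|L. Re (h x) *\<^sub>R f x) + \<i> * (LINT x|L. Im (h x) *\<^sub>R f x)"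
    unfolding complex_integral_def
    using signed_integral_density[OF L integrable_Re[OF h] re f] signed_integral_density[OF L integrable_Im[OF h] im f]
    by simp
  also have "\<dots> = (LINT x|L. Re (h x) *\<^sub>R f x + \<i> * (Im (h x) *\<^sub>R f x))"
    using fh[OF integrable_Re[OF h]] fh[OF integrable_Im[OF h]]
    by (subst Bochner_Integration.integral_add) (auto simp del: mult_scaleR_right)
  also have "\<dots> = (LINT x|L. h x * f x)"
    by (intro Bochner_Integration.integral_cong) (auto simp: complex_eq_iff)
  finally show ?thesis .
qed

lemma complex_vector_measure_density:
  fixes \<mu> :: "'a set \<Rightarrow> complex"
  assumes \<mu>: "vector_measure S \<mu>" and L: "finite_measure L" "sets L = sets S"
    and dom: "\<And>A. A \<in> sets S \<Longrightarrow> \<bar>Re (\<mu> A)\<bar> \<le> measure L A" "\<And>A. A \<in> sets S \<Longrightarrow> \<bar>Im (\<mu> A)\<bar> \<le> measure L A"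
  obtains h :: "'a \<Rightarrow> complex" where "integrable L h" "\<And>A. A \<in> sets S \<Longrightarrow> \<mu> A = set_lebesgue_integral L A h"
proof -
  obtain a where a: "integrable L a" "\<And>A. A \<in> sets S \<Longrightarrow> Re (\<mu> A) = set_lebesgue_integral L A a"
    using dominated_vector_measure_density[OF vector_measure_linear[OF \<mu> bounded_linear_Re] L dom(1)] by blast
  obtain b where b: "integrable L b" "\<And>A. A \<in> sets S \<Longrightarrow> Im (\<mu> A) = set_lebesgue_integral L A b"
    using dominated_vector_measure_density[OF vector_measure_linear[OF \<mu> bounded_linear_Im] L dom(2)] by blast
  define h where "h x = of_real (a x) + \<i> * of_real (b x)" for x
  have h: "integrable L h" unfolding h_def using a b by simp
  show ?thesis
  proof (rule that[OF h])
    fix A assume A: "A \<in> sets S"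
    have int: "integrable L (\<lambda>x. indicator A x *\<^sub>R h x)"
      using A L h by (intro integrable_mult_indicator) auto
    show "\<mu> A = set_lebesgue_integral L A h"
      using integral_Re[OF int] integral_Im[OF int] a(2)[OF A] b(2)[OF A]
      by (simp add: complex_eq_iff set_lebesgue_integral_def h_def)
  qed
qed

section \<open>Approximation by continuous functions on the circle\<close>

lemma finite_borel_inner_approx:
  assumes L: "finite_measure L" "sets L = sets circle" and A: "A \<in> sets circle" and e: "e > 0"
  obtains K where "compact K" "K \<subseteq> A" "measure L (A - K) < e"
proof -
  interpret L: finite_measure L by fact
  have sp: "space L = sphere 0 1" using sets_eq_imp_space_eq[OF L(2)] by simp
  \<comment> \<open>Pushed forward to the whole plane, a finite Borel measure is inner regular;
    compact subsets of A lie in the circle anyway.\<close>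
  define N where "N = distr L borel (\<lambda>x. x)"
  have id: "(\<lambda>x. x) \<in> L \<rightarrow>\<^sub>M borel"
    using measurable_circle_continuous[OF continuous_on_id] L(2) by (simp cong: measurable_cong_sets)
  have sub: "X \<in> sets borel" if "X \<in> sets circle" for X
    using that unfolding circle_def sets_restrict_space by (auto intro: borel_closed)
  have emN: "emeasure N X = emeasure L (X \<inter> sphere 0 1)" if "X \<in> sets borel" for X
    unfolding N_def using that id by (simp add: emeasure_distr sp)
  have fin: "emeasure N (space N) \<noteq> \<infinity>"
    using emN[of UNIV] L.emeasure_finite by (simp add: N_def)
  have AS: "A \<subseteq> sphere 0 1" using sets.sets_into_space[OF A] by simp
  have "emeasure N A = (SUP K\<in>{K. K \<subseteq> A \<and> compact K}. emeasure N K)"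
    by (rule inner_regular) (use fin sub[OF A] in \<open>simp_all add: N_def\<close>)
  then have "emeasure L A = (SUP K\<in>{K. K \<subseteq> A \<and> compact K}. emeasure N K)"
    using emN[OF sub[OF A]] AS by (simp add: Int_absorb2)
  note SUP = this
  have "\<exists>K\<in>{K. K \<subseteq> A \<and> compact K}. emeasure L A < emeasure N K + ennreal e"
  proof (rule ccontr)
    assume "\<not> ?thesis"
    then have "(SUP K\<in>{K. K \<subseteq> A \<and> compact K}. emeasure N K + ennreal e) \<le> emeasure L A"
      by (intro SUP_least) (auto simp: not_less)
    also have "(SUP K\<in>{K. K \<subseteq> A \<and> compact K}. emeasure N K + ennreal e) = emeasure L A + ennreal e"
      unfolding SUP by (rule ennreal_SUP_add_left) auto
    finally show False using e by (simp add: L.emeasure_eq_measure flip: ennreal_plus)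
  qed
  then obtain K where K: "K \<subseteq> A" "compact K" "emeasure L A < emeasure N K + ennreal e" by blast
  have Kb: "K \<in> sets borel" using K by (auto intro: borel_compact)
  have "K \<inter> sphere 0 1 = K" using K AS by auto
  then have KL: "K \<in> sets L" "emeasure N K = emeasure L K"
    using Kb emN[OF Kb] unfolding L(2) circle_def sets_restrict_space by auto
  have "measure L A < measure L K + e"
    using K(3) e unfolding KL(2) L.emeasure_eq_measure by (simp add: ennreal_less_iff flip: ennreal_plus)
  moreover have "measure L (A - K) = measure L A - measure L K"
    using K KL A L(2) by (intro L.finite_measure_Diff) auto
  ultimately show ?thesis using that[of K] K by simp
qed

lemma indicator_L1_approx:
  assumes L: "finite_measure L" "sets L = sets circle" and A: "A \<in> sets circle" and e: "e > 0"
  obtains g :: "complex \<Rightarrow> real" where "continuous_on (sphere 0 1) g" "(LINT x|L. \<bar>indicator A x - g x\<bar>) < e"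
    "integrable L g"
proof -
  interpret L: finite_measure L by fact
  have sp: "space L = sphere 0 1" using sets_eq_imp_space_eq[OF L(2)] by simp
  obtain K where K: "compact K" "K \<subseteq> A" "measure L (A - K) < e / 2"
    using finite_borel_inner_approx[OF L A, of "e / 2"] e by auto
  show ?thesis
  proof (cases "K = {}")
    \<comment> \<open>The distance to the empty set is 0 by convention, so the ramps of the other
      case would be constantly 1.\<close>
    case True
    show ?thesis
      by (rule that[of "\<lambda>_. 0"]) (use K True e A L(2) sets.sets_into_space[OF A] sp in \<open>auto simp: Int_absorb2\<close>)
  next
    case False
    define g where "g n x = max 0 (1 - real n * infdist x K)" for n x
    have gc: "continuous_on UNIV (g n)" for n unfolding g_def by (intro continuous_intros)
    have gm [measurable]: "g n \<in> borel_measurable L" for n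
      using measurable_circle_continuous[OF continuous_on_subset[OF gc]] L(2)
      by (simp cong: measurable_cong_sets)
    have gb: "0 \<le> g n x" "g n x \<le> 1" for n x by (auto simp: g_def infdist_nonneg)
    have Kb: "K \<in> sets L"
      using K sets.sets_into_space[OF A] borel_compact[OF K(1)] unfolding L(2) circle_def sets_restrict_space by auto
    have [measurable]: "A \<in> sets L" "K \<in> sets L" using A L(2) Kb by auto
    have lim: "(\<lambda>n. g n x) \<longlonglongrightarrow> indicator K x" for x
    proof (cases "x \<in> K")
      case True
      then show ?thesis by (simp add: g_def)
    next
      case F: False
      then have d: "infdist x K > 0"
        using infdist_pos_not_in_closed[of K x] compact_imp_closed[OF K(1)] False by simp
      obtain N where N: "1 / infdist x K < real N" using reals_Archimedean2 by blast
      have "g n x = 0" if "n \<ge> N" for n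
      proof -
        have "1 < real N * infdist x K" using N d by (simp add: divide_less_eq)
        also have "\<dots> \<le> real n * infdist x K" using that d by simp
        finally show ?thesis by (simp add: g_def)
      qed
      then have "\<forall>\<^sub>F n in sequentially. g n x = 0" by (auto simp: eventually_sequentially)
      then show ?thesis using F by (simp add: tendsto_eventually)
    qed
    have "(\<lambda>n. LINT x|L. \<bar>indicator A x - g n x\<bar>) \<longlonglongrightarrow> (LINT x|L. \<bar>indicator A x - indicator K x\<bar>)"
    proof (rule integral_dominated_convergence[where w="\<lambda>_. 1"])
      show "AE x in L. (\<lambda>n. \<bar>indicator A x - g n x\<bar>) \<longlonglongrightarrow> \<bar>indicator A x - indicator K x\<bar>"
        by (intro AE_I2 tendsto_intros lim)
      show "AE x in L. norm \<bar>indicator A x - g n x\<bar> \<le> 1" for n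
      proof (rule AE_I2)
        fix x
        show "norm \<bar>indicator A x - g n x\<bar> \<le> 1"
          using gb(1)[of n x] gb(2)[of n x] by (auto simp: indicator_def)
      qed
    qed auto
    also have "(LINT x|L. \<bar>indicator A x - indicator K x\<bar>) = measure L (A - K)"
    proof -
      have "(LINT x|L. \<bar>indicator A x - indicator K x\<bar>) = (LINT x|L. indicator (A - K) x :: real)"
        using K(2) by (intro Bochner_Integration.integral_cong) (auto simp: indicator_def)
      also have "\<dots> = measure L (A - K)"
      proof -
        have "(A - K) \<inter> space L = A - K" using sets.sets_into_space[OF \<open>A \<in> sets L\<close>] by auto
        then show ?thesis by simp
      qed
      finally show ?thesis .
    qed
    finally have "\<forall>\<^sub>F n in sequentially. (LINT x|L. \<bar>indicator A x - g n x\<bar>) < e"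
      by (rule order_tendstoD) (use K e in simp)
    then obtain n where n: "(LINT x|L. \<bar>indicator A x - g n x\<bar>) < e"
      by (auto simp: eventually_sequentially)
    show ?thesis
    proof (rule that[OF _ n])
      show "continuous_on (sphere 0 1) (g n)" by (rule continuous_on_subset[OF gc]) simp
      show "integrable L (g n)"
        by (rule L.integrable_const_bound[where B=1]) (use gb in \<open>auto simp: abs_le_iff intro: order_trans[of _ 0]\<close>)
    qed
  qed
qed

lemma integrable_continuous_circle:
  fixes f :: "complex \<Rightarrow> 'a :: {banach, second_countable_topology}"
  assumes L: "finite_measure L" "sets L = sets circle" and f: "continuous_on (sphere 0 1) f"
  shows "integrable L f"
proof -
  have sp: "space L = sphere 0 1" using sets_eq_imp_space_eq[OF L(2)] by simp
  obtain B where "\<And>x. x \<in> sphere 0 1 \<Longrightarrow> norm (f x) \<le> B"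
    using continuous_circle_bounded[OF f] by blast
  then show ?thesis
    using measurable_circle_continuous[OF f] L(2)
    by (intro finite_measure.integrable_const_bound[OF L(1), of _ B])
       (auto intro!: AE_I2 simp: sp cong: measurable_cong_sets)
qed

lemma continuous_dense_L1:
  fixes f :: "complex \<Rightarrow> 'b :: {banach, second_countable_topology}"
  assumes L: "finite_measure L" "sets L = sets circle" and f: "integrable L f" and e: "e > 0"
  shows "\<exists>g. continuous_on (sphere 0 1) g \<and> (LINT x|L. norm (f x - g x)) < e"
  using f e
proof (induction arbitrary: e rule: integrable_induct)
  case (base A c)
  define e' where "e' = e / (norm c + 1)"
  have e': "e' > 0" using base by (simp add: e'_def add_nonneg_pos)
  obtain g :: "complex \<Rightarrow> real" where g: "continuous_on (sphere 0 1) g" "(LINT x|L. \<bar>indicator A x - g x\<bar>) < e'"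
    using indicator_L1_approx[OF L _ e', of A] base L(2) by metis
  have "(LINT x|L. norm (indicat_real A x *\<^sub>R c - g x *\<^sub>R c)) = (LINT x|L. \<bar>indicator A x - g x\<bar> * norm c)"
    by (intro Bochner_Integration.integral_cong) (auto simp flip: scaleR_left_diff_distrib)
  also have "\<dots> = (LINT x|L. \<bar>indicator A x - g x\<bar>) * norm c" by simp
  also have "\<dots> \<le> e' * norm c" using g by (intro mult_right_mono) auto
  also have "\<dots> < e"
  proof -
    have "e' * norm c < e' * (norm c + 1)" using e' by simp
    also have "\<dots> = e" by (simp add: e'_def add_nonneg_eq_0_iff)
    finally show ?thesis .
  qed
  finally show ?case
    using g(1) by (intro exI[of _ "\<lambda>x. g x *\<^sub>R c"]) (auto intro!: continuous_intros)
next
  case (add f1 f2)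
  obtain g1 where g1: "continuous_on (sphere 0 1) g1" "(LINT x|L. norm (f1 x - g1 x)) < e / 2"
    using add.IH(1)[of "e / 2"] add.prems by auto
  obtain g2 where g2: "continuous_on (sphere 0 1) g2" "(LINT x|L. norm (f2 x - g2 x)) < e / 2"
    using add.IH(2)[of "e / 2"] add.prems by auto
  have i: "integrable L g1" "integrable L g2" using integrable_continuous_circle[OF L] g1 g2 by auto
  have "(LINT x|L. norm (f1 x + f2 x - (g1 x + g2 x))) \<le> (LINT x|L. norm (f1 x - g1 x) + norm (f2 x - g2 x))"
    using add.hyps i by (intro integral_mono) (auto intro!: integrable_norm order_trans[OF _ norm_triangle_ineq] simp: algebra_simps)
  also have "\<dots> = (LINT x|L. norm (f1 x - g1 x)) + (LINT x|L. norm (f2 x - g2 x))"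
    using add.hyps i by (intro Bochner_Integration.integral_add) auto
  also have "\<dots> < e" using g1 g2 by simp
  finally show ?case
    using g1(1) g2(1) by (intro exI[of _ "\<lambda>x. g1 x + g2 x"]) (auto intro!: continuous_intros)
next
  case (lim f s)
  have "(\<lambda>n. LINT x|L. norm (f x - s n x)) \<longlonglongrightarrow> (LINT x|L. norm (0 :: 'b))"
  proof (rule integral_dominated_convergence[where w="\<lambda>x. 3 * norm (f x)"])
    show "AE x in L. (\<lambda>n. norm (f x - s n x)) \<longlonglongrightarrow> norm (0 :: 'b)"
    proof (rule AE_I2)
      fix x assume "x \<in> space L"
      then have "(\<lambda>n. norm (f x - s n x)) \<longlonglongrightarrow> norm (f x - f x)" by (intro tendsto_intros lim.hyps)
      then show "(\<lambda>n. norm (f x - s n x)) \<longlonglongrightarrow> norm (0 :: 'b)" by simp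
    qed
    show "AE x in L. norm (norm (f x - s n x)) \<le> 3 * norm (f x)" for n
    proof (rule AE_I2)
      fix x assume "x \<in> space L"
      then have "norm (s n x) \<le> 2 * norm (f x)" by (rule lim.hyps)
      then show "norm (norm (f x - s n x)) \<le> 3 * norm (f x)"
        using norm_triangle_ineq4[of "f x" "s n x"] by simp
    qed
  qed (use lim.hyps in auto)
  then have "\<forall>\<^sub>F n in sequentially. (LINT x|L. norm (f x - s n x)) < e / 2"
    by (rule order_tendstoD) (use lim.prems in simp)
  then obtain n where n: "(LINT x|L. norm (f x - s n x)) < e / 2" by (auto simp: eventually_sequentially)
  obtain g where g: "continuous_on (sphere 0 1) g" "(LINT x|L. norm (s n x - g x)) < e / 2"
    using lim.IH[of "e / 2" n] lim.prems by auto
  have i: "integrable L g" using integrable_continuous_circle[OF L] g by auto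
  have "(LINT x|L. norm (f x - g x)) \<le> (LINT x|L. norm (f x - s n x) + norm (s n x - g x))"
    using lim.hyps i by (intro integral_mono) (auto intro!: integrable_norm order_trans[OF _ norm_triangle_ineq])
  also have "\<dots> = (LINT x|L. norm (f x - s n x)) + (LINT x|L. norm (s n x - g x))"
    using lim.hyps i by (intro Bochner_Integration.integral_add) auto
  also have "\<dots> < e" using g n by simp
  finally show ?case using g by blast
qed

text \<open>An L^1 approximation has a subsequence converging almost everywhere. Composing it with
  the nearest-point projection onto the compact convex set S, which is continuous and fixes S, keeps
  the values in S and so provides the bounds for dominated convergence.\<close>

lemma continuous_approx_AE:
  fixes f :: "complex \<Rightarrow> 'b :: euclidean_space"
  assumes L: "finite_measure L" "sets L = sets circle" and f: "f \<in> borel_measurable L"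
    and S: "convex S" "compact S" "S \<noteq> {}" "\<And>x. x \<in> sphere 0 1 \<Longrightarrow> f x \<in> S"
  obtains g where "\<And>n::nat. continuous_on (sphere 0 1) (g n)" "\<And>n x. g n x \<in> S"
    "AE x in L. (\<lambda>n. g n x) \<longlonglongrightarrow> f x"
proof -
  interpret L: finite_measure L by fact
  have sp: "space L = sphere 0 1" using sets_eq_imp_space_eq[OF L(2)] by simp
  have cl: "closed S" by (rule compact_imp_closed[OF S(2)])
  obtain B where B: "\<And>y. y \<in> S \<Longrightarrow> norm y \<le> B" using compact_imp_bounded[OF S(2)] by (auto simp: bounded_iff)
  have fi: "integrable L f"
    by (rule L.integrable_const_bound[where B=B]) (use f B S(4) in \<open>auto simp: sp\<close>)
  have "\<exists>g. continuous_on (sphere 0 1) g \<and> (LINT x|L. norm (f x - g x)) < inverse (real (Suc n))" for n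
    by (rule continuous_dense_L1[OF L fi]) simp
  then obtain g where g: "\<And>n. continuous_on (sphere 0 1) (g n)"
    "\<And>n. (LINT x|L. norm (f x - g n x)) < inverse (real (Suc n))" by metis
  have gi: "integrable L (g n)" for n by (rule integrable_continuous_circle[OF L g(1)])
  have "(\<lambda>n. LINT x|L. norm (f x - g n x)) \<longlonglongrightarrow> 0"
    by (rule tendsto_sandwich[OF _ _ tendsto_const LIMSEQ_inverse_real_of_nat])
       (use g(2) in \<open>auto intro!: always_eventually less_imp_le\<close>)
  then obtain q where q: "strict_mono q" "AE x in L. (\<lambda>n. f x - g (q n) x) \<longlonglongrightarrow> 0"
    using tendsto_L1_AE_subseq[of L "\<lambda>n x. f x - g n x"] fi gi by auto
  show ?thesis
  proof (rule that[of "\<lambda>n x. closest_point S (g (q n) x)"])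
    show "continuous_on (sphere 0 1) (\<lambda>x. closest_point S (g (q n) x))" for n
      by (rule continuous_on_compose2[OF continuous_on_closest_point[OF S(1) cl S(3), of UNIV] g(1)]) simp
    show "closest_point S (g (q n) x) \<in> S" for n x by (rule closest_point_in_set[OF cl S(3)])
    show "AE x in L. (\<lambda>n. closest_point S (g (q n) x)) \<longlonglongrightarrow> f x"
      using q(2) AE_space
    proof eventually_elim
      case (elim x)
      have "(\<lambda>n. f x - (f x - g (q n) x)) \<longlonglongrightarrow> f x - 0" by (intro tendsto_intros elim)
      then have "(\<lambda>n. g (q n) x) \<longlonglongrightarrow> f x" by simp
      then have "(\<lambda>n. closest_point S (g (q n) x)) \<longlonglongrightarrow> closest_point S (f x)"
        using continuous_at_closest_point[OF S(1) cl S(3)] isCont_tendsto_compose by blast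
      then show ?case using S(4)[of x] elim(2) by (simp add: sp closest_point_self)
    qed
  qed
qed

section \<open>The Poisson kernel\<close>

definition poisson :: "complex \<Rightarrow> complex \<Rightarrow> real" where
  "poisson z w = Re ((w + z) / (w - z))"

lemma poisson_eq:
  assumes "cmod w = 1"
  shows "poisson z w = (1 - (cmod z)\<^sup>2) / (cmod (w - z))\<^sup>2"
proof -
  have w: "Re w * Re w + Im w * Im w = 1"
    using assms cmod_power2[of w] by (simp add: power2_eq_square)
  have "poisson z w = Re ((w + z) * cnj (w - z)) / (cmod (w - z))\<^sup>2"
    unfolding poisson_def complex_div_cnj[of "w + z"]
    by (simp del: complex_cnj_diff add: Re_divide_of_real flip: of_real_power)
  also have "Re ((w + z) * cnj (w - z)) = 1 - (cmod z)\<^sup>2"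
    unfolding cmod_power2 using w by (simp add: algebra_simps power2_eq_square)
  finally show ?thesis .
qed

lemma poisson_nonneg: "cmod w = 1 \<Longrightarrow> cmod z < 1 \<Longrightarrow> 0 \<le> poisson z w"
  by (simp add: poisson_eq power_le_one)

text \<open>On the unit circle |w - r u| = |u - r w|, so the two points may exchange roles.\<close>

lemma poisson_swap:
  assumes "cmod u = 1" "cmod w = 1"
  shows "poisson (of_real r * u) w = poisson (of_real r * w) u"
proof -
  have "(cmod (w - of_real r * u))\<^sup>2 = (cmod (u - of_real r * w))\<^sup>2"
  proof -
    have "Re u * Re u + Im u * Im u = 1" "Re w * Re w + Im w * Im w = 1"
      using assms cmod_power2[of u] cmod_power2[of w] by (simp_all add: power2_eq_square)
    then have "(Re w - r * Re u) * (Re w - r * Re u) + (Im w - r * Im u) * (Im w - r * Im u) =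
       (Re u - r * Re w) * (Re u - r * Re w) + (Im u - r * Im w) * (Im u - r * Im w)"
      by algebra
    then show ?thesis unfolding cmod_power2 by (simp add: power2_eq_square)
  qed
  then show ?thesis using assms by (simp add: poisson_eq norm_mult)
qed

lemma denominator_nonzero:
  assumes "cmod w = 1" "cmod z < 1" shows "w - z \<noteq> 0"
  using assms by auto

lemma poisson_le:
  assumes r: "0 \<le> r" "r < 1" and "cmod u = 1" "cmod w = 1"
  shows "poisson (of_real r * u) w \<le> 1 / (1 - r)\<^sup>2"
proof -
  have "1 - r \<le> cmod (w - of_real r * u)"
    using norm_triangle_ineq2[of w "of_real r * u"] assms by (simp add: norm_mult)
  then have le: "(1 - r)\<^sup>2 \<le> (cmod (w - of_real r * u))\<^sup>2" using r by (intro power_mono) auto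
  have "poisson (of_real r * u) w \<le> 1 / (cmod (w - of_real r * u))\<^sup>2"
    using assms by (simp add: poisson_eq norm_mult divide_right_mono)
  also have "\<dots> \<le> 1 / (1 - r)\<^sup>2" by (rule frac_le) (use le r in auto)
  finally show ?thesis .
qed

lemma continuous_on_poisson:
  assumes "0 \<le> r" "r < 1" "cmod w = 1"
  shows "continuous_on (sphere 0 1) (\<lambda>u. poisson (of_real r * u) w)"
  unfolding poisson_def
  using denominator_nonzero[OF assms(3)] assms(1,2)
  by (intro continuous_intros) (auto simp: norm_mult)

lemma poisson_mean:
  assumes r: "0 \<le> r" "r < 1" and w: "cmod w = 1"
  shows "(LINT u|arc_measure. poisson (of_real r * u) w) = 1"
proof -
  have hol: "(\<lambda>z. (w + z) / (w - z)) holomorphic_on ball 0 1"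
    using denominator_nonzero[OF w] by (intro holomorphic_intros) auto
  have cont: "continuous_on (sphere 0 1) (\<lambda>u. (w + of_real r * u) / (w - of_real r * u))"
    by (rule continuous_on_scaled_circle[OF holomorphic_on_imp_continuous_on[OF hol] r])
  have "(LINT u|arc_measure. poisson (of_real r * u) w) = Re (LINT u|arc_measure. (w + of_real r * u) / (w - of_real r * u))"
    unfolding poisson_def by (rule integral_Re[OF integrable_arc_continuous[OF cont]])
  also have "\<dots> = 1" using circle_mean_value[OF hol r] w by auto
  finally show ?thesis .
qed

lemma poisson_mean':
  assumes r: "0 \<le> r" "r < 1" and u: "cmod u = 1"
  shows "(LINT w|arc_measure. poisson (of_real r * u) w) = 1"
proof -
  have "(LINT w|arc_measure. poisson (of_real r * u) w) = (LINT w|arc_measure. poisson (of_real r * w) u)"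
    using u by (intro Bochner_Integration.integral_cong poisson_swap) auto
  then show ?thesis using poisson_mean[OF r u] by simp
qed

lemma poisson_average_bounded:
  assumes g: "continuous_on (sphere 0 1) g" "\<And>u. cmod u = 1 \<Longrightarrow> \<bar>g u\<bar> \<le> B"
    and r: "0 \<le> r" "r < 1" and w: "cmod w = 1"
  shows "\<bar>LINT u|arc_measure. g u * poisson (of_real r * u) w\<bar> \<le> B"
proof -
  have B: "0 \<le> B" using g(2)[OF w] by simp
  have i1: "integrable arc_measure (\<lambda>u. g u * poisson (of_real r * u) w)"
    by (intro integrable_arc_continuous continuous_intros g(1) continuous_on_poisson r w)
  have i2: "integrable arc_measure (\<lambda>u. B * poisson (of_real r * u) w)"
    by (intro integrable_arc_continuous continuous_intros continuous_on_poisson r w)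
  have "\<bar>LINT u|arc_measure. g u * poisson (of_real r * u) w\<bar> \<le> (LINT u|arc_measure. \<bar>g u * poisson (of_real r * u) w\<bar>)"
    by (rule integral_abs_bound)
  also have "\<dots> \<le> (LINT u|arc_measure. B * poisson (of_real r * u) w)"
  proof (intro integral_mono integrable_abs i1 i2)
    fix u assume "u \<in> space arc_measure"
    then have u: "cmod u = 1" by simp
    have "0 \<le> poisson (of_real r * u) w" using u w r by (intro poisson_nonneg) (auto simp: norm_mult)
    then show "\<bar>g u * poisson (of_real r * u) w\<bar> \<le> B * poisson (of_real r * u) w"
      using g(2)[OF u] by (simp add: abs_mult mult_right_mono)
  qed
  also have "\<dots> = B" using poisson_mean[OF r w] by simp
  finally show ?thesis .
qed

lemma poisson_average_tendsto:
  assumes g: "continuous_on (sphere 0 1) g" and w: "cmod w = 1"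
  shows "((\<lambda>r. LINT u|arc_measure. g u * poisson (of_real r * u) w) \<longlongrightarrow> g w) (at_left 1)"
proof (rule tendstoI)
  fix e :: real assume e: "e > 0"
  obtain B where B: "\<And>x. x \<in> sphere 0 1 \<Longrightarrow> norm (g x) \<le> B"
    using continuous_circle_bounded[OF g] by blast
  have B0: "0 \<le> B" using B[of w] w norm_ge_zero[of "g w"] by (auto intro: order_trans)
  obtain d where d: "d > 0" "\<And>u. cmod u = 1 \<Longrightarrow> dist u w < d \<Longrightarrow> \<bar>g u - g w\<bar> < e / 2"
    using g w e unfolding continuous_on_iff by (metis dist_real_def half_gt_zero mem_sphere_0)
  \<comment> \<open>Near w the continuity of g contributes e / 2. Where |u - w| \<ge> d, the
    difference of values is at most 2 B, and the kernel at most (1 - r^2) / (d / 2)^2 as soon as 1 -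
    r < d / 2.\<close>
  have "((\<lambda>r. e / 2 + 2 * B * ((1 - r\<^sup>2) / (d / 2)\<^sup>2)) \<longlongrightarrow> e / 2 + 2 * B * ((1 - 1\<^sup>2) / (d / 2)\<^sup>2)) (at_left 1)"
    using d by (intro tendsto_intros) auto
  then have "\<forall>\<^sub>F r in at_left 1. e / 2 + 2 * B * ((1 - r\<^sup>2) / (d / 2)\<^sup>2) < e"
    by (rule order_tendstoD) (use e in simp)
  moreover have "\<forall>\<^sub>F r in at_left (1::real). r \<in> {max 0 (1 - d / 2)<..<1}"
    by (rule eventually_at_left_real) (use d in simp)
  ultimately show "\<forall>\<^sub>F r in at_left 1. dist (LINT u|arc_measure. g u * poisson (of_real r * u) w) (g w) < e"
  proof eventually_elim
    case (elim r)
    then have r: "0 \<le> r" "r < 1" "1 - r < d / 2" by auto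
    have r2: "r\<^sup>2 \<le> 1" using r by (simp add: abs_square_le_1)
    let ?k = "2 * B * ((1 - r\<^sup>2) / (d / 2)\<^sup>2)"
    have k: "0 \<le> ?k" using B0 r2 by simp
    have P: "integrable arc_measure (\<lambda>u. poisson (of_real r * u) w)"
      by (intro integrable_arc_continuous continuous_on_poisson r w)
    have gP: "integrable arc_measure (\<lambda>u. g u * poisson (of_real r * u) w)"
      by (intro integrable_arc_continuous continuous_intros g continuous_on_poisson r w)
    have "(LINT u|arc_measure. g u * poisson (of_real r * u) w) - g w
        = (LINT u|arc_measure. g u * poisson (of_real r * u) w - g w * poisson (of_real r * u) w)"
      using P gP poisson_mean[OF r(1,2) w] by simp
    also have "\<bar>\<dots>\<bar> \<le> (LINT u|arc_measure. \<bar>g u * poisson (of_real r * u) w - g w * poisson (of_real r * u) w\<bar>)"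
      by (rule integral_abs_bound)
    also have "\<dots> \<le> (LINT u|arc_measure. e / 2 * poisson (of_real r * u) w + ?k)"
    proof (rule integral_mono)
      fix u assume "u \<in> space arc_measure"
      then have u: "cmod u = 1" by simp
      have p0: "0 \<le> poisson (of_real r * u) w" using u w r by (intro poisson_nonneg) (auto simp: norm_mult)
      have eq: "\<bar>g u * poisson (of_real r * u) w - g w * poisson (of_real r * u) w\<bar> = \<bar>g u - g w\<bar> * poisson (of_real r * u) w"
        using p0 by (simp add: abs_mult flip: left_diff_distrib)
      show "\<bar>g u * poisson (of_real r * u) w - g w * poisson (of_real r * u) w\<bar> \<le> e / 2 * poisson (of_real r * u) w + ?k"
      proof (cases "dist u w < d")
        case True
        then have "\<bar>g u - g w\<bar> * poisson (of_real r * u) w \<le> e / 2 * poisson (of_real r * u) w"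
          using d(2)[OF u] p0 by (intro mult_right_mono) auto
        then show ?thesis unfolding eq using k by simp
      next
        case False
        have "cmod (w - u) \<le> cmod (w - of_real r * u) + cmod (of_real r * u - u)"
          using norm_triangle_ineq[of "w - of_real r * u" "of_real r * u - u"] by simp
        also have "of_real r * u - u = - of_real (1 - r) * u" by (simp add: algebra_simps)
        also have "cmod (- of_real (1 - r) * u) = 1 - r"
          using r u by (simp only: norm_mult norm_minus_cancel norm_of_real) simp
        finally have "d / 2 \<le> cmod (w - of_real r * u)"
          using False r by (simp add: dist_norm norm_minus_commute)
        then have "(d / 2)\<^sup>2 \<le> (cmod (w - of_real r * u))\<^sup>2" using d by (intro power_mono) auto
        then have pl: "poisson (of_real r * u) w \<le> (1 - r\<^sup>2) / (d / 2)\<^sup>2"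
        proof -
          have "(1 - r\<^sup>2) / (cmod (w - of_real r * u))\<^sup>2 \<le> (1 - r\<^sup>2) / (d / 2)\<^sup>2"
            by (rule frac_le) (use r2 d \<open>(d / 2)\<^sup>2 \<le> (cmod (w - of_real r * u))\<^sup>2\<close> in auto)
          then show ?thesis using r u w by (simp only: poisson_eq[OF w] norm_mult norm_of_real) simp
        qed
        have "\<bar>g u - g w\<bar> \<le> 2 * B" using B[of u] B[of w] u w by simp
        then have "\<bar>g u - g w\<bar> * poisson (of_real r * u) w \<le> ?k"
          using pl p0 B0 by (intro mult_mono) auto
        then show ?thesis unfolding eq using p0 e by (simp add: add_increasing)
      qed
    next
      interpret arc: finite_measure arc_measure by (rule finite_measure_arc)
      show "integrable arc_measure (\<lambda>u. \<bar>g u * poisson (of_real r * u) w - g w * poisson (of_real r * u) w\<bar>)"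
        using P gP by simp
      show "integrable arc_measure (\<lambda>u. e / 2 * poisson (of_real r * u) w + ?k)" using P by simp
    qed
    also have "\<dots> = e / 2 + ?k"
    proof -
      interpret arc: finite_measure arc_measure by (rule finite_measure_arc)
      show ?thesis using P poisson_mean[OF r(1,2) w]
        by (subst Bochner_Integration.integral_add) (auto simp: measure_arc_space)
    qed
    finally show ?case using elim by (simp add: dist_real_def)
  qed
qed

lemma measurable_circle_ident [measurable]: "(\<lambda>x. x) \<in> borel_measurable circle"
  by (rule measurable_circle_continuous[OF continuous_on_id])

lemma poisson_Fubini:
  fixes h :: "complex \<Rightarrow> 'b :: {banach, second_countable_topology}"
  assumes L: "finite_measure L" "sets L = sets circle" and h: "integrable L h"
    and g: "continuous_on (sphere 0 1) g" and r: "0 \<le> r" "r < 1"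
  shows "(LINT u|arc_measure. g u *\<^sub>R (LINT w|L. poisson (of_real r * u) w *\<^sub>R h w)) =
    (LINT w|L. (LINT u|arc_measure. g u * poisson (of_real r * u) w) *\<^sub>R h w)"
    and "integrable arc_measure (\<lambda>u. g u *\<^sub>R (LINT w|L. poisson (of_real r * u) w *\<^sub>R h w))"
proof -
  interpret L: finite_measure L by fact
  interpret arc: finite_measure arc_measure by (rule finite_measure_arc)
  interpret pair_sigma_finite arc_measure L ..
  have sp: "space L = sphere 0 1" using sets_eq_imp_space_eq[OF L(2)] by simp
  note [measurable_cong] = L(2)
  have [measurable]: "g \<in> borel_measurable circle" by (rule measurable_circle_continuous[OF g])
  have [measurable]: "h \<in> borel_measurable L" using h by auto
  obtain B where B: "\<And>x. x \<in> sphere 0 1 \<Longrightarrow> norm (g x) \<le> B"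
    using continuous_circle_bounded[OF g] by blast
  define F where "F = (\<lambda>(u, w). (g u * poisson (of_real r * u) w) *\<^sub>R h w)"
  have Fm [measurable]: "F \<in> borel_measurable (arc_measure \<Otimes>\<^sub>M L)"
    unfolding F_def poisson_def by measurable
  have B0: "0 \<le> B" using B[of 1] norm_ge_zero[of "g 1"] by (auto intro: order_trans)
  \<comment> \<open>At fixed r the kernel is bounded, which makes the double integrand
    integrable.\<close>
  have bound: "norm (F (u, w)) \<le> B / (1 - r)\<^sup>2 * norm (h w)" if "cmod u = 1" "cmod w = 1" for u w
  proof -
    have "0 \<le> poisson (of_real r * u) w" using that r by (intro poisson_nonneg) (auto simp: norm_mult)
    then have "\<bar>g u\<bar> * \<bar>poisson (of_real r * u) w\<bar> \<le> B * (1 / (1 - r)\<^sup>2)"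
      using that B[of u] B0 poisson_le[OF r that] by (intro mult_mono) auto
    then have "\<bar>g u\<bar> * \<bar>poisson (of_real r * u) w\<bar> * norm (h w) \<le> B * (1 / (1 - r)\<^sup>2) * norm (h w)"
      by (rule mult_right_mono) simp
    then show ?thesis by (simp add: F_def abs_mult)
  qed
  have int_w: "integrable L (\<lambda>w. F (u, w))" if "cmod u = 1" for u
  proof (rule Bochner_Integration.integrable_bound)
    show "integrable L (\<lambda>w. B / (1 - r)\<^sup>2 * norm (h w))" using h by simp
    show "(\<lambda>w. F (u, w)) \<in> borel_measurable L" unfolding F_def poisson_def prod.case by measurable
    show "AE w in L. norm (F (u, w)) \<le> norm (B / (1 - r)\<^sup>2 * norm (h w))"
      using bound[OF that] B0 by (intro AE_I2) (auto simp: sp abs_mult)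
  qed
  have Fint: "integrable (arc_measure \<Otimes>\<^sub>M L) F"
  proof (rule Fubini_integrable[OF Fm])
    show "integrable arc_measure (\<lambda>u. LINT w|L. norm (F (u, w)))"
    proof (rule arc.integrable_const_bound)
      show "AE u in arc_measure. norm (LINT w|L. norm (F (u, w))) \<le> (LINT w|L. B / (1 - r)\<^sup>2 * norm (h w))"
      proof (rule AE_I2)
        fix u assume "u \<in> space arc_measure"
        then have u: "cmod u = 1" by simp
        have "norm (LINT w|L. norm (F (u, w))) = (LINT w|L. norm (F (u, w)))" by simp
        also have "\<dots> \<le> (LINT w|L. B / (1 - r)\<^sup>2 * norm (h w))"
          using h bound[OF u] int_w[OF u] by (intro integral_mono) (auto simp: sp)
        finally show "norm (LINT w|L. norm (F (u, w))) \<le> (LINT w|L. B / (1 - r)\<^sup>2 * norm (h w))" .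
      qed
      show "(\<lambda>u. LINT w|L. norm (F (u, w))) \<in> borel_measurable arc_measure" by measurable
    qed
    show "AE u in arc_measure. integrable L (\<lambda>w. F (u, w))" using int_w by (intro AE_I2) auto
  qed
  have inner_u: "(LINT w|L. F (u, w)) = g u *\<^sub>R (LINT w|L. poisson (of_real r * u) w *\<^sub>R h w)" for u
    by (simp add: F_def flip: scaleR_scaleR)
  have inner_w: "(LINT u|arc_measure. F (u, w)) = (LINT u|arc_measure. g u * poisson (of_real r * u) w) *\<^sub>R h w"
    if "cmod w = 1" for w
  proof -
    have "integrable arc_measure (\<lambda>u. g u * poisson (of_real r * u) w)"
      by (intro integrable_arc_continuous continuous_intros g continuous_on_poisson r that)
    then show ?thesis by (simp add: F_def)
  qed
  show "(LINT u|arc_measure. g u *\<^sub>R (LINT w|L. poisson (of_real r * u) w *\<^sub>R h w)) =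
    (LINT w|L. (LINT u|arc_measure. g u * poisson (of_real r * u) w) *\<^sub>R h w)"
  proof -
    have "(LINT u|arc_measure. LINT w|L. F (u, w)) = (LINT w|L. LINT u|arc_measure. F (u, w))"
      using Fubini_integral[of "\<lambda>u w. F (u, w)"] Fint by simp
    also have "\<dots> = (LINT w|L. (LINT u|arc_measure. g u * poisson (of_real r * u) w) *\<^sub>R h w)"
      by (intro Bochner_Integration.integral_cong refl inner_w) (simp add: sp)
    finally show ?thesis unfolding inner_u .
  qed
  show "integrable arc_measure (\<lambda>u. g u *\<^sub>R (LINT w|L. poisson (of_real r * u) w *\<^sub>R h w))"
    unfolding inner_u[symmetric] using integrable_fst[of "\<lambda>u w. F (u, w)"] Fint by simp
qed

section \<open>Kernels, moments and uniqueness\<close>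

lemma cauchy_kernel_sums:
  fixes h :: "complex \<Rightarrow> complex"
  assumes L: "finite_measure L" "sets L = sets circle" and h: "integrable L h" and z: "cmod z < 1"
  shows "(\<lambda>n. z ^ n * (LINT w|L. h w * w powi (- int n))) sums (LINT w|L. w / (w - z) * h w)"
proof -
  have sp: "space L = sphere 0 1" using sets_eq_imp_space_eq[OF L(2)] by simp
  note [measurable_cong] = L(2)
  have [measurable]: "h \<in> borel_measurable L" using h by auto
  have i: "integrable L (\<lambda>w. z ^ n * (h w * inverse w ^ n))" for n
  proof (rule Bochner_Integration.integrable_bound[OF h])
    show "(\<lambda>w. z ^ n * (h w * inverse w ^ n)) \<in> borel_measurable L" by measurable
    show "AE w in L. norm (z ^ n * (h w * inverse w ^ n)) \<le> norm (h w)"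
      using z by (intro AE_I2) (auto simp: sp norm_mult norm_power norm_inverse power_le_one mult_left_le_one_le)
  qed
  have nrm: "norm (z ^ n * (h w * inverse w ^ n)) = cmod z ^ n * norm (h w)" if "cmod w = 1" for w n
    using that by (simp add: norm_mult norm_power norm_inverse)
  have "(\<lambda>n. LINT w|L. z ^ n * (h w * inverse w ^ n)) sums (LINT w|L. (\<Sum>n. z ^ n * (h w * inverse w ^ n)))"
  proof (rule sums_integral[OF i])
    show "AE w in L. summable (\<lambda>n. norm (z ^ n * (h w * inverse w ^ n)))"
      using z by (intro AE_I2) (auto simp: sp nrm intro!: summable_mult2 summable_geometric)
    have "(LINT w|L. norm (z ^ n * (h w * inverse w ^ n))) = cmod z ^ n * (LINT w|L. norm (h w))" for n
    proof -
      have "(LINT w|L. norm (z ^ n * (h w * inverse w ^ n))) = (LINT w|L. cmod z ^ n * norm (h w))"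
        by (intro Bochner_Integration.integral_cong) (auto simp: sp nrm)
      then show ?thesis by simp
    qed
    then show "summable (\<lambda>n. LINT w|L. norm (z ^ n * (h w * inverse w ^ n)))"
      using z by (simp add: summable_mult2 summable_geometric)
  qed
  also have "(LINT w|L. (\<Sum>n. z ^ n * (h w * inverse w ^ n))) = (LINT w|L. w / (w - z) * h w)"
  proof (intro Bochner_Integration.integral_cong refl)
    fix w assume "w \<in> space L"
    then have w: "cmod w = 1" "w \<noteq> 0" by (auto simp: sp)
    have "(\<lambda>n. (z / w) ^ n) sums (1 / (1 - z / w))"
      using z w by (intro geometric_sums) (simp add: norm_divide)
    then have "(\<lambda>n. (z / w) ^ n * h w) sums (1 / (1 - z / w) * h w)" by (rule sums_mult2)
    also have "(\<lambda>n. (z / w) ^ n * h w) = (\<lambda>n. z ^ n * (h w * inverse w ^ n))"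
      by (simp add: fun_eq_iff field_simps power_divide)
    also have "1 / (1 - z / w) = w / (w - z)" using w by (simp add: field_simps)
    finally show "(\<Sum>n. z ^ n * (h w * inverse w ^ n)) = w / (w - z) * h w" by (simp add: sums_iff)
  qed
  finally show ?thesis by (simp add: power_int_minus power_inverse)
qed

text \<open>The Herglotz kernel is twice the Cauchy kernel minus 1; this doubles every moment except
  the one at 0.\<close>

lemma herglotz_kernel_sums:
  fixes h :: "complex \<Rightarrow> complex"
  assumes L: "finite_measure L" "sets L = sets circle" and h: "integrable L h" and z: "cmod z < 1"
  shows "(\<lambda>n. z ^ n * ((if n = 0 then 1 else 2) * (LINT w|L. h w * w powi (- int n)))) sums
     (LINT w|L. (w + z) / (w - z) * h w)"
    and "integrable L (\<lambda>w. (w + z) / (w - z) * h w)"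
proof -
  have sp: "space L = sphere 0 1" using sets_eq_imp_space_eq[OF L(2)] by simp
  have c: "continuous_on (sphere 0 1) (\<lambda>w. w / (w - z))"
    using denominator_nonzero[OF _ z] by (intro continuous_intros) auto
  have m: "(\<lambda>w. w / (w - z)) \<in> borel_measurable L"
    using measurable_circle_continuous[OF c] L(2) by (simp cong: measurable_cong_sets)
  obtain B where B: "\<And>w. w \<in> sphere 0 1 \<Longrightarrow> norm (w / (w - z)) \<le> B"
    using continuous_circle_bounded[OF c] by blast
  have i: "integrable L (\<lambda>w. w / (w - z) * h w)"
  proof (rule Bochner_Integration.integrable_bound)
    show "integrable L (\<lambda>w. of_real B * h w)" using h by simp
    show "(\<lambda>w. w / (w - z) * h w) \<in> borel_measurable L"
      by (rule borel_measurable_times[OF m]) (use h in auto)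
    show "AE w in L. norm (w / (w - z) * h w) \<le> norm (of_real B * h w)"
    proof (rule AE_I2)
      fix w assume "w \<in> space L"
      then have "norm (w / (w - z)) \<le> \<bar>B\<bar>" using B[of w] abs_ge_self[of B] by (simp add: sp)
      then have "norm (w / (w - z)) * norm (h w) \<le> \<bar>B\<bar> * norm (h w)" by (rule mult_right_mono) simp
      then show "norm (w / (w - z) * h w) \<le> norm (of_real B * h w)"
        by (simp only: norm_mult norm_of_real)
    qed
  qed
  define k where "k w = w / (w - z) * h w" for w
  have ki: "integrable L k" using i by (simp add: k_def[abs_def])
  have eq: "(w + z) / (w - z) * h w = 2 * k w - h w" if "w \<in> space L" for w
    using denominator_nonzero[OF _ z, of w] that by (simp add: sp k_def field_simps)
  have "integrable L (\<lambda>w. 2 * k w - h w)" using ki h by simp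
  then show "integrable L (\<lambda>w. (w + z) / (w - z) * h w)"
    using eq by (subst Bochner_Integration.integrable_cong[OF refl, of L _ "\<lambda>w. 2 * k w - h w"]) auto
  have "(LINT w|L. (w + z) / (w - z) * h w) = (LINT w|L. 2 * k w - h w)"
    by (intro Bochner_Integration.integral_cong eq refl)
  also have "\<dots> = 2 * (LINT w|L. k w) - (LINT w|L. h w)" using ki h by simp
  finally have val: "(LINT w|L. (w + z) / (w - z) * h w) = 2 * (LINT w|L. w / (w - z) * h w) - (LINT w|L. h w)"
    by (simp add: k_def)
  have s1: "(\<lambda>n. 2 * (z ^ n * (LINT w|L. h w * w powi (- int n)))) sums (2 * (LINT w|L. w / (w - z) * h w))"
    by (intro sums_mult cauchy_kernel_sums[OF L h z])
  have s2: "(\<lambda>n. if n = 0 then (LINT w|L. h w) else 0) sums (LINT w|L. h w)"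
    using sums_single[of 0 "\<lambda>_. LINT w|L. h w"] by (simp add: eq_commute)
  show "(\<lambda>n. z ^ n * ((if n = 0 then 1 else 2) * (LINT w|L. h w * w powi (- int n)))) sums
     (LINT w|L. (w + z) / (w - z) * h w)"
    unfolding val by (rule sums_cong[THEN iffD1, OF _ sums_diff[OF s1 s2]]) auto
qed

lemma poisson_integrable:
  fixes h :: "complex \<Rightarrow> 'b :: {banach, second_countable_topology}"
  assumes L: "finite_measure L" "sets L = sets circle" and h: "integrable L h" and z: "cmod z < 1"
  shows "integrable L (\<lambda>w. poisson z w *\<^sub>R h w)"
proof -
  have sp: "space L = sphere 0 1" using sets_eq_imp_space_eq[OF L(2)] by simp
  have c: "continuous_on (sphere 0 1) (poisson z)"
    unfolding poisson_def using denominator_nonzero[OF _ z] by (intro continuous_intros) auto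
  have m: "poisson z \<in> borel_measurable L"
    using measurable_circle_continuous[OF c] L(2) by (simp cong: measurable_cong_sets)
  obtain B where B: "\<And>w. w \<in> sphere 0 1 \<Longrightarrow> norm (poisson z w) \<le> B"
    using continuous_circle_bounded[OF c] by blast
  show ?thesis
  proof (rule Bochner_Integration.integrable_bound)
    show "integrable L (\<lambda>w. B *\<^sub>R h w)" using h by simp
    show "(\<lambda>w. poisson z w *\<^sub>R h w) \<in> borel_measurable L" using m h by auto
    show "AE w in L. norm (poisson z w *\<^sub>R h w) \<le> norm (B *\<^sub>R h w)"
      using B by (intro AE_I2) (auto simp: sp intro!: mult_right_mono intro: order_trans[OF _ abs_ge_self])
  qed
qed

definition radius_seq :: "nat \<Rightarrow> real" where
  "radius_seq n = 1 - inverse (real (Suc n))"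

lemma radius_seq_bounds: "0 \<le> radius_seq n" "radius_seq n < 1"
  by (auto simp: radius_seq_def field_simps)

lemma radius_seq_tendsto: "filterlim radius_seq (at_left 1) sequentially"
proof -
  have "radius_seq \<longlonglongrightarrow> 1 - 0"
    unfolding radius_seq_def by (intro tendsto_intros LIMSEQ_inverse_real_of_nat)
  then show ?thesis
    unfolding filterlim_at using radius_seq_bounds(2) by (auto intro!: always_eventually simp: less_imp_neq)
qed

text \<open>By Fubini the Poisson kernel is moved from the measure to the continuous function, whose
  Poisson averages converge pointwise and boundedly. A sequence of radii is used so that dominated
  convergence applies.\<close>

lemma poisson_weak_limit:
  fixes k :: "complex \<Rightarrow> 'b :: {banach, second_countable_topology}"
  assumes L: "finite_measure L" "sets L = sets circle" and k: "integrable L k"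
    and g: "continuous_on (sphere 0 1) g"
  shows "(\<lambda>n. LINT u|arc_measure. g u *\<^sub>R (LINT w|L. poisson (of_real (radius_seq n) * u) w *\<^sub>R k w))
    \<longlonglongrightarrow> (LINT w|L. g w *\<^sub>R k w)"
proof -
  have sp: "space L = sphere 0 1" using sets_eq_imp_space_eq[OF L(2)] by simp
  obtain B where B: "\<And>x. x \<in> sphere 0 1 \<Longrightarrow> norm (g x) \<le> B"
    using continuous_circle_bounded[OF g] by blast
  have pm: "(\<lambda>w. (LINT u|arc_measure. g u * poisson (of_real r * u) w)) \<in> borel_measurable L" for r
  proof -
    interpret arc: finite_measure arc_measure by (rule finite_measure_arc)
    have [measurable]: "g \<in> borel_measurable circle" by (rule measurable_circle_continuous[OF g])
    note [measurable_cong] = L(2)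
    show ?thesis unfolding poisson_def by measurable
  qed
  have "(\<lambda>n. LINT w|L. (LINT u|arc_measure. g u * poisson (of_real (radius_seq n) * u) w) *\<^sub>R k w) \<longlonglongrightarrow> (LINT w|L. g w *\<^sub>R k w)"
  proof (rule integral_dominated_convergence[where w="\<lambda>w. B * norm (k w)"])
    show "(\<lambda>w. g w *\<^sub>R k w) \<in> borel_measurable L"
      using measurable_circle_continuous[OF g] L(2) k by (auto cong: measurable_cong_sets)
    show "(\<lambda>w. (LINT u|arc_measure. g u * poisson (of_real (radius_seq n) * u) w) *\<^sub>R k w) \<in> borel_measurable L" for n
      using pm k by auto
    show "integrable L (\<lambda>w. B * norm (k w))" using k by simp
    show "AE w in L. (\<lambda>n. (LINT u|arc_measure. g u * poisson (of_real (radius_seq n) * u) w) *\<^sub>R k w) \<longlonglongrightarrow> g w *\<^sub>R k w"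
      using filterlim_compose[OF poisson_average_tendsto[OF g] radius_seq_tendsto]
      by (intro AE_I2 tendsto_intros) (auto simp: sp)
    show "AE w in L. norm ((LINT u|arc_measure. g u * poisson (of_real (radius_seq n) * u) w) *\<^sub>R k w) \<le> B * norm (k w)" for n
      using poisson_average_bounded[OF g _ radius_seq_bounds] B by (intro AE_I2) (auto simp: sp intro!: mult_right_mono)
  qed
  then show ?thesis unfolding poisson_Fubini(1)[OF L k g radius_seq_bounds] .
qed

text \<open>The Herglotz integral of k sees only the moments with exponents \<le> 0; the others
  enter through the conjugate of k. Together both give the Poisson integral, since Re K k is half of
  K k plus the conjugate of K cnj k. Vanishing Poisson integrals annihilate continuous functions,
  and then indicators.\<close>

lemma zero_moments_imp_AE_zero:
  fixes k :: "complex \<Rightarrow> complex"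
  assumes L: "finite_measure L" "sets L = sets circle" and k: "integrable L k"
    and zero: "\<And>n. (LINT w|L. k w * w powi n) = 0"
  shows "AE w in L. k w = 0"
proof -
  interpret L: finite_measure L by fact
  have sp: "space L = sphere 0 1" using sets_eq_imp_space_eq[OF L(2)] by simp
  have ker: "(LINT w|L. (w + z) / (w - z) * h w) = 0"
    if h: "integrable L h" "\<And>n. (LINT w|L. h w * w powi n) = 0" and z: "cmod z < 1" for h z
    using herglotz_kernel_sums(1)[OF L h(1) z] h(2) by (simp add: sums_iff)
  have ck: "integrable L (\<lambda>w. cnj (k w))" using k by simp
  have cz: "(LINT w|L. cnj (k w) * w powi n) = 0" for n
  proof -
    have "(LINT w|L. cnj (k w) * w powi n) = (LINT w|L. cnj (k w * w powi (- n)))"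
    proof (intro Bochner_Integration.integral_cong refl)
      fix w assume "w \<in> space L"
      then have w: "cmod w = 1" "w \<noteq> 0" by (auto simp: sp)
      have "w * cnj w = 1" using w complex_norm_square[of w] by simp
      then have "cnj w = inverse w" by (rule inverse_unique[symmetric])
      then have "cnj (w powi (- n)) = w powi n"
        by (simp add: complex_cnj_power_int power_int_inverse power_int_minus)
      then show "cnj (k w) * w powi n = cnj (k w * w powi (- n))" by simp
    qed
    also have "\<dots> = cnj (LINT w|L. k w * w powi (- n))" by (rule Bochner_Integration.integral_cnj)
    finally show ?thesis using zero[of "- n"] by simp
  qed
  have P0: "(LINT w|L. poisson z w *\<^sub>R k w) = 0" if z: "cmod z < 1" for z
  proof -
    define A where "A w = (w + z) / (w - z) * k w" for w
    define C where "C w = (w + z) / (w - z) * cnj (k w)" for w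
    have i: "integrable L A" "integrable L C"
      using herglotz_kernel_sums(2)[OF L k z] herglotz_kernel_sums(2)[OF L ck z]
      by (simp_all add: A_def[abs_def] C_def[abs_def])
    have half: "Re K *\<^sub>R x = (K * x + cnj (K * cnj x)) / 2" for K x :: complex
      by (simp add: complex_eq_iff)
    have "(LINT w|L. poisson z w *\<^sub>R k w) = (LINT w|L. (A w + cnj (C w)) / 2)"
      unfolding poisson_def half A_def C_def ..
    also have "\<dots> = ((LINT w|L. A w) + cnj (LINT w|L. C w)) / 2"
      using i by simp
    also have "\<dots> = 0" using ker[OF k zero z] ker[OF ck cz z] by (simp add: A_def C_def)
    finally show ?thesis .
  qed
  have cont0: "(LINT w|L. g w *\<^sub>R k w) = 0" if g: "continuous_on (sphere 0 1) g" for g :: "complex \<Rightarrow> real"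
  proof -
    have "(LINT u|arc_measure. g u *\<^sub>R (LINT w|L. poisson (of_real (radius_seq n) * u) w *\<^sub>R k w)) = (LINT u|arc_measure. 0)" for n
      using radius_seq_bounds[of n] by (intro Bochner_Integration.integral_cong refl) (simp add: P0 norm_mult)
    then show ?thesis using poisson_weak_limit[OF L k g] by (simp add: LIMSEQ_const_iff)
  qed
  show ?thesis
  proof (rule L.density_zero[OF k])
    fix A assume A: "A \<in> sets L"
    obtain g :: "nat \<Rightarrow> complex \<Rightarrow> real" where g: "\<And>n. continuous_on (sphere 0 1) (g n)" "\<And>n x. g n x \<in> {0..1}"
      "AE x in L. (\<lambda>n. g n x) \<longlonglongrightarrow> indicator A x"
    proof (rule continuous_approx_AE[OF L])
      show "(indicator A :: complex \<Rightarrow> real) \<in> borel_measurable L" using A by simp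
      show "indicator A x \<in> {0..1 :: real}" for x by (simp add: indicator_def)
    qed auto
    have gm: "g n \<in> borel_measurable L" for n
      using measurable_circle_continuous[OF g(1)] L(2) by (simp cong: measurable_cong_sets)
    have "(\<lambda>n. LINT x|L. g n x *\<^sub>R k x) \<longlonglongrightarrow> (LINT x|L. indicator A x *\<^sub>R k x)"
    proof (rule integral_dominated_convergence[where w="\<lambda>x. norm (k x)"])
      show "AE x in L. (\<lambda>n. g n x *\<^sub>R k x) \<longlonglongrightarrow> indicat_real A x *\<^sub>R k x"
        using g(3) by eventually_elim (intro tendsto_intros)
      show "AE x in L. norm (g n x *\<^sub>R k x) \<le> norm (k x)" for n
        using g(2)[of n] by (intro AE_I2) (auto intro!: mult_left_le_one_le)
    qed (use A gm k in auto)
    then show "set_lebesgue_integral L A k = 0"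
      unfolding cont0[OF g(1)] by (simp add: LIMSEQ_const_iff set_lebesgue_integral_def)
  qed
qed

section \<open>The entropy of a matrix density\<close>

lemma hpair_eq_inner: "hpair B X = (fst B, fst (snd B), 2 *\<^sub>R snd (snd B)) \<bullet> X"
  by (cases X; cases B) (simp add: hpair_def inner_complex_def)

lemma bounded_linear_hpair: "bounded_linear (hpair B)"
  unfolding hpair_eq_inner by (rule bounded_linear_inner_right)

lemma integrable_hpair: "integrable M F \<Longrightarrow> integrable M (\<lambda>w. hpair B (F w))"
  by (rule integrable_bounded_linear[OF bounded_linear_hpair])

lemma integral_hpair: "integrable M F \<Longrightarrow> (LINT w|M. hpair B (F w)) = hpair B (integral\<^sup>L M F)"
  by (rule integral_bounded_linear[OF bounded_linear_hpair])

text \<open>Self-duality of the positive cone, tested on rank one matrices. It lets positivity pass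
  through integrals, which commute with each pairing.\<close>

lemma hpsd_hpairI:
  assumes "\<And>B. hpsd B \<Longrightarrow> 0 \<le> hpair B X"
  shows "hpsd X"
proof -
  obtain a d b where X: "X = (a, d, b)" by (cases X)
  show ?thesis unfolding X
  proof (rule hpsd_quadratic_form)
    fix x y :: complex
    have "hpsd ((cmod x)\<^sup>2, (cmod y)\<^sup>2, cnj x * y)"
      by (simp add: hpsd_def norm_mult power_mult_distrib)
    from assms[OF this] show "0 \<le> (cmod x)\<^sup>2 * a + (cmod y)\<^sup>2 * d + 2 * Re (x * b * cnj y)"
      by (simp add: X hpair_def algebra_simps)
  qed
qed

lemma hpsd_integral:
  assumes F: "integrable M F" and "AE w in M. hpsd (F w)"
  shows "hpsd (integral\<^sup>L M F)"
proof (rule hpsd_hpairI)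
  fix B assume B: "hpsd B"
  show "0 \<le> hpair B (integral\<^sup>L M F)"
    unfolding integral_hpair[OF F, symmetric]
    by (rule integral_nonneg_AE) (use assms(2) in eventually_elim, use hpair_nonneg[OF B] in auto)
qed

lemma continuous_hdet: "continuous_on A hdet" and continuous_htr: "continuous_on A htr"
  unfolding hdet_def htr_def by (intro continuous_intros)+

lemma closed_hpsd: "closed {X. hpsd X}"
  unfolding hpsd_def by (intro closed_Collect_conj closed_Collect_le continuous_intros)

lemma hpsd_0 [simp]: "hpsd 0"
  by (simp add: hpsd_def)

lemma ln_hdet_le_htr: "hpsd X \<Longrightarrow> hdet X > 0 \<Longrightarrow> ln (hdet X) \<le> htr X - 2"
  using ln_hdet_le[of X hone] by (simp add: hpair_hone)

lemma hdet_le_htr: "hpsd X \<Longrightarrow> hdet X \<le> (htr X)\<^sup>2"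
proof -
  assume X: "hpsd X"
  then have "hdet X \<le> fst X * fst (snd X)" by (simp add: hdet_def)
  also have "\<dots> \<le> (htr X)\<^sup>2" using X by (simp add: hpsd_def htr_def power2_eq_square algebra_simps add_increasing)
  finally show ?thesis .
qed

lemma hpsd_snd_le_htr: "hpsd X \<Longrightarrow> cmod (snd (snd X)) \<le> htr X"
proof -
  assume X: "hpsd X"
  have "(cmod (snd (snd X)))\<^sup>2 \<le> fst X * fst (snd X)" using X by (simp add: hpsd_def)
  also have "\<dots> \<le> (htr X)\<^sup>2" using X by (simp add: hpsd_def htr_def power2_eq_square algebra_simps add_increasing)
  finally have "(cmod (snd (snd X)))\<^sup>2 \<le> (htr X)\<^sup>2" .
  then show ?thesis by (rule power2_le_imp_le) (simp add: htr_nonneg X)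
qed

lemma norm_hpsd_le: "hpsd X \<Longrightarrow> norm X \<le> 3 * htr X"
proof -
  assume X: "hpsd X"
  have "norm X \<le> norm (fst X) + (norm (fst (snd X)) + norm (snd (snd X)))"
    by (cases X) (simp add: order_trans[OF norm_Pair_le add_left_mono[OF norm_Pair_le]] del: real_norm_def)
  then show ?thesis using hpsd_snd_le_htr[OF X] X by (simp add: hpsd_def htr_def)
qed

lemma abs_hpair_le: "\<bar>hpair B X\<bar> \<le> 4 * norm B * norm X"
proof -
  have "\<bar>hpair B X\<bar> \<le> norm (fst B, fst (snd B), 2 *\<^sub>R snd (snd B)) * norm X"
    unfolding hpair_eq_inner by (rule Cauchy_Schwarz_ineq2)
  also have "norm (fst B, fst (snd B), 2 *\<^sub>R snd (snd B)) \<le> norm (fst B) + (norm (fst (snd B)) + norm (2 *\<^sub>R snd (snd B)))"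
    by (rule order_trans[OF norm_Pair_le add_left_mono[OF norm_Pair_le]])
  also have "\<dots> \<le> norm B + (norm B + 2 * norm B)"
  proof -
    have "norm (fst B) \<le> norm B" "norm (snd B) \<le> norm B" "norm (fst (snd B)) \<le> norm (snd B)" "norm (snd (snd B)) \<le> norm (snd B)"
      using norm_fst_le[of "fst B" "snd B"] norm_snd_le[of "snd B" "fst B"]
        norm_fst_le[of "fst (snd B)" "snd (snd B)"] norm_snd_le[of "snd (snd B)" "fst (snd B)"] by simp_all
    then show ?thesis by simp
  qed
  finally show ?thesis by (simp add: mult_right_mono)
qed

definition hinv :: "htriple \<Rightarrow> htriple" where
  "hinv X = (1 / hdet X) *\<^sub>R hadj X"

lemma hinv_facts:
  assumes "hpsd X" "hdet X > 0"
  shows "hpsd (hinv X)" "hdet (hinv X) = 1 / hdet X" "hpair (hinv X) X = 2" "htr (hinv X) = htr X / hdet X"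
  using assms by (simp_all add: hinv_def hpsd_scaleR hpsd_hadj hdet_scaleR hdet_hadj hpair_scaleR_left
      hpair_hadj_self htr_hadj power2_eq_square)

section \<open>The entropy of the absolutely continuous part\<close>

locale matrix_density =
  fixes L :: "complex measure" and H :: "complex \<Rightarrow> htriple" and \<rho> :: "complex \<Rightarrow> real"
  assumes L: "finite_measure L" "sets L = sets circle"
    and H: "integrable L H" "\<And>w. hpsd (H w)"
    and \<rho>: "integrable L \<rho>" "\<And>w. 0 \<le> \<rho> w"
    and arc: "arc_measure = density L (\<lambda>w. ennreal (\<rho> w))"
begin

lemma space_L: "space L = sphere 0 1"
  using sets_eq_imp_space_eq[OF L(2)] by simp

lemma measurable_L [measurable]: "\<rho> \<in> borel_measurable L" "H \<in> borel_measurable L"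
  using H \<rho> by auto

lemma measurable_arc_iff: "f \<in> borel_measurable arc_measure \<longleftrightarrow> f \<in> borel_measurable L"
  using L(2) by (simp cong: measurable_cong_sets)

lemma integral_arc:
  fixes f :: "complex \<Rightarrow> 'b :: {banach, second_countable_topology}"
  assumes "f \<in> borel_measurable L"
  shows "integral\<^sup>L arc_measure f = (LINT w|L. \<rho> w *\<^sub>R f w)" "integrable arc_measure f \<longleftrightarrow> integrable L (\<lambda>w. \<rho> w *\<^sub>R f w)"
proof -
  have "\<rho> \<in> borel_measurable L" "AE w in L. 0 \<le> \<rho> w" using \<rho>(2) by auto
  from integral_density[OF assms this] integrable_density[OF assms this]
  show "integral\<^sup>L arc_measure f = (LINT w|L. \<rho> w *\<^sub>R f w)" "integrable arc_measure f \<longleftrightarrow> integrable L (\<lambda>w. \<rho> w *\<^sub>R f w)"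
    unfolding arc by simp_all
qed

lemma integral_\<rho>: "integral\<^sup>L L \<rho> = 1"
  using integral_arc(1)[of "\<lambda>_. 1 :: real"] measure_arc_space by simp

lemma AE_arc: "(AE w in arc_measure. P w) \<longleftrightarrow> (AE w in L. 0 < \<rho> w \<longrightarrow> P w)"
  unfolding arc by (subst AE_density) auto

text \<open>With dM = H dL and arc length equal to \<rho> dL, this is the density of the absolutely
  continuous part of M. The singular part lives on \<rho> = 0, where the quotient takes the value 0
  by convention; that set is null for arc length.\<close>

definition "W0 w = (1 / \<rho> w) *\<^sub>R H w"
definition "Wr z = (LINT w|L. poisson z w *\<^sub>R H w)"

lemma measurable_W0 [measurable]: "W0 \<in> borel_measurable L"
  unfolding W0_def by measurable

lemma borel_measurable_h [measurable]: "hdet \<in> borel_measurable borel" "htr \<in> borel_measurable borel"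
  "hadj \<in> borel_measurable borel"
  unfolding hadj_def[abs_def]
  by (intro borel_measurable_continuous_onI continuous_hdet continuous_htr continuous_intros)+

lemma borel_measurable_hinv [measurable]: "hinv \<in> borel_measurable borel"
  unfolding hinv_def[abs_def] by measurable

lemma hpsd_W0: "hpsd (W0 w)"
  unfolding W0_def using H(2) \<rho>(2) by (intro hpsd_scaleR) auto

lemma H_eq: "0 < \<rho> w \<Longrightarrow> H w = \<rho> w *\<^sub>R W0 w"
  by (simp add: W0_def)

lemma hpsd_Wr: "cmod z < 1 \<Longrightarrow> hpsd (Wr z)"
  unfolding Wr_def using H(2) poisson_nonneg
  by (intro hpsd_integral poisson_integrable[OF L H(1)] AE_I2 hpsd_scaleR) (auto simp: space_L)

text \<open>Jensen's inequality by tangents: the bound \<open>ln_hdet_le\<close> for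
  \<open>W0 w\<close>, with the inverse of the Poisson integral at z as the other matrix, is
  integrated against the Poisson kernel. Averaging over |z| = r then removes the kernel, whose mean
  is 1.\<close>

lemma mean_ln_hdet_ge:
  assumes int: "integrable arc_measure (\<lambda>w. ln (hdet (W0 w)))" and pos: "AE w in arc_measure. 0 < hdet (W0 w)"
    and r: "0 \<le> r" "r < 1" and Wpos: "\<And>z. cmod z < 1 \<Longrightarrow> 0 < hdet (Wr z)"
    and intW: "integrable arc_measure (\<lambda>u. ln (hdet (Wr (of_real r * u))))"
  shows "(LINT w|arc_measure. ln (hdet (W0 w))) \<le> (LINT u|arc_measure. ln (hdet (Wr (of_real r * u))))"
proof -
  define l where "l w = \<rho> w * ln (hdet (W0 w))" for w
  have lint: "integrable L l" using integral_arc(2)[of "\<lambda>w. ln (hdet (W0 w))"] int by (simp add: l_def[abs_def])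
  have pw: "(LINT w|L. poisson z w *\<^sub>R l w) \<le> ln (hdet (Wr z))" if z: "cmod z < 1" and zr: "z = of_real r * u" "cmod u = 1" for z u
  proof -
    let ?B = "hinv (Wr z)"
    note B = hinv_facts[OF hpsd_Wr[OF z] Wpos[OF z]]
    have i1: "integrable L (\<lambda>w. poisson z w *\<^sub>R l w)" by (rule poisson_integrable[OF L lint z])
    have i2: "integrable L (\<lambda>w. poisson z w *\<^sub>R H w)" by (rule poisson_integrable[OF L H(1) z])
    have i3: "integrable L (\<lambda>w. poisson z w *\<^sub>R \<rho> w)" by (rule poisson_integrable[OF L \<rho>(1) z])
    have "(LINT w|L. poisson z w *\<^sub>R \<rho> w) = (LINT w|arc_measure. poisson z w)"
    proof -
      have "continuous_on (sphere 0 1) (poisson z)"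
        unfolding poisson_def using denominator_nonzero[OF _ z] by (intro continuous_intros) auto
      then have "poisson z \<in> borel_measurable L"
        using measurable_circle_continuous L(2) by (simp cong: measurable_cong_sets)
      from integral_arc(1)[OF this] show ?thesis by (simp add: mult.commute)
    qed
    also have "\<dots> = 1" unfolding zr(1) by (rule poisson_mean'[OF r zr(2)])
    finally have P1: "(LINT w|L. poisson z w *\<^sub>R \<rho> w) = 1" .
    have "(LINT w|L. poisson z w *\<^sub>R l w) \<le>
       (LINT w|L. hpair ?B (poisson z w *\<^sub>R H w) + (ln (hdet (Wr z)) - 2) * (poisson z w *\<^sub>R \<rho> w))"
    proof (rule integral_mono_AE[OF i1])
      show "integrable L (\<lambda>w. hpair ?B (poisson z w *\<^sub>R H w) + (ln (hdet (Wr z)) - 2) * (poisson z w *\<^sub>R \<rho> w))"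
        using integrable_hpair[OF i2, of ?B] i3 by simp
      show "AE w in L. poisson z w *\<^sub>R l w \<le> hpair ?B (poisson z w *\<^sub>R H w) + (ln (hdet (Wr z)) - 2) * (poisson z w *\<^sub>R \<rho> w)"
        using pos[unfolded AE_arc] AE_space
      proof eventually_elim
        case (elim w)
        then have P: "0 \<le> poisson z w" using poisson_nonneg[OF _ z] by (simp add: space_L)
        show ?case
        proof (cases "\<rho> w = 0")
          \<comment> \<open>Here arc length has no mass and only the singular part of M contributes.
            Its pairing is nonnegative, so it can only enlarge the upper bound.\<close>
          case True
          have "0 \<le> hpair ?B (poisson z w *\<^sub>R H w)" by (intro hpair_nonneg hpsd_scaleR B H P)
          then show ?thesis using True by (simp add: l_def)
        next
          case False
          then have rp: "0 < \<rho> w" using \<rho>(2)[of w] by simp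
          have "ln (hdet (W0 w)) \<le> hpair ?B (W0 w) - 2 - ln (hdet ?B)"
            by (rule ln_hdet_le) (use elim rp hpsd_W0 B Wpos[OF z] in auto)
          also have "ln (hdet ?B) = - ln (hdet (Wr z))" unfolding B using Wpos[OF z] by (simp add: ln_div)
          finally have "(poisson z w * \<rho> w) * ln (hdet (W0 w)) \<le> (poisson z w * \<rho> w) * (hpair ?B (W0 w) - 2 + ln (hdet (Wr z)))"
            using P rp by (intro mult_left_mono) auto
          then show ?thesis by (simp add: l_def H_eq[OF rp] hpair_scaleR_right algebra_simps)
        qed
      qed
    qed
    also have "\<dots> = (LINT w|L. hpair ?B (poisson z w *\<^sub>R H w)) + (ln (hdet (Wr z)) - 2) * (LINT w|L. poisson z w *\<^sub>R \<rho> w)"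
      using integrable_hpair[OF i2, of ?B] i3 by simp
    also have "\<dots> = ln (hdet (Wr z))"
      unfolding P1 integral_hpair[OF i2] using B(3) by (simp add: Wr_def)
    finally show ?thesis .
  qed
  have c1: "continuous_on (sphere 0 1) (\<lambda>u :: complex. 1 :: real)" by (intro continuous_intros)
  have "(LINT w|arc_measure. ln (hdet (W0 w))) = (LINT w|L. l w)"
    by (subst integral_arc(1)) (simp_all add: l_def[abs_def])
  also have "\<dots> = (LINT w|L. (LINT u|arc_measure. 1 * poisson (of_real r * u) w) *\<^sub>R l w)"
    using poisson_mean[OF r] by (intro Bochner_Integration.integral_cong refl) (simp add: space_L)
  also have "\<dots> = (LINT u|arc_measure. 1 *\<^sub>R (LINT w|L. poisson (of_real r * u) w *\<^sub>R l w))"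
    by (rule poisson_Fubini(1)[OF L lint c1 r, symmetric])
  also have "\<dots> \<le> (LINT u|arc_measure. ln (hdet (Wr (of_real r * u))))"
  proof (rule integral_mono[OF poisson_Fubini(2)[OF L lint c1 r] intW])
    fix u assume "u \<in> space arc_measure"
    then show "1 *\<^sub>R (LINT w|L. poisson (of_real r * u) w *\<^sub>R l w) \<le> ln (hdet (Wr (of_real r * u)))"
      using r by (simp only: scaleR_one, intro pw[OF _ refl]) (auto simp: norm_mult)
  qed
  finally show ?thesis .
qed

definition "trace_mass = (LINT w|L. htr (H w))"

lemma integrable_htr_H: "integrable L (\<lambda>w. htr (H w))"
  using integrable_hpair[OF H(1), of hone] by (simp add: hpair_hone)

lemma trace_mass_nonneg: "0 \<le> trace_mass"
  unfolding trace_mass_def by (intro integral_nonneg_AE AE_I2 htr_nonneg H)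

lemma hpair_components: "hpair B X = fst B * fst X + fst (snd B) * fst (snd X)
    + (2 * Re (snd (snd B))) * Re (snd (snd X)) + (2 * Im (snd (snd B))) * Im (snd (snd X))"
  by (simp add: hpair_def)

lemma bounded_linear_components:
  "bounded_linear (fst :: htriple \<Rightarrow> real)" "bounded_linear (\<lambda>X :: htriple. fst (snd X))"
  "bounded_linear (\<lambda>X :: htriple. Re (snd (snd X)))" "bounded_linear (\<lambda>X :: htriple. Im (snd (snd X)))"
  by (intro bounded_linear_fst bounded_linear_compose[OF bounded_linear_Re]
      bounded_linear_compose[OF bounded_linear_Im] bounded_linear_compose[OF bounded_linear_fst] bounded_linear_snd
      bounded_linear_compose[OF bounded_linear_snd bounded_linear_snd])+

text \<open>The tangent bound given by \<open>G\<close> is applied to the Poisson integral at every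
  point. Its right side is linear in that integral, so as the radius tends to 1 it converges weakly
  to the pairing of \<open>G\<close> with all of M, singular part included.\<close>

lemma variational_continuous:
  assumes E: "\<And>r. 0 \<le> r \<Longrightarrow> r < 1 \<Longrightarrow> E \<le> (LINT u|arc_measure. ln (hdet (Wr (of_real r * u))))"
    and intW: "\<And>r. 0 \<le> r \<Longrightarrow> r < 1 \<Longrightarrow> integrable arc_measure (\<lambda>u. ln (hdet (Wr (of_real r * u))))"
    and Wpos: "\<And>z. cmod z < 1 \<Longrightarrow> 0 < hdet (Wr z)"
    and G: "continuous_on (sphere 0 1) G" "\<And>w. hpsd (G w)" "\<And>w. 0 < hdet (G w)"
  shows "E \<le> (LINT w|L. hpair (G w) (H w)) - 2 - (LINT w|arc_measure. ln (hdet (G w)))"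
proof -
  interpret arcm: finite_measure arc_measure by (rule finite_measure_arc)
  have lnG: "integrable arc_measure (\<lambda>w. ln (hdet (G w)))"
  proof (intro integrable_arc_continuous continuous_on_ln ballI)
    show "continuous_on (sphere 0 1) (\<lambda>w. hdet (G w))"
      by (rule continuous_on_compose2[OF continuous_hdet[of UNIV] G(1)]) simp
    show "hdet (G w) \<noteq> 0" for w using G(3)[of w] by simp
  qed
  \<comment> \<open>Weak convergence is known for scalar test functions, so the pairing is split
    into its four real components.\<close>
  have comp: "(\<lambda>n. LINT u|arc_measure. g u *\<^sub>R T (Wr (of_real (radius_seq n) * u))) \<longlonglongrightarrow> (LINT w|L. g w *\<^sub>R T (H w))"
    "integrable arc_measure (\<lambda>u. g u *\<^sub>R T (Wr (of_real (radius_seq n) * u)))"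
    "integrable L (\<lambda>w. g w *\<^sub>R T (H w))"
    if T: "bounded_linear T" and g: "continuous_on (sphere 0 1) g" for T :: "htriple \<Rightarrow> real" and g :: "complex \<Rightarrow> real" and n
  proof -
    have TH: "integrable L (\<lambda>w. T (H w))" by (rule integrable_bounded_linear[OF T H(1)])
    have TW: "T (Wr z) = (LINT w|L. poisson z w *\<^sub>R T (H w))" if "cmod z < 1" for z
      unfolding Wr_def integral_bounded_linear[OF T poisson_integrable[OF L H(1) that], symmetric]
      by (simp add: linear_simps[OF T])
    have eq: "g u *\<^sub>R T (Wr (of_real (radius_seq n) * u)) = g u *\<^sub>R (LINT w|L. poisson (of_real (radius_seq n) * u) w *\<^sub>R T (H w))"
      if "u \<in> space arc_measure" for u n
      using radius_seq_bounds[of n] that by (subst TW) (auto simp: norm_mult)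
    have eqi: "(LINT u|arc_measure. g u *\<^sub>R T (Wr (of_real (radius_seq n) * u))) =
      (LINT u|arc_measure. g u *\<^sub>R (LINT w|L. poisson (of_real (radius_seq n) * u) w *\<^sub>R T (H w)))" for n
      by (intro Bochner_Integration.integral_cong refl eq)
    show "(\<lambda>n. LINT u|arc_measure. g u *\<^sub>R T (Wr (of_real (radius_seq n) * u))) \<longlonglongrightarrow> (LINT w|L. g w *\<^sub>R T (H w))"
      unfolding eqi by (rule poisson_weak_limit[OF L TH g])
    show "integrable arc_measure (\<lambda>u. g u *\<^sub>R T (Wr (of_real (radius_seq n) * u)))"
      using poisson_Fubini(2)[OF L TH g radius_seq_bounds]
      by (subst Bochner_Integration.integrable_cong[OF refl eq]) 
    obtain B where B: "\<And>x. x \<in> sphere 0 1 \<Longrightarrow> norm (g x) \<le> B"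
      using continuous_circle_bounded[OF g] by blast
    have gm: "g \<in> borel_measurable L"
      using measurable_circle_continuous[OF g] L(2) by (simp cong: measurable_cong_sets)
    have "integrable L (\<lambda>w. T (H w) *\<^sub>R g w)"
      by (rule integrable_scaleR_bounded[OF TH gm]) (use B in \<open>auto simp: space_L\<close>)
    then show "integrable L (\<lambda>w. g w *\<^sub>R T (H w))" by (simp add: mult.commute)
  qed
  have g: "continuous_on (sphere 0 1) (\<lambda>w. fst (G w))" "continuous_on (sphere 0 1) (\<lambda>w. fst (snd (G w)))"
    "continuous_on (sphere 0 1) (\<lambda>w. 2 * Re (snd (snd (G w))))" "continuous_on (sphere 0 1) (\<lambda>w. 2 * Im (snd (snd (G w))))"
    by (intro continuous_intros G(1))+
  note c = comp[OF bounded_linear_components(1) g(1)] comp[OF bounded_linear_components(2) g(2)]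
    comp[OF bounded_linear_components(3) g(3)] comp[OF bounded_linear_components(4) g(4)]
  have hp: "hpair (G u) (X u) = fst (G u) *\<^sub>R fst (X u) + fst (snd (G u)) *\<^sub>R fst (snd (X u))
    + (2 * Re (snd (snd (G u)))) *\<^sub>R Re (snd (snd (X u))) + (2 * Im (snd (snd (G u)))) *\<^sub>R Im (snd (snd (X u)))" for X u
    by (simp only: hpair_components real_scaleR_def)
  have lim: "(\<lambda>n. LINT u|arc_measure. hpair (G u) (Wr (of_real (radius_seq n) * u))) \<longlonglongrightarrow> (LINT w|L. hpair (G w) (H w))"
  proof -
    have "(LINT u|arc_measure. hpair (G u) (Wr (of_real (radius_seq n) * u))) =
       (LINT u|arc_measure. fst (G u) *\<^sub>R fst (Wr (of_real (radius_seq n) * u))) +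
       (LINT u|arc_measure. fst (snd (G u)) *\<^sub>R fst (snd (Wr (of_real (radius_seq n) * u)))) +
       (LINT u|arc_measure. (2 * Re (snd (snd (G u)))) *\<^sub>R Re (snd (snd (Wr (of_real (radius_seq n) * u))))) +
       (LINT u|arc_measure. (2 * Im (snd (snd (G u)))) *\<^sub>R Im (snd (snd (Wr (of_real (radius_seq n) * u)))))" for n
      unfolding hp[of _ "\<lambda>u. Wr (of_real (radius_seq n) * u)"]
      using c(2,5,8,11)[of n] by (simp only: Bochner_Integration.integral_add Bochner_Integration.integrable_add)
    moreover have "(LINT w|L. hpair (G w) (H w)) = (LINT w|L. fst (G w) *\<^sub>R fst (H w)) + (LINT w|L. fst (snd (G w)) *\<^sub>R fst (snd (H w)))
       + (LINT w|L. (2 * Re (snd (snd (G w)))) *\<^sub>R Re (snd (snd (H w)))) + (LINT w|L. (2 * Im (snd (snd (G w)))) *\<^sub>R Im (snd (snd (H w))))"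
      unfolding hp[of _ H] using c(3,6,9,12) by (simp only: Bochner_Integration.integral_add Bochner_Integration.integrable_add)
    ultimately show ?thesis by (simp only:) (intro tendsto_add c)
  qed
  have intn: "integrable arc_measure (\<lambda>u. hpair (G u) (Wr (of_real (radius_seq n) * u)))" for n
    unfolding hp[of _ "\<lambda>u. Wr (of_real (radius_seq n) * u)"] by (intro Bochner_Integration.integrable_add c)
  have "E + 2 + (LINT w|arc_measure. ln (hdet (G w))) \<le> (LINT u|arc_measure. hpair (G u) (Wr (of_real (radius_seq n) * u)))" for n
  proof -
    let ?r = "radius_seq n"
    note r = radius_seq_bounds[of n]
    have "E + 2 + (LINT w|arc_measure. ln (hdet (G w)))
      \<le> (LINT u|arc_measure. ln (hdet (Wr (of_real ?r * u)))) + (LINT u|arc_measure. 2) + (LINT w|arc_measure. ln (hdet (G w)))"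
      using E[OF r] by (simp add: measure_arc_space)
    also have "\<dots> = (LINT u|arc_measure. ln (hdet (Wr (of_real ?r * u))) + 2 + ln (hdet (G u)))"
      using intW[OF r] lnG by (simp add: Bochner_Integration.integral_add)
    also have "\<dots> \<le> (LINT u|arc_measure. hpair (G u) (Wr (of_real ?r * u)))"
    proof (rule integral_mono[OF _ intn])
      show "integrable arc_measure (\<lambda>u. ln (hdet (Wr (of_real ?r * u))) + 2 + ln (hdet (G u)))"
        using intW[OF r] lnG by simp
      fix u assume "u \<in> space arc_measure"
      then have z: "cmod (of_real ?r * u) < 1" using r by (simp add: norm_mult)
      show "ln (hdet (Wr (of_real ?r * u))) + 2 + ln (hdet (G u)) \<le> hpair (G u) (Wr (of_real ?r * u))"
        using ln_hdet_le[OF hpsd_Wr[OF z] Wpos[OF z] G(2,3), of u] by simp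
    qed
    finally show ?thesis .
  qed
  then have "E + 2 + (LINT w|arc_measure. ln (hdet (G w))) \<le> (LINT w|L. hpair (G w) (H w))"
    by (intro LIMSEQ_le_const[OF lim]) auto
  then show ?thesis by simp
qed

text \<open>A compact convex set of matrices on which ln det is bounded when \<eta> > 0. Measurable
  test functions with values in it can be approximated by continuous ones that stay in it.\<close>

definition box :: "real \<Rightarrow> real \<Rightarrow> htriple set" where
  "box \<eta> K = {X. hpsd (X - \<eta> *\<^sub>R hone) \<and> htr X \<le> K}"

lemma box_facts:
  assumes X: "X \<in> box \<eta> K" and \<eta>: "\<eta> > 0"
  shows "hpsd X" "\<eta>\<^sup>2 \<le> hdet X" "hdet X \<le> K\<^sup>2" "norm X \<le> 3 * K" "hdet X > 0"
proof -
  have h: "hpsd (X - \<eta> *\<^sub>R hone)" "htr X \<le> K" "hpsd (\<eta> *\<^sub>R hone)" using X \<eta> by (auto simp: box_def hpsd_scaleR)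
  show P: "hpsd X" using hpsd_add[OF h(1,3)] by simp
  show e: "\<eta>\<^sup>2 \<le> hdet X" using hdet_mono[OF h(3,1)] by (simp add: hdet_scaleR)
  have "(htr X)\<^sup>2 \<le> K\<^sup>2" using htr_nonneg[OF P] h(2) by (intro power_mono) auto
  then show "hdet X \<le> K\<^sup>2" using hdet_le_htr[OF P] by simp
  show "norm X \<le> 3 * K" using norm_hpsd_le[OF P] h(2) by simp
  show "hdet X > 0" using e \<eta> by (smt (verit) zero_less_power)
qed

lemma convex_box: "convex (box \<eta> K)"
proof -
  have "convex ((\<lambda>X. X - \<eta> *\<^sub>R hone) -` {X. hpsd X} \<inter> {X. htr X \<le> K})"
  proof (intro convex_Int)
    show "convex ((\<lambda>X. X - \<eta> *\<^sub>R hone) -` {X. hpsd X})"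
    proof (rule convexI, simp)
      fix x y :: htriple and u v :: real
      assume a: "hpsd (x - \<eta> *\<^sub>R hone)" "hpsd (y - \<eta> *\<^sub>R hone)" "0 \<le> u" "0 \<le> v" "u + v = 1"
      have "u *\<^sub>R x + v *\<^sub>R y - \<eta> *\<^sub>R hone = u *\<^sub>R x + v *\<^sub>R y - (u + v) *\<^sub>R \<eta> *\<^sub>R hone" using a by simp
      also have "\<dots> = u *\<^sub>R (x - \<eta> *\<^sub>R hone) + v *\<^sub>R (y - \<eta> *\<^sub>R hone)" by (simp add: algebra_simps)
      finally show "hpsd (u *\<^sub>R x + v *\<^sub>R y - \<eta> *\<^sub>R hone)" using a by (simp add: hpsd_add hpsd_scaleR)
    qed
    show "convex {X. htr X \<le> K}"
      by (rule convexI) (auto intro: convex_bound_le)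
  qed
  then show ?thesis by (simp add: box_def vimage_def Int_def)
qed

lemma compact_box:
  assumes "\<eta> > 0" shows "compact (box \<eta> K)"
proof -
  have "closed ((\<lambda>X. X - \<eta> *\<^sub>R hone) -` {X. hpsd X} \<inter> {X. htr X \<le> K})"
    by (intro closed_Int continuous_closed_vimage closed_hpsd closed_Collect_le continuous_htr continuous_intros)
  moreover have "bounded (box \<eta> K)"
    unfolding bounded_iff using box_facts(4) assms by blast
  ultimately show ?thesis by (simp add: compact_eq_bounded_closed box_def vimage_def Int_def)
qed

lemma abs_ln_hdet_box:
  assumes "X \<in> box \<eta> K" "\<eta> > 0"
  shows "\<bar>ln (hdet X)\<bar> \<le> \<bar>ln (\<eta>\<^sup>2)\<bar> + \<bar>ln (K\<^sup>2)\<bar>"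
proof -
  note b = box_facts[OF assms]
  have "ln (\<eta>\<^sup>2) \<le> ln (hdet X)" using b assms(2) by (intro ln_mono) auto
  moreover have "ln (hdet X) \<le> ln (K\<^sup>2)" using b by (intro ln_mono) auto
  ultimately show ?thesis by linarith
qed

lemma measurable_hpair_H:
  assumes "F \<in> borel_measurable L"
  shows "(\<lambda>w. hpair (F w) (H w)) \<in> borel_measurable L"
proof -
  have T: "(\<lambda>B :: htriple. (fst B, fst (snd B), 2 *\<^sub>R snd (snd B))) \<in> borel_measurable borel"
    by (intro borel_measurable_continuous_onI continuous_intros)
  show ?thesis
    unfolding hpair_eq_inner
    by (intro borel_measurable_inner measurable_compose[OF assms T] measurable_L)
qed

lemma abs_hpair_H_le:
  assumes "X \<in> box \<eta> K" "\<eta> > 0"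
  shows "\<bar>hpair X (H w)\<bar> \<le> 4 * (3 * K) * norm (H w)"
proof -
  have "4 * norm X * norm (H w) \<le> 4 * (3 * K) * norm (H w)"
    using box_facts(4)[OF assms] by (intro mult_right_mono mult_left_mono) auto
  then show ?thesis using order_trans[OF abs_hpair_le[of X "H w"]] by simp
qed

lemma variational_measurable:
  assumes E: "\<And>r. 0 \<le> r \<Longrightarrow> r < 1 \<Longrightarrow> E \<le> (LINT u|arc_measure. ln (hdet (Wr (of_real r * u))))"
    and intW: "\<And>r. 0 \<le> r \<Longrightarrow> r < 1 \<Longrightarrow> integrable arc_measure (\<lambda>u. ln (hdet (Wr (of_real r * u))))"
    and Wpos: "\<And>z. cmod z < 1 \<Longrightarrow> 0 < hdet (Wr z)"
    and G: "G \<in> borel_measurable L" "\<And>w. G w \<in> box \<eta> K" and \<eta>: "\<eta> > 0"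
  shows "E \<le> (LINT w|L. hpair (G w) (H w)) - 2 - (LINT w|arc_measure. ln (hdet (G w)))"
proof -
  interpret arcm: finite_measure arc_measure by (rule finite_measure_arc)
  have ne: "box \<eta> K \<noteq> {}" using G(2) by blast
  obtain g where g: "\<And>n::nat. continuous_on (sphere 0 1) (g n)" "\<And>n x. g n x \<in> box \<eta> K"
    "AE x in L. (\<lambda>n. g n x) \<longlonglongrightarrow> G x"
    using continuous_approx_AE[OF L G(1) convex_box compact_box[OF \<eta>] ne G(2)] by blast
  have gm [measurable]: "g n \<in> borel_measurable L" for n
    using measurable_circle_continuous[OF g(1)] L(2) by (simp cong: measurable_cong_sets)
  note [measurable] = G(1)
  have l1: "(\<lambda>n. LINT w|L. hpair (g n w) (H w)) \<longlonglongrightarrow> (LINT w|L. hpair (G w) (H w))"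
  proof (rule integral_dominated_convergence[where w="\<lambda>w. 4 * (3 * K) * norm (H w)"])
    show "integrable L (\<lambda>w. 4 * (3 * K) * norm (H w))" using H(1) by simp
    show "AE w in L. (\<lambda>n. hpair (g n w) (H w)) \<longlonglongrightarrow> hpair (G w) (H w)"
      using g(3) by eventually_elim (unfold hpair_def, intro tendsto_intros)
    show "AE w in L. norm (hpair (g n w) (H w)) \<le> 4 * (3 * K) * norm (H w)" for n
      using abs_hpair_H_le[OF g(2) \<eta>] by (intro AE_I2) simp
  qed (auto intro: measurable_hpair_H G(1))
  have l2: "(\<lambda>n. LINT w|arc_measure. ln (hdet (g n w))) \<longlonglongrightarrow> (LINT w|arc_measure. ln (hdet (G w)))"
  proof (rule integral_dominated_convergence[where w="\<lambda>w. \<bar>ln (\<eta>\<^sup>2)\<bar> + \<bar>ln (K\<^sup>2)\<bar>"])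
    show "AE w in arc_measure. (\<lambda>n. ln (hdet (g n w))) \<longlonglongrightarrow> ln (hdet (G w))"
      unfolding AE_arc using g(3)
    proof eventually_elim
      case (elim w)
      have "(\<lambda>n. hdet (g n w)) \<longlonglongrightarrow> hdet (G w)" unfolding hdet_def by (intro tendsto_intros elim)
      then show ?case using box_facts(5)[OF G(2) \<eta>, of w] by (auto intro!: tendsto_ln)
    qed
    show "AE w in arc_measure. norm (ln (hdet (g n w))) \<le> \<bar>ln (\<eta>\<^sup>2)\<bar> + \<bar>ln (K\<^sup>2)\<bar>" for n
      using abs_ln_hdet_box[OF g(2) \<eta>] by (intro AE_I2) auto
  qed (auto simp: measurable_arc_iff)
  have "E \<le> (LINT w|L. hpair (g n w) (H w)) - 2 - (LINT w|arc_measure. ln (hdet (g n w)))" for n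
    by (rule variational_continuous[OF E intW Wpos g(1)]) (use box_facts[OF g(2) \<eta>] in auto)
  then show ?thesis
    by (intro LIMSEQ_le_const[OF tendsto_diff[OF tendsto_diff[OF l1 tendsto_const] l2]]) auto
qed

lemma hdet_add_scaled: "hdet (X + e *\<^sub>R hone) = hdet X + e * htr X + e\<^sup>2"
  by (simp add: hdet_def htr_def hone_def power2_eq_square algebra_simps)

lemma integrable_htr_W0: "integrable arc_measure (\<lambda>w. htr (W0 w))"
proof -
  have "integrable L (\<lambda>w. \<rho> w *\<^sub>R htr (W0 w))"
  proof (rule Bochner_Integration.integrable_bound[OF integrable_htr_H])
    show "AE w in L. norm (\<rho> w *\<^sub>R htr (W0 w)) \<le> norm (htr (H w))"
      using \<rho>(2) by (intro AE_I2) (auto simp: W0_def)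
  qed measurable
  then show ?thesis by (subst integral_arc(2)) auto
qed

text \<open>Adding e times the identity confines ln det between ln (e^2) and the trace, so the
  entropy of the regularised density is finite before anything is known about
  \<open>W0\<close>.\<close>

lemma regularized:
  assumes e: "e > 0"
  shows "hpsd (W0 w + e *\<^sub>R hone)" "e\<^sup>2 \<le> hdet (W0 w + e *\<^sub>R hone)" "0 < hdet (W0 w + e *\<^sub>R hone)"
    "integrable arc_measure (\<lambda>w. ln (hdet (W0 w + e *\<^sub>R hone)))"
proof -
  have "hpsd (e *\<^sub>R hone)" using e by (simp add: hpsd_scaleR)
  then show X: "hpsd (W0 w + e *\<^sub>R hone)" for w by (intro hpsd_add hpsd_W0)
  show X2: "e\<^sup>2 \<le> hdet (W0 w + e *\<^sub>R hone)" for w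
    using hdet_nonneg[OF hpsd_W0, of w] htr_nonneg[OF hpsd_W0, of w] e by (simp add: hdet_add_scaled)
  then show X3: "0 < hdet (W0 w + e *\<^sub>R hone)" for w
    using e by (smt (verit) zero_less_power)
  show "integrable arc_measure (\<lambda>w. ln (hdet (W0 w + e *\<^sub>R hone)))"
  proof (rule Bochner_Integration.integrable_bound)
    interpret arcm: finite_measure arc_measure by (rule finite_measure_arc)
    show "integrable arc_measure (\<lambda>w. \<bar>ln (e\<^sup>2)\<bar> + (htr (W0 w) + 2 * e))" using integrable_htr_W0 by simp
    show "(\<lambda>w. ln (hdet (W0 w + e *\<^sub>R hone))) \<in> borel_measurable arc_measure"
      unfolding measurable_arc_iff by measurable
    show "AE w in arc_measure. norm (ln (hdet (W0 w + e *\<^sub>R hone))) \<le> norm (\<bar>ln (e\<^sup>2)\<bar> + (htr (W0 w) + 2 * e))"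
    proof (rule AE_I2)
      fix w
      have "ln (hdet (W0 w + e *\<^sub>R hone)) \<le> htr (W0 w) + 2 * e - 2"
        using ln_hdet_le_htr[OF X[of w] X3[of w]] by simp
      moreover have "ln (e\<^sup>2) \<le> ln (hdet (W0 w + e *\<^sub>R hone))"
        using X2[of w] X3[of w] e by (intro ln_mono) auto
      moreover have "0 \<le> htr (W0 w)" by (rule htr_nonneg[OF hpsd_W0])
      ultimately show "norm (ln (hdet (W0 w + e *\<^sub>R hone))) \<le> norm (\<bar>ln (e\<^sup>2)\<bar> + (htr (W0 w) + 2 * e))"
        using e unfolding real_norm_def by linarith
    qed
  qed
qed

text \<open>The tangent bound is sharp at the inverse of its argument, so the test function is
  essentially the inverse of W0 + e where \<rho> > 0. Where \<rho> = 0 it is only \<eta> times the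
  identity, so that the singular part of M costs no more than \<eta> times its trace.\<close>

lemma entropy_regularized_ge:
  assumes E: "\<And>r. 0 \<le> r \<Longrightarrow> r < 1 \<Longrightarrow> E \<le> (LINT u|arc_measure. ln (hdet (Wr (of_real r * u))))"
    and intW: "\<And>r. 0 \<le> r \<Longrightarrow> r < 1 \<Longrightarrow> integrable arc_measure (\<lambda>u. ln (hdet (Wr (of_real r * u))))"
    and Wpos: "\<And>z. cmod z < 1 \<Longrightarrow> 0 < hdet (Wr z)"
    and e: "e > 0"
  shows "E \<le> (LINT w|arc_measure. ln (hdet (W0 w + e *\<^sub>R hone)))"
proof (rule field_le_epsilon)
  fix \<epsilon> :: real assume \<epsilon>: "\<epsilon> > 0"
  \<comment> \<open>Makes the total cost \<eta> * \<open>trace_mass\<close> at most \<epsilon>; the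
    summand 1 guards against mass 0.\<close>
  define \<eta> where "\<eta> = \<epsilon> / (trace_mass + 1)"
  have \<eta>: "\<eta> > 0" using \<epsilon> trace_mass_nonneg by (simp add: \<eta>_def)
  interpret arcm: finite_measure arc_measure by (rule finite_measure_arc)
  define X where "X w = W0 w + e *\<^sub>R hone" for w
  note R = regularized[OF e, folded X_def]
  have [measurable]: "X \<in> borel_measurable L" unfolding X_def by measurable
  note I = hinv_facts[OF R(1,3)]
  define G where "G w = (if 0 < \<rho> w then hinv (X w) else 0) + \<eta> *\<^sub>R hone" for w
  have [measurable]: "G \<in> borel_measurable L" unfolding G_def by measurable
  \<comment> \<open>Both eigenvalues of W0 + e are at least e, so the trace of its inverse is at
    most 2 / e. This keeps \<open>G\<close> in a fixed box.\<close>
  have tr: "htr (hinv (X w)) \<le> 2 / e" for w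
  proof -
    have "e * htr (X w) \<le> 2 * hdet (X w)"
      using hdet_nonneg[OF hpsd_W0, of w] htr_nonneg[OF hpsd_W0, of w] e
      unfolding X_def hdet_add_scaled by (simp add: distrib_left power2_eq_square)
    then show ?thesis unfolding I using e R(3)[of w] by (simp add: field_simps)
  qed
  have box: "G w \<in> box \<eta> (2 / e + 2 * \<eta>)" for w
    using I(1)[of w] tr[of w] e by (auto simp: box_def G_def htr_def[of 0])
  have hG: "hpair (G w) (H w) \<le> 2 * \<rho> w + \<eta> * htr (H w)" for w
  proof (cases "0 < \<rho> w")
    case True
    have "hpair (hinv (X w)) (W0 w) = hpair (hinv (X w)) (X w) - e * htr (hinv (X w))"
      unfolding X_def hpair_add_right hpair_scaleR_right by (simp add: hpair_def htr_def hone_def algebra_simps)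
    also have "\<dots> \<le> 2" using I(3)[of w] htr_nonneg[OF I(1)[of w]] e by simp
    finally have "\<rho> w * hpair (hinv (X w)) (W0 w) \<le> \<rho> w * 2" using True by (intro mult_left_mono) auto
    moreover have "hpair (G w) (H w) = \<rho> w * hpair (hinv (X w)) (W0 w) + \<eta> * htr (H w)"
      using True by (simp add: G_def hpair_add_left hpair_scaleR_left hpair_hone)
        (simp add: H_eq hpair_scaleR_right)
    ultimately show ?thesis by simp
  next
    case False
    then show ?thesis using \<rho>(2)[of w] by (simp add: G_def hpair_scaleR_left hpair_hone)
  qed
  have int1: "integrable L (\<lambda>w. hpair (G w) (H w))"
  proof (rule Bochner_Integration.integrable_bound)
    show "integrable L (\<lambda>w. 4 * (3 * (2 / e + 2 * \<eta>)) * norm (H w))" using H(1) by simp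
    show "AE w in L. norm (hpair (G w) (H w)) \<le> norm (4 * (3 * (2 / e + 2 * \<eta>)) * norm (H w))"
      using abs_hpair_H_le[OF box \<eta>] by (intro AE_I2) (auto intro: order_trans[OF _ abs_ge_self])
  qed (auto intro: measurable_hpair_H)
  have "(LINT w|L. hpair (G w) (H w)) \<le> (LINT w|L. 2 * \<rho> w + \<eta> * htr (H w))"
    using int1 \<rho>(1) integrable_htr_H hG by (intro integral_mono) auto
  also have "\<dots> = 2 + \<eta> * trace_mass"
    using \<rho>(1) integrable_htr_H integral_\<rho> by (simp add: trace_mass_def)
  finally have b1: "(LINT w|L. hpair (G w) (H w)) \<le> 2 + \<eta> * trace_mass" .
  have "(LINT w|arc_measure. - ln (hdet (X w))) \<le> (LINT w|arc_measure. ln (hdet (G w)))"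
  proof (rule integral_mono_AE)
    show "integrable arc_measure (\<lambda>w. - ln (hdet (X w)))" using R(4) by simp
    show "integrable arc_measure (\<lambda>w. ln (hdet (G w)))"
    proof (rule arcm.integrable_const_bound)
      show "AE w in arc_measure. norm (ln (hdet (G w))) \<le> \<bar>ln (\<eta>\<^sup>2)\<bar> + \<bar>ln ((2 / e + 2 * \<eta>)\<^sup>2)\<bar>"
        using abs_ln_hdet_box[OF box \<eta>] by (intro AE_I2) auto
      show "(\<lambda>w. ln (hdet (G w))) \<in> borel_measurable arc_measure"
        unfolding measurable_arc_iff by measurable
    qed
    show "AE w in arc_measure. - ln (hdet (X w)) \<le> ln (hdet (G w))"
      unfolding AE_arc
    proof (intro AE_I2 impI)
      fix w assume "0 < \<rho> w"
      then have "hdet (hinv (X w)) \<le> hdet (G w)"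
        using \<eta> by (intro hdet_mono I) (simp add: G_def hpsd_scaleR)
      then have "ln (1 / hdet (X w)) \<le> ln (hdet (G w))"
        unfolding I using R(3)[of w] box_facts(5)[OF box \<eta>, of w] by (intro ln_mono) auto
      then show "- ln (hdet (X w)) \<le> ln (hdet (G w))" using R(3)[of w] by (simp add: ln_div)
    qed
  qed
  then have b2: "- (LINT w|arc_measure. ln (hdet (G w))) \<le> (LINT w|arc_measure. ln (hdet (X w)))" by simp
  have "E \<le> (LINT w|L. hpair (G w) (H w)) - 2 - (LINT w|arc_measure. ln (hdet (G w)))"
    by (rule variational_measurable[OF E intW Wpos _ box \<eta>]) auto
  then have "E \<le> \<eta> * trace_mass + (LINT w|arc_measure. ln (hdet (X w)))" using b1 b2 by simp
  moreover have "\<eta> * trace_mass \<le> \<epsilon>"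
    using \<epsilon> trace_mass_nonneg by (simp add: \<eta>_def field_simps)
  ultimately show "E \<le> (LINT w|arc_measure. ln (hdet (W0 w + e *\<^sub>R hone))) + \<epsilon>" by (simp add: X_def)
qed

text \<open>The regularised entropies decrease with e and stay above E. Fatou's lemma for the
  nonnegative differences to the first of them bounds the integral of the limit, which yields
  positivity of det W0 almost everywhere, integrability and the inequality at once.\<close>

lemma entropy_ge:
  assumes E: "\<And>r. 0 \<le> r \<Longrightarrow> r < 1 \<Longrightarrow> E \<le> (LINT u|arc_measure. ln (hdet (Wr (of_real r * u))))"
    and intW: "\<And>r. 0 \<le> r \<Longrightarrow> r < 1 \<Longrightarrow> integrable arc_measure (\<lambda>u. ln (hdet (Wr (of_real r * u))))"
    and Wpos: "\<And>z. cmod z < 1 \<Longrightarrow> 0 < hdet (Wr z)"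
  shows "AE w in arc_measure. 0 < hdet (W0 w)" "integrable arc_measure (\<lambda>w. ln (hdet (W0 w)))"
    "E \<le> (LINT w|arc_measure. ln (hdet (W0 w)))"
proof -
  define e where "e n = inverse (real (Suc n))" for n
  have e: "e n > 0" "e n \<le> e 0" for n by (auto simp: e_def field_simps)
  have elim: "e \<longlonglongrightarrow> 0" unfolding e_def by (rule LIMSEQ_inverse_real_of_nat)
  define D where "D n w = hdet (W0 w + e n *\<^sub>R hone)" for n w
  define U where "U n w = ln (D n w)" for n w
  have Dpos: "0 < D n w" for n w using regularized(3)[OF e(1)] by (simp add: D_def)
  have [measurable]: "D n \<in> borel_measurable L" for n unfolding D_def by measurable
  have [measurable]: "U n \<in> borel_measurable arc_measure" for n
    unfolding measurable_arc_iff U_def by measurable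
  have hm [measurable]: "(\<lambda>w. hdet (W0 w)) \<in> borel_measurable arc_measure"
    unfolding measurable_arc_iff by measurable
  have Uint: "integrable arc_measure (U n)" for n
    using regularized(4)[OF e(1)] by (simp add: U_def[abs_def] D_def)
  have UE: "E \<le> integral\<^sup>L arc_measure (U n)" for n
    using entropy_regularized_ge[OF E intW Wpos e(1)] by (simp add: U_def[abs_def] D_def)
  have nn: "0 \<le> hdet (W0 w)" "0 \<le> htr (W0 w)" for w using hpsd_W0 hdet_nonneg htr_nonneg by auto
  have Ule: "U n w \<le> U 0 w" for n w
  proof -
    have "D n w \<le> D 0 w"
      using nn[of w] e[of n] by (auto simp: D_def hdet_add_scaled intro!: add_mono mult_right_mono power_mono)
    then show ?thesis unfolding U_def using Dpos by (intro ln_mono) auto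
  qed
  have Dlim: "(\<lambda>n. D n w) \<longlonglongrightarrow> hdet (W0 w)" for w
  proof -
    have "(\<lambda>n. hdet (W0 w) + e n * htr (W0 w) + (e n)\<^sup>2) \<longlonglongrightarrow> hdet (W0 w) + 0 * htr (W0 w) + 0\<^sup>2"
      by (intro tendsto_intros elim)
    then show ?thesis by (simp add: D_def hdet_add_scaled)
  qed
  let ?l = "\<lambda>w. ln (hdet (W0 w))"
  \<comment> \<open>The value \<open>top\<close> on det W0 = 0 is the true limit there, as the
    logarithms tend to minus infinity; finiteness of the integral of F makes that set null.\<close>
  define F where "F w = (if 0 < hdet (W0 w) then ennreal (U 0 w - ?l w) else top)" for w
  have lim: "(\<lambda>n. ennreal (U 0 w - U n w)) \<longlonglongrightarrow> F w" for w
  proof (cases "0 < hdet (W0 w)")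
    case True
    then have "(\<lambda>n. ennreal (U 0 w - U n w)) \<longlonglongrightarrow> ennreal (U 0 w - ?l w)"
      unfolding U_def by (intro tendsto_ennrealI tendsto_intros Dlim) auto
    then show ?thesis using True by (simp add: F_def)
  next
    case False
    then have z: "hdet (W0 w) = 0" using nn[of w] by simp
    have "filterlim (\<lambda>n. D n w) (at_right 0) sequentially"
      unfolding filterlim_at using Dlim[of w] Dpos z by (auto intro!: always_eventually simp: less_imp_neq[symmetric])
    then have "filterlim (\<lambda>n. U n w) at_bot sequentially"
      unfolding U_def by (rule filterlim_compose[OF ln_at_0])
    then have "filterlim (\<lambda>n. - U n w) at_top sequentially"
      by (simp add: filterlim_uminus_at_top)
    then have "filterlim (\<lambda>n. U 0 w + - U n w) at_top sequentially"
      by (rule filterlim_tendsto_add_at_top[OF tendsto_const])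
    then have "(\<lambda>n. ennreal (U 0 w - U n w)) \<longlonglongrightarrow> top"
      by (simp add: ennreal_tendsto_top_eq_at_top)
    then show ?thesis using z by (simp add: F_def)
  qed
  let ?C = "integral\<^sup>L arc_measure (U 0) - E"
  have C0: "0 \<le> ?C" using UE[of 0] by simp
  have bnd: "(\<integral>\<^sup>+w. ennreal (U 0 w - U n w) \<partial>arc_measure) \<le> ennreal ?C" for n
  proof -
    have "(\<integral>\<^sup>+w. ennreal (U 0 w - U n w) \<partial>arc_measure) = ennreal (LINT w|arc_measure. U 0 w - U n w)"
      using Uint Ule by (intro nn_integral_eq_integral) auto
    also have "\<dots> \<le> ennreal ?C"
      using Uint UE[of n] by (intro ennreal_leI) (simp add: Bochner_Integration.integral_diff)
    finally show ?thesis .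
  qed
  have "(\<integral>\<^sup>+w. F w \<partial>arc_measure) = (\<integral>\<^sup>+w. liminf (\<lambda>n. ennreal (U 0 w - U n w)) \<partial>arc_measure)"
    by (intro nn_integral_cong lim_imp_Liminf[OF _ lim, symmetric]) simp
  also have "\<dots> \<le> liminf (\<lambda>n. \<integral>\<^sup>+w. ennreal (U 0 w - U n w) \<partial>arc_measure)"
    by (rule nn_integral_liminf) auto
  also have "\<dots> \<le> ennreal ?C"
  proof -
    have "liminf (\<lambda>n. \<integral>\<^sup>+w. ennreal (U 0 w - U n w) \<partial>arc_measure) \<le> liminf (\<lambda>n. ennreal ?C)"
      using bnd by (intro Liminf_mono) auto
    then show ?thesis by (simp add: Liminf_const)
  qed
  finally have FC: "(\<integral>\<^sup>+w. F w \<partial>arc_measure) \<le> ennreal ?C" .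
  have Fm: "F \<in> borel_measurable arc_measure" unfolding F_def by measurable
  have "AE w in arc_measure. F w \<noteq> \<infinity>"
    by (rule nn_integral_PInf_AE[OF Fm]) (use FC in \<open>auto simp: top_unique\<close>)
  then show pos: "AE w in arc_measure. 0 < hdet (W0 w)"
    by eventually_elim (auto simp: F_def split: if_splits)
  have Feq: "(\<integral>\<^sup>+w. ennreal (U 0 w - ?l w) \<partial>arc_measure) = (\<integral>\<^sup>+w. F w \<partial>arc_measure)"
    by (rule nn_integral_cong_AE) (use pos in eventually_elim, auto simp: F_def)
  have l0: "AE w in arc_measure. 0 \<le> U 0 w - ?l w"
    using pos
  proof eventually_elim
    case (elim w)
    then have "?l w \<le> U 0 w"
      unfolding U_def using nn[of w] e[of 0] by (intro ln_mono) (auto simp: D_def hdet_add_scaled)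
    then show ?case by simp
  qed
  have dint: "integrable arc_measure (\<lambda>w. U 0 w - ?l w)"
    by (rule integrableI_nonneg) (use l0 FC Feq in \<open>auto intro: le_less_trans\<close>)
  have "integrable arc_measure (\<lambda>w. U 0 w - (U 0 w - ?l w))"
    by (rule Bochner_Integration.integrable_diff[OF Uint dint])
  then show lint: "integrable arc_measure ?l" by simp
  have "ennreal (LINT w|arc_measure. U 0 w - ?l w) \<le> ennreal ?C"
    using nn_integral_eq_integral[OF dint l0] FC Feq by simp
  then have "(LINT w|arc_measure. U 0 w - ?l w) \<le> ?C" using C0 by (simp add: ennreal_le_iff)
  then show "E \<le> (LINT w|arc_measure. ?l w)" using Uint lint by simp
qed

end

section \<open>Logarithmic integrals with values in the extended reals\<close>

lemma ln_ereal_measurable [measurable]: "ln_ereal \<in> borel_measurable borel"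
  unfolding ln_ereal_def by measurable

lemma log_det_integral_arc:
  assumes D: "(\<lambda>w. Re (det (W w))) \<in> borel_measurable circle"
  shows "log_det_integral W = ereal_integral arc_measure (\<lambda>w. ln_ereal (Re (det (W w))))"
  unfolding log_det_integral_def ereal_integral_def arc_measure_def
  using D by (subst (1 2) nn_integral_distr) auto

text \<open>A finite integral of the positive part excludes \<infinity> - \<infinity>. If the
  negative part is finite as well, then D is positive almost everywhere and its logarithm is
  integrable; otherwise the value is -\<infinity>.\<close>

lemma log_det_integral_cases:
  fixes W :: "complex \<Rightarrow> complex^2^2"
  defines "D \<equiv> \<lambda>w. Re (det (W w))"
  assumes D: "D \<in> borel_measurable circle"
    and fin: "(\<integral>\<^sup>+w. e2ennreal (ln_ereal (D w)) \<partial>arc_measure) < \<infinity>"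
  shows "(AE w in arc_measure. 0 < D w) \<and> integrable arc_measure (\<lambda>w. ln (D w)) \<Longrightarrow>
      log_det_integral W = ereal (LINT w|arc_measure. ln (D w))"
    and "\<not> ((AE w in arc_measure. 0 < D w) \<and> integrable arc_measure (\<lambda>w. ln (D w))) \<Longrightarrow>
      log_det_integral W = - \<infinity>"
proof -
  note [measurable] = D
  let ?P = "\<integral>\<^sup>+w. e2ennreal (ln_ereal (D w)) \<partial>arc_measure"
  let ?N = "\<integral>\<^sup>+w. e2ennreal (- ln_ereal (D w)) \<partial>arc_measure"
  have eq: "log_det_integral W = enn2ereal ?P - enn2ereal ?N"
    using log_det_integral_arc[of W] D by (simp add: D_def ereal_integral_def)
  have P: "?P = (\<integral>\<^sup>+w. ennreal (ln (D w)) \<partial>arc_measure)" and N: "?N = (\<integral>\<^sup>+w. ennreal (- ln (D w)) \<partial>arc_measure)"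
    if "AE w in arc_measure. 0 < D w"
    by (rule nn_integral_cong_AE, use that in eventually_elim, simp add: ln_ereal_def e2ennreal_ereal)+
  show "log_det_integral W = ereal (LINT w|arc_measure. ln (D w))"
    if "(AE w in arc_measure. 0 < D w) \<and> integrable arc_measure (\<lambda>w. ln (D w))"
  proof -
    from that have pos: "AE w in arc_measure. 0 < D w" and int: "integrable arc_measure (\<lambda>w. ln (D w))" by auto
    have "?P < \<infinity>" "?N < \<infinity>" using int unfolding P[OF pos] N[OF pos] real_integrable_def
      by (simp_all add: less_top[symmetric])
    then have "enn2ereal ?P = ereal (enn2real ?P)" "enn2ereal ?N = ereal (enn2real ?N)"
      by (metis enn2ereal_ennreal enn2real_nonneg ennreal_enn2real infinity_ennreal_def)+
    then show ?thesis
      unfolding eq real_lebesgue_integral_def[OF int] by (simp add: P[OF pos] N[OF pos])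
  qed
  show "log_det_integral W = - \<infinity>"
    if not: "\<not> ((AE w in arc_measure. 0 < D w) \<and> integrable arc_measure (\<lambda>w. ln (D w)))"
  proof -
    have "?N = \<infinity>"
    proof (rule ccontr)
      assume N': "?N \<noteq> \<infinity>"
      have "AE w in arc_measure. e2ennreal (- ln_ereal (D w)) \<noteq> \<infinity>"
        by (rule nn_integral_PInf_AE[OF _ N']) measurable
      then have pos: "AE w in arc_measure. 0 < D w"
        by eventually_elim (auto simp: ln_ereal_def split: if_splits)
      have "integrable arc_measure (\<lambda>w. ln (D w))"
        unfolding real_integrable_def using N' fin unfolding P[OF pos] N[OF pos] by auto
      then show False using not pos by blast
    qed
    moreover have "enn2ereal ?P \<noteq> \<infinity>" using fin by (auto simp: enn2ereal_eq_top_iff)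
    ultimately show ?thesis unfolding eq by (cases "enn2ereal ?P") auto
  qed
qed

section \<open>The Szego limit for one frame\<close>

locale szego_data = schur_recursion i j f \<gamma> + matrix_density L H \<rho>
  for i j f \<gamma> L H \<rho> +
  fixes F :: "quat fps"
  assumes F: "F * (1 - fps_X * f 0) = 1 + fps_X * f 0" and qF: "qconv F"
    and Wr_eq: "\<And>z. cmod z < 1 \<Longrightarrow> Wr z = hpart (qeval F z)"
begin

definition "V z = 1 - mscalar z * A 0 z"

text \<open>The Cayley equation is given with 1 - X f to the right of F, while the congruence needs
  it on the left. Since 1 - X f and 1 + X f commute and the former is invertible, the factor can
  change sides.\<close>

lemma hcong_V_Wr:
  assumes z: "cmod z < 1"
  shows "hcong (V z) (Wr z) = hone - (cmod z)\<^sup>2 *\<^sub>R hgram (A 0 z)"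
proof -
  define u where "u = 1 - fps_X * f 0"
  have u: "u * inverse u = 1" by (rule inverse_mult_eq_1') (simp add: u_def)
  have "u * F * u = u * (1 + fps_X * f 0)" using F by (simp add: mult.assoc u_def)
  also have "\<dots> = (1 + fps_X * f 0) * u" by (simp add: u_def algebra_simps)
  finally have "u * F * (u * inverse u) = (1 + fps_X * f 0) * (u * inverse u)"
    by (simp only: mult.assoc[symmetric])
  then have uF: "u * F = 1 + fps_X * f 0" by (simp add: u)
  note qc = strictly_contractive_qconv[OF con] qconv_add qconv_diff qconv_mult qconv_X qconv_1 qF
  have "(1 - mscalar z * A 0 z) * qeval F z = 1 + mscalar z * A 0 z"
    using arg_cong[OF uF, of "\<lambda>h. qeval h z"] z
    by (simp add: u_def qeval_add qeval_diff qeval_mult qeval_X qeval_1 qc A_def)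
  from hcong_caratheodory[OF this] show ?thesis unfolding V_def Wr_eq[OF z] .
qed

lemma hdet_V_Wr:
  assumes z: "cmod z < 1"
  shows "(cmod (mdet (V z)))\<^sup>2 * hdet (Wr z) = hdet (hG 0 (cmod z) 0 z)"
  by (simp add: hdet_hcong[symmetric] hcong_V_Wr[OF z] hG_def)

lemma V_nonzero: "cmod z < 1 \<Longrightarrow> mdet (V z) \<noteq> 0"
  and Wr_pos: "cmod z < 1 \<Longrightarrow> 0 < hdet (Wr z)"
proof -
  assume z: "cmod z < 1"
  have "(cmod (mdet (V z)))\<^sup>2 * hdet (Wr z) > 0"
    unfolding hdet_V_Wr[OF z] using z by (intro hG_bounds(2)) auto
  then show "mdet (V z) \<noteq> 0" "0 < hdet (Wr z)" by (auto simp: zero_less_mult_iff)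
qed

text \<open>The Poisson integral and 1 - r^2 A A^H differ by the congruence with \<open>V\<close>,
  whose determinant is holomorphic, zero-free and 1 at the origin. It contributes nothing to the
  mean.\<close>

lemma mean_ln_hdet_Wr:
  assumes r: "0 \<le> r" "r < 1"
  shows "integrable arc_measure (\<lambda>u. ln (hdet (Wr (of_real r * u))))"
    and "(LINT u|arc_measure. ln (hdet (Wr (of_real r * u)))) = E 0 r 0"
proof -
  have h: "(\<lambda>z. e (A 0 z)) holomorphic_on ball 0 1" if "e \<in> {m11, m12, m21, m22}" for e
    unfolding A_def by (intro holomorphic_qeval strictly_contractive_qconv con that)
  have hol: "(\<lambda>z. mdet (V z)) holomorphic_on ball 0 1"
    unfolding mdet_def V_def mscalar_def
    by simp (intro holomorphic_intros h, auto)
  have V0: "(LINT w|arc_measure. ln (cmod (mdet (V (of_real r * w))))) = 0"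
    by (rule circle_mean_ln_norm[OF hol V_nonzero _ r]) (simp_all add: V_def mdet_def mscalar_def)
  have Vi: "integrable arc_measure (\<lambda>w. ln (cmod (mdet (V (of_real r * w)))))"
    using V_nonzero by (intro integrable_arc_continuous continuous_on_scaled_circle[of "\<lambda>z. ln (cmod (mdet (V z)))"] r
       continuous_on_ln continuous_on_norm holomorphic_on_imp_continuous_on[OF hol]) auto
  have eq: "ln (hdet (Wr (of_real r * w))) = ln (hdet (hG 0 r 0 (of_real r * w))) - 2 * ln (cmod (mdet (V (of_real r * w))))"
    if "w \<in> space arc_measure" for w
  proof -
    have z: "cmod (of_real r * w) = r" using that r by (simp add: norm_mult)
    then have z1: "cmod (of_real r * w) < 1" using r by simp
    show ?thesis
      using hdet_V_Wr[OF z1, unfolded z] Wr_pos[OF z1] V_nonzero[OF z1]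
      by (simp add: ln_mult_pos ln_realpow flip: hdet_V_Wr[OF z1, unfolded z])
  qed
  note Ei = integrable_E[OF r, of 0 0]
  show "integrable arc_measure (\<lambda>u. ln (hdet (Wr (of_real r * u))))"
    using Ei Vi by (subst Bochner_Integration.integrable_cong[OF refl eq]) auto
  have "(LINT u|arc_measure. ln (hdet (Wr (of_real r * u)))) =
    (LINT u|arc_measure. ln (hdet (hG 0 r 0 (of_real r * u))) - 2 * ln (cmod (mdet (V (of_real r * u)))))"
    by (intro Bochner_Integration.integral_cong refl eq)
  also have "\<dots> = E 0 r 0" using Ei Vi V0 by (simp add: E_def)
  finally show "(LINT u|arc_measure. ln (hdet (Wr (of_real r * u)))) = E 0 r 0" .
qed

definition "entropy_finite \<longleftrightarrow> (AE w in arc_measure. 0 < hdet (W0 w)) \<and> integrable arc_measure (\<lambda>w. ln (hdet (W0 w)))"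
definition "entropy = (LINT w|arc_measure. ln (hdet (W0 w)))"

lemma entropy_upper:
  assumes "entropy_finite"
  shows "entropy \<le> (\<Sum>k<n. 2 * ln (1 - s k))"
proof -
  have "entropy \<le> (\<Sum>k<n. 2 * ln (1 - s k)) + 2 * ln (1 + \<Delta> n r)" if r: "0 \<le> r" "r < 1" for r
    using mean_ln_hdet_ge[OF _ _ r Wr_pos mean_ln_hdet_Wr(1)[OF r]] assms E_0_upper[OF r, of n]
    unfolding entropy_finite_def entropy_def mean_ln_hdet_Wr(2)[OF r] by linarith
  then have ev: "\<forall>\<^sub>F r in at_left 1. entropy \<le> (\<Sum>k<n. 2 * ln (1 - s k)) + 2 * ln (1 + \<Delta> n r)"
    using eventually_at_left_real[of 0 "1 :: real"] by (auto elim!: eventually_mono)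
  have "((\<lambda>r. (\<Sum>k<n. 2 * ln (1 - s k)) + 2 * ln (1 + \<Delta> n r)) \<longlongrightarrow> (\<Sum>k<n. 2 * ln (1 - s k)) + 2 * ln (1 + 0)) (at_left 1)"
    by (intro tendsto_intros \<Delta>_tendsto) auto
  from tendsto_lowerbound[OF this ev] show ?thesis by simp
qed

text \<open>From x \<le> - ln (1 - x), a lower bound for the partial sums makes the squares of
  |\<gamma>| summable. Hence \<gamma> tends to 0, as \<open>E_0_lower\<close> requires, and the
  entropy bound at every radius follows.\<close>

lemma entropy_lower:
  assumes K: "\<And>n. K \<le> (\<Sum>k<n. 2 * ln (1 - s k))"
  shows "entropy_finite" "K \<le> entropy"
proof -
  have "summable s"
  proof (rule summableI_nonneg_bounded)
    show "0 \<le> s n" for n by (rule s_bounds)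
    show "sum s {..<n} \<le> - K / 2" for n
    proof -
      have "s k \<le> - ln (1 - s k)" for k using ln_le_minus_one[of "1 - s k"] s_bounds[of k] by simp
      then have "sum s {..<n} \<le> (\<Sum>k<n. - ln (1 - s k))" by (rule sum_mono)
      also have "\<dots> = - (\<Sum>k<n. 2 * ln (1 - s k)) / 2" by (simp add: sum_negf sum_distrib_left[symmetric])
      also have "\<dots> \<le> - K / 2" using K[of n] by simp
      finally show ?thesis .
    qed
  qed
  then have "s \<longlonglongrightarrow> 0" by (rule summable_LIMSEQ_zero)
  then have "(\<lambda>n. sqrt (s n)) \<longlonglongrightarrow> sqrt 0" by (intro tendsto_intros)
  then have "\<gamma> \<longlonglongrightarrow> 0" by (simp add: s_def[abs_def] tendsto_norm_zero_iff)
  then have "K \<le> (LINT u|arc_measure. ln (hdet (Wr (of_real r * u))))" if r: "0 \<le> r" "r < 1" for r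
    unfolding mean_ln_hdet_Wr(2)[OF r] by (intro E_0_lower[OF r _ K])
  note * = entropy_ge[OF this mean_ln_hdet_Wr(1) Wr_pos]
  show "entropy_finite" unfolding entropy_finite_def using *(1,2) by blast
  show "K \<le> entropy" unfolding entropy_def by (rule *(3))
qed

text \<open>The partial products decrease to some q \<ge> 0. If q > 0, then ln q bounds all partial
  sums from below, so the entropy is finite and at least ln q. If q = 0, a finite entropy would keep
  all products above its exponential.\<close>

lemma szego_limit:
  "(\<lambda>n. \<Prod>k<n. (1 - (norm (\<gamma> k))\<^sup>2)\<^sup>2) \<longlonglongrightarrow> (if entropy_finite then exp entropy else 0)"
proof -
  define p where "p n = (\<Prod>k<n. (1 - s k)\<^sup>2)" for n
  have p_exp: "p n = exp (\<Sum>k<n. 2 * ln (1 - s k))" for n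
    unfolding p_def exp_sum[OF finite_lessThan]
    by (rule prod.cong) (use s_bounds in \<open>auto simp: exp_double power2_eq_square\<close>)
  have p0: "0 < p n" for n unfolding p_exp by simp
  have dec: "decseq p"
  proof (rule decseq_SucI)
    fix n
    have "(1 - s n)\<^sup>2 \<le> 1" using s_bounds[of n] by (simp add: abs_square_le_1)
    then show "p (Suc n) \<le> p n" using p0[of n] by (simp add: p_def mult_left_le)
  qed
  obtain q where q: "p \<longlonglongrightarrow> q" "\<And>n. q \<le> p n"
    using decseq_convergent[OF dec, of 0] p0 less_imp_le by metis
  have q0: "0 \<le> q" by (rule LIMSEQ_le_const[OF q(1)]) (use p0 less_imp_le in auto)
  have "q = (if entropy_finite then exp entropy else 0)"
  proof (cases "q = 0")
    case True
    have "\<not> entropy_finite"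
    proof
      assume fin: "entropy_finite"
      have "exp entropy \<le> p n" for n unfolding p_exp using entropy_upper[OF fin, of n] by simp
      then have "exp entropy \<le> q" by (intro LIMSEQ_le_const[OF q(1)]) auto
      then show False using True by simp
    qed
    then show ?thesis using True by simp
  next
    case False
    then have qp: "0 < q" using q0 by simp
    have "ln q \<le> (\<Sum>k<n. 2 * ln (1 - s k))" for n
    proof -
      have "ln q \<le> ln (p n)" using q(2)[of n] qp by (intro ln_mono) auto
      then show ?thesis by (simp add: p_exp)
    qed
    note low = entropy_lower[OF this]
    have "exp entropy \<le> p n" for n unfolding p_exp using entropy_upper[OF low(1), of n] by simp
    then have "exp entropy \<le> q" by (intro LIMSEQ_le_const[OF q(1)]) auto
    moreover have "q \<le> exp entropy" using low(2) qp by (metis exp_le_cancel_iff exp_ln)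
    ultimately show ?thesis using low(1) by simp
  qed
  then show ?thesis using q(1) unfolding p_def[abs_def] s_def by (simp only:)
qed

end

section \<open>Densities of the measures on the circle and their uniqueness\<close>

lemma (in matrix_density) density_eq_AE:
  fixes x k :: "complex \<Rightarrow> complex"
  assumes x: "integrable arc_measure x" and k: "integrable L k" and N: "N \<in> null_sets arc_measure"
    and eq: "\<And>A. A \<in> sets circle \<Longrightarrow> A \<inter> N = {} \<Longrightarrow> set_lebesgue_integral arc_measure A x = set_lebesgue_integral L A k"
  shows "AE w in arc_measure. x w = (1 / \<rho> w) *\<^sub>R k w"
proof -
  interpret L: finite_measure L by (rule L)
  have NL: "N \<in> sets L" using null_setsD2[OF N] L(2) by simp
  have xm: "x \<in> borel_measurable L"
    using borel_measurable_integrable[OF x] by (simp only: measurable_arc_iff)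
  have rx: "integrable L (\<lambda>w. \<rho> w *\<^sub>R x w)" using x integral_arc(2)[OF xm] by simp
  \<comment> \<open>The set \<open>N\<close> carrying the singular part is null for arc length but
    may have mass under L. Both candidates are cut off outside \<open>N\<close>, where the set
    functions agree, and compared as densities with respect to L.\<close>
  define a where "a w = indicator (space L - N) w *\<^sub>R (\<rho> w *\<^sub>R x w)" for w
  define b where "b w = indicator (space L - N) w *\<^sub>R k w" for w
  have ai: "integrable L a" unfolding a_def using NL rx by (intro integrable_mult_indicator) auto
  have bi: "integrable L b" unfolding b_def using NL k by (intro integrable_mult_indicator) auto
  have "AE w in L. a w = b w"
  proof (rule L.density_unique_banach[OF ai bi])
    fix A assume A: "A \<in> sets L"
    have B: "A - N \<in> sets circle" "(A - N) \<inter> N = {}" using A NL L(2) by auto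
    have sub: "A \<subseteq> space L" by (rule sets.sets_into_space[OF A])
    have "set_lebesgue_integral L A a = (LINT w|L. \<rho> w *\<^sub>R (indicator (A - N) w *\<^sub>R x w))"
      unfolding set_lebesgue_integral_def a_def
      by (intro Bochner_Integration.integral_cong) (auto simp: indicator_def)
    also have "\<dots> = set_lebesgue_integral arc_measure (A - N) x"
      unfolding set_lebesgue_integral_def using xm A NL by (subst integral_arc(1)) auto
    also have "\<dots> = set_lebesgue_integral L (A - N) k" by (rule eq[OF B])
    also have "\<dots> = set_lebesgue_integral L A b"
      unfolding set_lebesgue_integral_def b_def
      by (intro Bochner_Integration.integral_cong) (auto simp: indicator_def)
    finally show "set_lebesgue_integral L A a = set_lebesgue_integral L A b" .
  qed
  then have "AE w in arc_measure. a w = b w" unfolding AE_arc by eventually_elim simp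
  moreover have "AE w in arc_measure. 0 < \<rho> w" unfolding AE_arc by simp
  moreover have "AE w in arc_measure. w \<notin> N" by (rule AE_not_in[OF N])
  moreover have "AE w in arc_measure. w \<in> space arc_measure" by (rule AE_space)
  ultimately show ?thesis
  proof eventually_elim
    case (elim w)
    then have "\<rho> w *\<^sub>R x w = k w" by (simp add: a_def b_def space_L)
    then show ?case using elim(2) by (metis (no_types) div_self divideR_right less_irrefl real_vector.scale_one scaleR_scaleR
       times_divide_eq_left mult_1)
  qed
qed

lemma psd_matrix_hpsd:
  assumes "psd_matrix (vector [vector [a, b], vector [cnj b, d]])"
  shows "a = of_real (Re a)" "d = of_real (Re d)" "hpsd (Re a, Re d, b)"
proof -
  have form: "cnj x * a * x + cnj x * b * y + (cnj y * cnj b * x + cnj y * d * y) \<in> \<real>\<^sub>\<ge>\<^sub>0" for x y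
    using assms[unfolded psd_matrix_def, rule_format, of "vector [x, y]"]
    by (simp add: sum_2 algebra_simps)
  have "a \<in> \<real>\<^sub>\<ge>\<^sub>0" using form[of 1 0] by simp
  then show a: "a = of_real (Re a)" by (metis complex_is_Real_iff complex_nonneg_Reals_iff of_real_Re)
  have "d \<in> \<real>\<^sub>\<ge>\<^sub>0" using form[of 0 1] by simp
  then show d: "d = of_real (Re d)" by (metis complex_is_Real_iff complex_nonneg_Reals_iff of_real_Re)
  have ab: "Im a = 0" "Im d = 0" using arg_cong[OF a, of Im] arg_cong[OF d, of Im] by simp_all
  show "hpsd (Re a, Re d, b)"
  proof (rule hpsd_quadratic_form)
    fix x y :: complex
    have "0 \<le> Re (cnj (cnj x) * a * cnj x + cnj (cnj x) * b * cnj y + (cnj (cnj y) * cnj b * cnj x + cnj (cnj y) * d * cnj y))"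
      using form[of "cnj x" "cnj y"] complex_nonneg_Reals_iff by blast
    also have "\<dots> = (cmod x)\<^sup>2 * Re a + (cmod y)\<^sup>2 * Re d + 2 * Re (x * b * cnj y)"
      unfolding cmod_power2 using ab by (simp add: power2_eq_square algebra_simps)
    finally show "0 \<le> (cmod x)\<^sup>2 * Re a + (cmod y)\<^sup>2 * Re d + 2 * Re (x * b * cnj y)" .
  qed
qed

lemma bounded_linear_coord1: "bounded_linear (coord1 u)"
proof -
  have "coord1 u = (\<lambda>p. of_real (p \<bullet> 1) + of_real (p \<bullet> u) * \<i>)"
    by (simp add: fun_eq_iff coord1_def complex_eq_iff inner_quat_def)
  then show ?thesis
    by (simp only:) (intro bounded_linear_add bounded_linear_compose[OF bounded_linear_of_real bounded_linear_inner_left]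
      bounded_linear_compose[OF bounded_linear_mult_left bounded_linear_compose[OF bounded_linear_of_real bounded_linear_inner_left]])
qed

lemma bounded_linear_coord2: "bounded_linear (coord2 u v)"
proof -
  have "coord2 u v = (\<lambda>p. of_real (p \<bullet> v) + of_real (p \<bullet> (u * v)) * \<i>)"
    by (simp add: fun_eq_iff coord2_def complex_eq_iff)
  then show ?thesis
    by (simp only:) (intro bounded_linear_add bounded_linear_compose[OF bounded_linear_of_real bounded_linear_inner_left]
      bounded_linear_compose[OF bounded_linear_mult_left bounded_linear_compose[OF bounded_linear_of_real bounded_linear_inner_left]])
qed

lemma finite_measure_sum:
  assumes "finite_measure L1" "sets L1 = sets S" "finite_measure L2" "sets L2 = sets S"
  obtains L where "finite_measure L" "sets L = sets S" "\<And>A. A \<in> sets S \<Longrightarrow> measure L A = measure L1 A + measure L2 A"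
  using nonneg_vector_measure[OF vector_measure_add[OF vector_measure_measure[OF assms(1,2)] vector_measure_measure[OF assms(3,4)]]]
  by (metis add_nonneg_nonneg measure_nonneg)

lemma complex_vector_measure_dominated:
  fixes \<nu> :: "'a set \<Rightarrow> complex"
  assumes "vector_measure S \<nu>"
  obtains L where "finite_measure L" "sets L = sets S"
    "\<And>A. A \<in> sets S \<Longrightarrow> \<bar>Re (\<nu> A)\<bar> \<le> measure L A" "\<And>A. A \<in> sets S \<Longrightarrow> \<bar>Im (\<nu> A)\<bar> \<le> measure L A"
proof -
  obtain L1 where L1: "finite_measure L1" "sets L1 = sets S" "\<And>A. A \<in> sets S \<Longrightarrow> \<bar>Re (\<nu> A)\<bar> \<le> measure L1 A"
    using vector_measure_dominated[OF vector_measure_linear[OF assms bounded_linear_Re]] by blast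
  obtain L2 where L2: "finite_measure L2" "sets L2 = sets S" "\<And>A. A \<in> sets S \<Longrightarrow> \<bar>Im (\<nu> A)\<bar> \<le> measure L2 A"
    using vector_measure_dominated[OF vector_measure_linear[OF assms bounded_linear_Im]] by blast
  obtain L where L: "finite_measure L" "sets L = sets S" "\<And>A. A \<in> sets S \<Longrightarrow> measure L A = measure L1 A + measure L2 A"
    using finite_measure_sum[OF L1(1,2) L2(1,2)] by blast
  show ?thesis
    by (rule that[OF L(1,2)]) (use L1(3) L2(3) L(3) in \<open>auto intro: order_trans add_increasing add_increasing2\<close>)
qed

lemma powi_circle:
  assumes "sets L = sets circle"
  shows "(\<lambda>w. w powi n) \<in> borel_measurable L" "\<And>w. w \<in> space L \<Longrightarrow> norm (w powi n) \<le> 1"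
proof -
  have c: "continuous_on (sphere 0 1) (\<lambda>w :: complex. w powi n)"
    by (intro continuous_intros) auto
  then show "(\<lambda>w. w powi n) \<in> borel_measurable L"
    using measurable_circle_continuous[OF c] assms by (simp cong: measurable_cong_sets)
  show "norm (w powi n) \<le> 1" if "w \<in> space L" for w
    using that sets_eq_imp_space_eq[OF assms] by (simp add: norm_power_int)
qed

lemma circle_moment_density:
  assumes "sets L = sets circle" "integrable L h" "\<And>A. A \<in> sets circle \<Longrightarrow> \<mu> A = set_lebesgue_integral L A h"
  shows "circle_moment \<mu> n = (LINT w|L. h w * w powi n)"
  unfolding circle_moment_def
  by (rule complex_integral_density[OF assms powi_circle[OF assms(1)]])

text \<open>Both measures receive densities with respect to a common dominating measure, and the
  difference of the densities has vanishing moments. This pins down the lower right entry of the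
  matrix measure, which is specified only through its moments.\<close>

lemma circle_measure_unique:
  fixes \<mu> \<nu> :: "complex set \<Rightarrow> complex"
  assumes \<mu>: "vector_measure circle \<mu>" and \<nu>: "vector_measure circle \<nu>"
    and eq: "\<And>n. circle_moment \<mu> n = circle_moment \<nu> n" and A: "A \<in> sets circle"
  shows "\<mu> A = \<nu> A"
proof -
  obtain L1 where L1: "finite_measure L1" "sets L1 = sets circle"
    "\<And>A. A \<in> sets circle \<Longrightarrow> \<bar>Re (\<mu> A)\<bar> \<le> measure L1 A" "\<And>A. A \<in> sets circle \<Longrightarrow> \<bar>Im (\<mu> A)\<bar> \<le> measure L1 A"
    using complex_vector_measure_dominated[OF \<mu>] by blast
  obtain L2 where L2: "finite_measure L2" "sets L2 = sets circle"
    "\<And>A. A \<in> sets circle \<Longrightarrow> \<bar>Re (\<nu> A)\<bar> \<le> measure L2 A" "\<And>A. A \<in> sets circle \<Longrightarrow> \<bar>Im (\<nu> A)\<bar> \<le> measure L2 A"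
    using complex_vector_measure_dominated[OF \<nu>] by blast
  obtain L where L: "finite_measure L" "sets L = sets circle" "\<And>A. A \<in> sets circle \<Longrightarrow> measure L A = measure L1 A + measure L2 A"
    using finite_measure_sum[OF L1(1,2) L2(1,2)] by blast
  have dom: "measure L1 A \<le> measure L A" "measure L2 A \<le> measure L A" if "A \<in> sets circle" for A
    using L(3)[OF that] by simp_all
  obtain h where h: "integrable L h" "\<And>A. A \<in> sets circle \<Longrightarrow> \<mu> A = set_lebesgue_integral L A h"
    using complex_vector_measure_density[OF \<mu> L(1,2) order_trans[OF L1(3) dom(1)] order_trans[OF L1(4) dom(1)]] by blast
  obtain k where k: "integrable L k" "\<And>A. A \<in> sets circle \<Longrightarrow> \<nu> A = set_lebesgue_integral L A k"
    using complex_vector_measure_density[OF \<nu> L(1,2) order_trans[OF L2(3) dom(2)] order_trans[OF L2(4) dom(2)]] by blast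
  have "AE w in L. h w - k w = 0"
  proof (rule zero_moments_imp_AE_zero[OF L(1,2)])
    show "integrable L (\<lambda>w. h w - k w)" using h k by simp
    fix n
    have i: "integrable L (\<lambda>w. x w * w powi n)" if "integrable L x" for x
    proof (rule Bochner_Integration.integrable_bound[OF that])
      show "(\<lambda>w. x w * w powi n) \<in> borel_measurable L" using that powi_circle(1)[OF L(2)] by auto
      show "AE w in L. norm (x w * w powi n) \<le> norm (x w)"
        using powi_circle(2)[OF L(2)] by (intro AE_I2) (auto simp: norm_mult mult_left_le)
    qed
    have "(LINT w|L. (h w - k w) * w powi n) = (LINT w|L. h w * w powi n) - (LINT w|L. k w * w powi n)"
      using i[OF h(1)] i[OF k(1)] by (simp add: left_diff_distrib)
    also have "\<dots> = 0"
      using eq[of n] circle_moment_density[OF L(2) h] circle_moment_density[OF L(2) k] by simp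
    finally show "(LINT w|L. (h w - k w) * w powi n) = 0" .
  qed
  then have "AE w in L. indicat_real A w *\<^sub>R h w = indicat_real A w *\<^sub>R k w" by eventually_elim simp
  then have "set_lebesgue_integral L A h = set_lebesgue_integral L A k"
    unfolding set_lebesgue_integral_def using h k A L(2)
    by (intro integral_cong_AE) auto
  then show ?thesis using h(2)[OF A] k(2)[OF A] by simp
qed

lemma set_integral_bounded_linear:
  fixes F :: "'a \<Rightarrow> 'b :: {banach, second_countable_topology}" and T :: "'b \<Rightarrow> 'c :: {banach, second_countable_topology}"
  assumes T: "bounded_linear T" and F: "integrable M F" and A: "A \<in> sets M"
  shows "T (set_lebesgue_integral M A F) = set_lebesgue_integral M A (\<lambda>w. T (F w))"
proof -
  have "integrable M (\<lambda>w. indicator A w *\<^sub>R F w)" by (rule integrable_mult_indicator[OF A F])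
  from integral_bounded_linear[OF T this] show ?thesis
    by (simp add: set_lebesgue_integral_def linear_simps(5)[OF T])
qed

text \<open>The dominating measure is the trace of the matrix measure plus arc length; positivity
  gives |b| \<le> a1 + a2, so the trace controls the off-diagonal entry too. All averages of the
  joint density over sets are positive matrices, hence so are almost all of its values.\<close>

lemma matrix_density_exists:
  fixes a1 a2 :: "complex set \<Rightarrow> real" and b :: "complex set \<Rightarrow> complex"
  assumes vm: "vector_measure circle a1" "vector_measure circle a2" "vector_measure circle b"
    and psd: "\<And>A. A \<in> sets circle \<Longrightarrow> hpsd (a1 A, a2 A, b A)"
  obtains L H \<rho> where "matrix_density L H \<rho>"
    "\<And>A. A \<in> sets circle \<Longrightarrow> a1 A = set_lebesgue_integral L A (\<lambda>w. fst (H w))"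
    "\<And>A. A \<in> sets circle \<Longrightarrow> a2 A = set_lebesgue_integral L A (\<lambda>w. fst (snd (H w)))"
    "\<And>A. A \<in> sets circle \<Longrightarrow> b A = set_lebesgue_integral L A (\<lambda>w. snd (snd (H w)))"
proof -
  have nn: "0 \<le> a1 A" "0 \<le> a2 A" "cmod (b A) \<le> a1 A + a2 A" if "A \<in> sets circle" for A
    using psd[OF that] hpsd_snd_le_htr[OF psd[OF that]] by (auto simp: hpsd_def htr_def)
  obtain L1 where L1: "finite_measure L1" "sets L1 = sets circle" "\<And>A. A \<in> sets circle \<Longrightarrow> measure L1 A = a1 A"
    using nonneg_vector_measure[OF vm(1) nn(1)] by metis
  obtain L2 where L2: "finite_measure L2" "sets L2 = sets circle" "\<And>A. A \<in> sets circle \<Longrightarrow> measure L2 A = a2 A"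
    using nonneg_vector_measure[OF vm(2) nn(2)] by metis
  obtain L12 where L12: "finite_measure L12" "sets L12 = sets circle"
    "\<And>A. A \<in> sets circle \<Longrightarrow> measure L12 A = measure L1 A + measure L2 A"
    using finite_measure_sum[OF L1(1,2) L2(1,2)] by blast
  obtain L where L: "finite_measure L" "sets L = sets circle"
    "\<And>A. A \<in> sets circle \<Longrightarrow> measure L A = measure L12 A + measure arc_measure A"
    using finite_measure_sum[OF L12(1,2) finite_measure_arc sets_arc_measure] by blast
  interpret L: finite_measure L by (rule L)
  have meas: "measure L A = a1 A + a2 A + measure arc_measure A" if "A \<in> sets circle" for A
    using L(3) L12(3) L1(3) L2(3) that by simp
  have dom: "\<bar>a1 A\<bar> \<le> measure L A" "\<bar>a2 A\<bar> \<le> measure L A" "\<bar>Re (b A)\<bar> \<le> measure L A"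
    "\<bar>Im (b A)\<bar> \<le> measure L A" "\<bar>measure arc_measure A\<bar> \<le> measure L A" if "A \<in> sets circle" for A
    using meas[OF that] nn[OF that] measure_nonneg[of arc_measure A] abs_Re_le_cmod[of "b A"] abs_Im_le_cmod[of "b A"]
    by linarith+
  obtain h1 where h1: "integrable L h1" "\<And>A. A \<in> sets circle \<Longrightarrow> a1 A = set_lebesgue_integral L A h1"
    using dominated_vector_measure_density[OF vm(1) L(1,2) dom(1)] by blast
  obtain h2 where h2: "integrable L h2" "\<And>A. A \<in> sets circle \<Longrightarrow> a2 A = set_lebesgue_integral L A h2"
    using dominated_vector_measure_density[OF vm(2) L(1,2) dom(2)] by blast
  obtain hb where hb: "integrable L hb" "\<And>A. A \<in> sets circle \<Longrightarrow> b A = set_lebesgue_integral L A hb"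
    using complex_vector_measure_density[OF vm(3) L(1,2) dom(3) dom(4)] by blast
  obtain \<rho>0 where \<rho>0: "integrable L \<rho>0" "\<And>A. A \<in> sets circle \<Longrightarrow> measure arc_measure A = set_lebesgue_integral L A \<rho>0"
    using dominated_vector_measure_density[OF vector_measure_measure[OF finite_measure_arc sets_arc_measure] L(1,2) dom(5)] by blast
  define H0 where "H0 w = (h1 w, h2 w, hb w)" for w
  have H0: "integrable L H0"
  proof -
    have bl: "bounded_linear (\<lambda>b :: complex. (0 :: real, 0 :: real, b))"
      by (intro bounded_linear_Pair bounded_linear_zero bounded_linear_ident)
    have "H0 = (\<lambda>w. h1 w *\<^sub>R (1, 0, 0) + h2 w *\<^sub>R (0, 1, 0) + (0, 0, hb w))"
      by (simp add: fun_eq_iff H0_def)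
    moreover have "integrable L (\<lambda>w. h1 w *\<^sub>R (1 :: real, 0 :: real, 0 :: complex) + h2 w *\<^sub>R (0, 1, 0) + (0, 0, hb w))"
      by (intro Bochner_Integration.integrable_add integrable_scaleR_left integrable_bounded_linear[OF bl hb(1)] h1(1) h2(1))
    ultimately show ?thesis by (simp only:)
  qed
  have bl: "bounded_linear (fst :: htriple \<Rightarrow> real)" "bounded_linear (\<lambda>X :: htriple. fst (snd X))"
    "bounded_linear (\<lambda>X :: htriple. snd (snd X))"
    by (intro bounded_linear_fst bounded_linear_compose[OF bounded_linear_fst bounded_linear_snd]
        bounded_linear_compose[OF bounded_linear_snd bounded_linear_snd])+
  have H0A: "set_lebesgue_integral L A H0 = (a1 A, a2 A, b A)" if A: "A \<in> sets circle" for A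
  proof -
    have AL: "A \<in> sets L" using A L(2) by simp
    have "fst (set_lebesgue_integral L A H0) = a1 A" "fst (snd (set_lebesgue_integral L A H0)) = a2 A"
      "snd (snd (set_lebesgue_integral L A H0)) = b A"
      using set_integral_bounded_linear[OF bl(1) H0 AL] set_integral_bounded_linear[OF bl(2) H0 AL]
        set_integral_bounded_linear[OF bl(3) H0 AL] h1(2)[OF A] h2(2)[OF A] hb(2)[OF A]
      by (simp_all add: H0_def)
    then show ?thesis by (metis prod.collapse)
  qed
  have aeH: "AE w in L. H0 w \<in> {X. hpsd X}"
  proof (rule L.averaging_theorem[OF H0 closed_hpsd])
    fix A assume "A \<in> sets L"
    then have A: "A \<in> sets circle" using L(2) by simp
    show "(1 / measure L A) *\<^sub>R set_lebesgue_integral L A H0 \<in> {X. hpsd X}"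
      unfolding H0A[OF A] mem_Collect_eq by (rule hpsd_scaleR[OF psd[OF A]]) simp
  qed
  \<comment> \<open>The locale asks for positivity at every point, so the density is changed to 0 on
    the exceptional null set.\<close>
  define H where "H w = (if hpsd (H0 w) then H0 w else 0)" for w
  have HH0: "AE w in L. H w = H0 w" using aeH by eventually_elim (simp add: H_def)
  have Hm: "H \<in> borel_measurable L"
  proof -
    have [measurable]: "Measurable.pred borel hpsd"
      using borel_closed[OF closed_hpsd] by (simp add: pred_def)
    have [measurable]: "H0 \<in> borel_measurable L" using H0 by auto
    show ?thesis unfolding H_def by measurable
  qed
  have Hint: "integrable L H"
    using integrable_cong_AE[OF Hm _ HH0] H0 by auto
  define \<rho> where "\<rho> w = max 0 (\<rho>0 w)" for w
  have "AE w in L. 0 \<le> \<rho>0 w"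
    by (rule L.density_nonneg[OF \<rho>0(1)]) (use \<rho>0(2) L(2) in \<open>simp flip: \<rho>0(2)\<close>)
  then have \<rho>\<rho>0: "AE w in L. \<rho> w = \<rho>0 w" by eventually_elim (simp add: \<rho>_def)
  have \<rho>int: "integrable L \<rho>" unfolding \<rho>_def using \<rho>0(1) by (intro integrable_max) auto
  have set_cong: "set_lebesgue_integral L A x = set_lebesgue_integral L A y"
    if "AE w in L. x w = y w" "x \<in> borel_measurable L" "y \<in> borel_measurable L" "A \<in> sets circle"
    for x y :: "complex \<Rightarrow> 'z :: {banach, second_countable_topology}" and A
    unfolding set_lebesgue_integral_def
    by (rule integral_cong_AE) (use that L(2) in \<open>auto elim!: eventually_mono\<close>)
  have "arc_measure = density L (\<lambda>w. ennreal (\<rho> w))"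
  proof (rule measure_eqI)
    show "sets arc_measure = sets (density L (\<lambda>w. ennreal (\<rho> w)))" by (simp add: L(2))
    fix A assume "A \<in> sets arc_measure"
    then have A: "A \<in> sets circle" "A \<in> sets L" by (simp_all add: L(2))
    have int: "integrable L (\<lambda>w. indicator A w * \<rho> w)" using integrable_mult_indicator[OF A(2) \<rho>int] by simp
    have "emeasure arc_measure A = ennreal (measure arc_measure A)"
      by (rule finite_measure.emeasure_eq_measure[OF finite_measure_arc])
    also have "measure arc_measure A = set_lebesgue_integral L A \<rho>"
      unfolding \<rho>0(2)[OF A(1)] using \<rho>\<rho>0 \<rho>0(1) \<rho>int A by (intro set_cong) (auto elim!: eventually_mono)
    also have "ennreal \<dots> = (\<integral>\<^sup>+w. ennreal (indicator A w * \<rho> w) \<partial>L)"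
      unfolding set_lebesgue_integral_def real_scaleR_def
      by (rule nn_integral_eq_integral[OF int, symmetric]) (auto simp: \<rho>_def)
    also have "\<dots> = emeasure (density L (\<lambda>w. ennreal (\<rho> w))) A"
      using \<rho>int A by (subst emeasure_density) (auto intro!: nn_integral_cong simp: indicator_def)
    finally show "emeasure arc_measure A = emeasure (density L (\<lambda>w. ennreal (\<rho> w))) A" .
  qed
  then have md: "matrix_density L H \<rho>"
    by unfold_locales (use L Hint \<rho>int in \<open>auto simp: H_def \<rho>_def\<close>)
  have HA: "set_lebesgue_integral L A H = (a1 A, a2 A, b A)" if A: "A \<in> sets circle" for A
    using set_cong[OF HH0 Hm _ A] H0 H0A[OF A] by simp
  show ?thesis
  proof (rule that[OF md])
    fix A assume A: "A \<in> sets circle"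
    then have AL: "A \<in> sets L" using L(2) by simp
    show "a1 A = set_lebesgue_integral L A (\<lambda>w. fst (H w))"
      using set_integral_bounded_linear[OF bl(1) Hint AL] by (simp add: HA[OF A])
    show "a2 A = set_lebesgue_integral L A (\<lambda>w. fst (snd (H w)))"
      using set_integral_bounded_linear[OF bl(2) Hint AL] by (simp add: HA[OF A])
    show "b A = set_lebesgue_integral L A (\<lambda>w. snd (snd (H w)))"
      using set_integral_bounded_linear[OF bl(3) Hint AL] by (simp add: HA[OF A])
  qed
qed

text \<open>Coefficient n \<ge> 1 of the Caratheodory series is 2 c(-n), and the kernel expansion
  carries the same factor. Each of the four entries is represented by its own density.\<close>

lemma (in slice_frame) qeval_herglotz:
  assumes L: "finite_measure L" "sets L = sets circle" and k: "integrable L k"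
    and e: "e \<in> {m11, m12, m21, m22}" and c0: "c 0 = 1"
    and mom: "\<And>n. e (qmat (c (- int n))) = (LINT w|L. k w * w powi (- int n))"
    and F: "qconv (caratheodory_series c)" and z: "cmod z < 1"
  shows "e (qeval (caratheodory_series c) z) = (LINT w|L. (w + z) / (w - z) * k w)"
proof -
  have "e (qmat (caratheodory_series c $ n)) = (if n = 0 then 1 else 2) * (LINT w|L. k w * w powi (- int n))" for n
  proof (cases "n = 0")
    case True
    then show ?thesis using mom[of 0] by (simp add: caratheodory_series_def c0)
  next
    case False
    then have "caratheodory_series c $ n = c (- int n) + c (- int n)"
      by (simp add: caratheodory_series_def fps_numeral_nth numeral_fps_const mult_2)
    moreover have "e (qmat (p + p)) = 2 * e (qmat p)" for p using e by (auto simp: qmat_simps)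
    ultimately show ?thesis using False mom[of n] by simp
  qed
  then show ?thesis
    using qentry_sums(1)[OF F e z] herglotz_kernel_sums(1)[OF L k z] by (simp add: sums_iff)
qed

section \<open>Matching moments, measure and Verblunsky coefficients\<close>

lemma verblunsky_product_limit:
  fixes c :: "int \<Rightarrow> quat" and \<gamma> :: "nat \<Rightarrow> quat" and i j :: quat
    and \<mu> :: "complex set \<Rightarrow> quat"
    and M :: "complex set \<Rightarrow> complex^2^2" and W :: "complex \<Rightarrow> complex^2^2"
  assumes c: "nontrivial_positive_definite_seq c" and c0: "c 0 = 1"
    and ver: "verblunsky_coefficients c \<gamma>"
    and ij: "i \<in> imag_units" "j \<in> imag_units" "orthogonal i j"
    and qpos: "q_positive i j \<mu>" and mom: "\<forall>n. quat_moment i j \<mu> n = c n"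
    and corr: "corresponding_matrix_measure i j \<mu> M"
    and rn: "rn_derivative M W"
  shows "(\<lambda>N. ereal (\<Prod>n<N. (1 - (norm (\<gamma> n))\<^sup>2)\<^sup>2)) \<longlonglongrightarrow> exp_ereal (log_det_integral W)"
proof -
  interpret slice_frame i j by unfold_locales (rule ij)+
  obtain f where f: "\<And>n. strictly_contractive (f n)" "\<And>n. \<gamma> n = f n $ 0"
    "caratheodory_series c * (1 - fps_X * f 0) = 1 + fps_X * f 0"
    "\<And>n. (1 + fps_X * f (Suc n) * fps_const (qcnj (\<gamma> n))) * f n = fps_const (\<gamma> n) + fps_X * f (Suc n)"
    using verblunsky_recursion[OF c c0 ver] by blast
  define a b where "a A = coord1 i (\<mu> A)" and "b A = coord2 i j (\<mu> A)" for A
  have vm\<mu>: "vector_measure circle \<mu>" using qpos by (simp add: q_positive_def)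
  have vma: "vector_measure circle a" and vmb: "vector_measure circle b"
    unfolding a_def b_def
    by (rule vector_measure_linear[OF vm\<mu> bounded_linear_coord1] vector_measure_linear[OF vm\<mu> bounded_linear_coord2])+
  obtain M0 where M0: "corresponding_matrix_measure i j \<mu> M0" "\<forall>A\<in>sets circle. psd_matrix (M0 A)"
    using qpos by (auto simp: q_positive_def)
  obtain \<nu>0 where \<nu>0: "vector_measure circle \<nu>0" "\<And>n. circle_moment \<nu>0 n = circle_moment a (- n)"
    "\<And>A. A \<in> sets circle \<Longrightarrow> M0 A = vector [vector [a A, b A], vector [cnj (b A), \<nu>0 A]]"
    using M0(1) unfolding corresponding_matrix_measure_def a_def b_def by blast
  obtain \<nu> where \<nu>: "vector_measure circle \<nu>" "\<And>n. circle_moment \<nu> n = circle_moment a (- n)"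
    "\<And>A. A \<in> sets circle \<Longrightarrow> M A = vector [vector [a A, b A], vector [cnj (b A), \<nu> A]]"
    using corr unfolding corresponding_matrix_measure_def a_def b_def by blast
  \<comment> \<open>q-positivity asserts that some corresponding matrix measure is positive. The
    moments determine its lower right entry, so positivity passes to the given M.\<close>
  have \<nu>\<nu>0: "\<nu> A = \<nu>0 A" if "A \<in> sets circle" for A
    by (rule circle_measure_unique[OF \<nu>(1) \<nu>0(1) _ that]) (simp add: \<nu>(2) \<nu>0(2))
  have psd: "a A = of_real (Re (a A))" "\<nu> A = of_real (Re (\<nu> A))" "hpsd (Re (a A), Re (\<nu> A), b A)"
    if "A \<in> sets circle" for A
    using psd_matrix_hpsd[of "a A" "b A" "\<nu>0 A"] M0(2) \<nu>0(3) \<nu>\<nu>0 that by auto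
  obtain L H \<rho> where md: "matrix_density L H \<rho>"
    and dens: "\<And>A. A \<in> sets circle \<Longrightarrow> Re (a A) = set_lebesgue_integral L A (\<lambda>w. fst (H w))"
    "\<And>A. A \<in> sets circle \<Longrightarrow> Re (\<nu> A) = set_lebesgue_integral L A (\<lambda>w. fst (snd (H w)))"
    "\<And>A. A \<in> sets circle \<Longrightarrow> b A = set_lebesgue_integral L A (\<lambda>w. snd (snd (H w)))"
    using matrix_density_exists[OF vector_measure_linear[OF vma bounded_linear_Re]
        vector_measure_linear[OF \<nu>(1) bounded_linear_Re] vmb psd(3)] by blast
  interpret matrix_density L H \<rho> by (rule md)
  interpret L: finite_measure L by (rule L)
  define h1 h2 hb where "h1 w = fst (H w)" and "h2 w = fst (snd (H w))" and "hb w = snd (snd (H w))" for w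
  have int: "integrable L h1" "integrable L h2" "integrable L hb"
    unfolding h1_def[abs_def] h2_def[abs_def] hb_def[abs_def]
    by (intro integrable_bounded_linear[OF _ H(1)] bounded_linear_fst bounded_linear_compose[OF bounded_linear_fst bounded_linear_snd]
        bounded_linear_compose[OF bounded_linear_snd bounded_linear_snd])+
  define k1 k2 kc where "k1 w = complex_of_real (h1 w)" and "k2 w = complex_of_real (h2 w)" and "kc w = cnj (hb w)" for w
  have kint: "integrable L k1" "integrable L k2" "integrable L kc"
    unfolding k1_def[abs_def] k2_def[abs_def] kc_def[abs_def] using int by auto
  have da: "a A = set_lebesgue_integral L A k1" and d\<nu>: "\<nu> A = set_lebesgue_integral L A k2"
    and db: "b A = set_lebesgue_integral L A hb" and dc: "cnj (b A) = set_lebesgue_integral L A kc"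
    if A: "A \<in> sets circle" for A
  proof -
    have AL: "A \<in> sets L" using A L(2) by simp
    show "a A = set_lebesgue_integral L A k1"
      using set_integral_bounded_linear[OF bounded_linear_of_real[where 'a=complex] int(1) AL] psd(1)[OF A] dens(1)[OF A]
      by (simp add: k1_def[abs_def] h1_def[abs_def])
    show "\<nu> A = set_lebesgue_integral L A k2"
      using set_integral_bounded_linear[OF bounded_linear_of_real[where 'a=complex] int(2) AL] psd(2)[OF A] dens(2)[OF A]
      by (simp add: k2_def[abs_def] h2_def[abs_def])
    show "b A = set_lebesgue_integral L A hb" using dens(3)[OF A] by (simp add: hb_def[abs_def])
    then show "cnj (b A) = set_lebesgue_integral L A kc"
      using set_integral_bounded_linear[OF bounded_linear_cnj int(3) AL] by (simp add: kc_def[abs_def])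
  qed
  have ma: "circle_moment a n = (LINT w|L. k1 w * w powi n)" and m\<nu>: "circle_moment \<nu> n = (LINT w|L. k2 w * w powi n)"
    and mb: "circle_moment b n = (LINT w|L. hb w * w powi n)" for n
    by (rule circle_moment_density[OF L(2) kint(1) da] circle_moment_density[OF L(2) kint(2) d\<nu>]
        circle_moment_density[OF L(2) int(3) db]; assumption)+
  have cc: "c1 (c n) = circle_moment a n" "c2 (c n) = circle_moment b n" for n
  proof -
    have "c n = slice_emb i (circle_moment a n) + slice_emb i (circle_moment b n) * j"
      using mom unfolding quat_moment_def a_def b_def by metis
    then show "c1 (c n) = circle_moment a n" "c2 (c n) = circle_moment b n" using coords_eqI by blast+
  qed
  have cnj_mom: "cnj (LINT w|L. k w * w powi n) = (LINT w|L. cnj (k w) * w powi (- n))" for k n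
  proof -
    have "cnj (LINT w|L. k w * w powi n) = (LINT w|L. cnj (k w * w powi n))"
      by (rule Bochner_Integration.integral_cnj[symmetric])
    also have "\<dots> = (LINT w|L. cnj (k w) * w powi (- n))"
    proof (intro Bochner_Integration.integral_cong refl)
      fix w assume "w \<in> space L"
      then have "w * cnj w = 1" using complex_norm_square[of w] by (simp add: space_L)
      then have "cnj w = inverse w" by (rule inverse_unique[symmetric])
      then show "cnj (k w * w powi n) = cnj (k w) * w powi (- n)"
        by (simp add: power_int_inverse power_int_minus)
    qed
    finally show ?thesis .
  qed
  have qmom: "m11 (qmat (c (- int n))) = (LINT w|L. k1 w * w powi (- int n))"
    "m12 (qmat (c (- int n))) = (LINT w|L. hb w * w powi (- int n))"
    "m21 (qmat (c (- int n))) = (LINT w|L. kc w * w powi (- int n))"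
    "m22 (qmat (c (- int n))) = (LINT w|L. k2 w * w powi (- int n))" for n
  proof -
    show "m11 (qmat (c (- int n))) = (LINT w|L. k1 w * w powi (- int n))"
      "m12 (qmat (c (- int n))) = (LINT w|L. hb w * w powi (- int n))"
      by (simp_all only: qmat_def m2.sel cc ma mb)
    \<comment> \<open>The skew symmetry required by q-positivity turns the lower left entry of
      \<open>qmat\<close> into the moment of the conjugated off-diagonal measure, so that M has the
      moments \<open>\<chi>\<^sub>i\<close> (c n).\<close>
    have "circle_moment b (- int n) = - circle_moment b (int n)"
      using qpos unfolding q_positive_def b_def[symmetric] by (metis add.inverse_inverse)
    then have "m21 (qmat (c (- int n))) = cnj (circle_moment b (int n))"
      by (simp add: qmat_def cc)
    then show "m21 (qmat (c (- int n))) = (LINT w|L. kc w * w powi (- int n))"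
      by (simp only: mb cnj_mom kc_def)
    have "m22 (qmat (c (- int n))) = cnj (circle_moment a (- int n))" by (simp add: qmat_def cc)
    also have "\<dots> = circle_moment a (int n)" unfolding ma cnj_mom by (simp add: k1_def)
    also have "\<dots> = circle_moment \<nu> (- int n)" by (simp add: \<nu>(2))
    finally show "m22 (qmat (c (- int n))) = (LINT w|L. k2 w * w powi (- int n))" unfolding m\<nu> .
  qed
  define F where "F = caratheodory_series c"
  have qF: "qconv F"
  proof (rule qconvI)
    fix n
    have mb1: "cmod (LINT w|L. k w * w powi m) \<le> (LINT w|L. cmod (k w))" if k: "integrable L k" for k m
    proof -
      have "cmod (LINT w|L. k w * w powi m) \<le> (LINT w|L. cmod (k w * w powi m))" by (rule integral_norm_bound)
      also have "\<dots> = (LINT w|L. cmod (k w))"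
        by (intro Bochner_Integration.integral_cong) (auto simp: norm_mult norm_power_int space_L)
      finally show ?thesis .
    qed
    have cb: "norm (c m) \<le> (LINT w|L. cmod (k1 w)) + (LINT w|L. cmod (hb w))" for m
    proof -
      have "(norm (c m))\<^sup>2 \<le> (cmod (c1 (c m)) + cmod (c2 (c m)))\<^sup>2"
        unfolding norm_eq by (simp add: power2_sum)
      then have "norm (c m) \<le> cmod (c1 (c m)) + cmod (c2 (c m))" by (rule power2_le_imp_le) simp
      then show ?thesis using mb1[OF kint(1), of m] mb1[OF int(3), of m] by (simp add: cc ma mb)
    qed
    show "norm (F $ n) \<le> 1 + 2 * ((LINT w|L. cmod (k1 w)) + (LINT w|L. cmod (hb w)))"
    proof (cases "n = 0")
      case True
      then show ?thesis using order_trans[OF norm_ge_zero cb[of 0]] by (simp add: F_def caratheodory_series_def)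
    next
      case False
      then have "F $ n = 2 * c (- int n)"
        by (simp add: F_def caratheodory_series_def fps_numeral_nth numeral_fps_const)
      then show ?thesis using cb[of "- int n"] by (simp add: norm_mult)
    qed
  qed
  have Wr_eq: "Wr z = hpart (qeval F z)" if z: "cmod z < 1" for z
  proof -
    let ?K = "\<lambda>w. (w + z) / (w - z)"
    have Ki: "integrable L (\<lambda>w. ?K w * k w)" if "integrable L k" for k
      by (rule herglotz_kernel_sums(2)[OF L that z])
    have q: "m11 (qeval F z) = (LINT w|L. ?K w * k1 w)" "m12 (qeval F z) = (LINT w|L. ?K w * hb w)"
      "m21 (qeval F z) = (LINT w|L. ?K w * kc w)" "m22 (qeval F z) = (LINT w|L. ?K w * k2 w)"
      unfolding F_def
      by (rule qeval_herglotz[where c=c and e=m11, OF L kint(1) _ c0 qmom(1) qF[unfolded F_def] z], simp)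
         (rule qeval_herglotz[where c=c and e=m12, OF L int(3) _ c0 qmom(2) qF[unfolded F_def] z], simp,
          rule qeval_herglotz[where c=c and e=m21, OF L kint(3) _ c0 qmom(3) qF[unfolded F_def] z], simp,
          rule qeval_herglotz[where c=c and e=m22, OF L kint(2) _ c0 qmom(4) qF[unfolded F_def] z], simp)
    have Pi: "integrable L (\<lambda>w. poisson z w *\<^sub>R H w)" by (rule poisson_integrable[OF L H(1) z])
    have comp: "T (Wr z) = (LINT w|L. poisson z w *\<^sub>R T (H w))" if T: "bounded_linear T"
      for T :: "htriple \<Rightarrow> 'x :: {banach, second_countable_topology}"
      unfolding Wr_def integral_bounded_linear[OF T Pi, symmetric] by (simp add: linear_simps(5)[OF T])
    have re: "Re (x * complex_of_real t) = Re x * t" for x t by simp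
    have "fst (Wr z) = Re (m11 (qeval F z))"
    proof -
      have "Re (m11 (qeval F z)) = (LINT w|L. Re (?K w * k1 w))"
        unfolding q by (rule integral_Re[OF Ki[OF kint(1)], symmetric])
      also have "\<dots> = (LINT w|L. poisson z w *\<^sub>R h1 w)" unfolding k1_def re poisson_def by simp
      finally have "Re (m11 (qeval F z)) = (LINT w|L. poisson z w *\<^sub>R h1 w)" .
      then show ?thesis using comp[OF bounded_linear_fst] by (simp add: h1_def)
    qed
    moreover have "fst (snd (Wr z)) = Re (m22 (qeval F z))"
    proof -
      have "Re (m22 (qeval F z)) = (LINT w|L. Re (?K w * k2 w))"
        unfolding q by (rule integral_Re[OF Ki[OF kint(2)], symmetric])
      also have "\<dots> = (LINT w|L. poisson z w *\<^sub>R h2 w)" unfolding k2_def re poisson_def by simp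
      finally have "Re (m22 (qeval F z)) = (LINT w|L. poisson z w *\<^sub>R h2 w)" .
      then show ?thesis using comp[OF bounded_linear_compose[OF bounded_linear_fst bounded_linear_snd]]
        by (simp add: h2_def)
    qed
    moreover have "snd (snd (Wr z)) = (m12 (qeval F z) + cnj (m21 (qeval F z))) / 2"
    proof -
      define P Q where "P w = ?K w * hb w" and "Q w = ?K w * kc w" for w
      have PQ: "integrable L P" "integrable L Q" using Ki[OF int(3)] Ki[OF kint(3)] by (simp_all add: P_def[abs_def] Q_def[abs_def])
      have "snd (snd (Wr z)) = (LINT w|L. poisson z w *\<^sub>R hb w)"
        using comp[OF bounded_linear_compose[OF bounded_linear_snd bounded_linear_snd]] by (simp add: hb_def)
      also have "\<dots> = (LINT w|L. (P w + cnj (Q w)) / 2)"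
      proof -
        have "Re K *\<^sub>R x = (K * x + cnj (K * cnj x)) / 2" for K x :: complex
          by (simp add: complex_eq_iff)
        then show ?thesis unfolding poisson_def P_def Q_def kc_def by (intro Bochner_Integration.integral_cong refl)
      qed
      also have "\<dots> = ((LINT w|L. P w) + cnj (LINT w|L. Q w)) / 2" using PQ by simp
      finally show ?thesis unfolding q P_def Q_def .
    qed
    ultimately show ?thesis by (simp add: hpart_def prod_eq_iff)
  qed
  interpret szego_data i j f \<gamma> L H \<rho> F
    by unfold_locales (use f qF Wr_eq in \<open>simp_all add: F_def\<close>)
  obtain Ms N where Ms: "integrable arc_measure W" "N \<in> null_sets arc_measure"
    "\<And>A. A \<in> sets circle \<Longrightarrow> A \<inter> N = {} \<Longrightarrow> Ms A = 0"
    "\<And>A. A \<in> sets circle \<Longrightarrow> M A = set_lebesgue_integral arc_measure A W + Ms A"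
    using rn unfolding rn_derivative_def by blast
  have blv: "bounded_linear (\<lambda>X :: complex^2^2. vec_nth (vec_nth X x) y)" for x y
    by (rule bounded_linear_compose[OF bounded_linear_vec_nth bounded_linear_vec_nth])
  define Wc where "Wc x y w = vec_nth (vec_nth (W w) x) y" for x y w
  have Wint: "integrable arc_measure (Wc x y)" for x y
    unfolding Wc_def[abs_def] by (rule integrable_bounded_linear[OF blv Ms(1)])
  have MA: "vec_nth (vec_nth (M A) x) y = set_lebesgue_integral arc_measure A (Wc x y)"
    if "A \<in> sets circle" "A \<inter> N = {}" for A x y
    using Ms(4)[OF that(1)] Ms(3)[OF that] set_integral_bounded_linear[OF blv Ms(1), of A x y] that(1)
    by (simp add: Wc_def[abs_def])
  \<comment> \<open>Off \<open>N\<close> the set function M is given by W alone, and it has density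
    k with respect to L; comparing the two identifies each entry of W.\<close>
  have entry: "AE w in arc_measure. Wc x y w = (1 / \<rho> w) *\<^sub>R k w"
    if k: "integrable L k" and kA: "\<And>A. A \<in> sets circle \<Longrightarrow> vec_nth (vec_nth (M A) x) y = set_lebesgue_integral L A k" for x y k
    by (rule density_eq_AE[OF Wint k Ms(2)]) (simp add: MA[symmetric] kA)
  have "AE w in arc_measure. Wc 1 1 w = (1 / \<rho> w) *\<^sub>R k1 w" by (rule entry[OF kint(1)]) (simp add: \<nu>(3) da)
  moreover have "AE w in arc_measure. Wc 1 2 w = (1 / \<rho> w) *\<^sub>R hb w" by (rule entry[OF int(3)]) (simp add: \<nu>(3) db)
  moreover have "AE w in arc_measure. Wc 2 1 w = (1 / \<rho> w) *\<^sub>R kc w" by (rule entry[OF kint(3)]) (simp add: \<nu>(3) dc)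
  moreover have "AE w in arc_measure. Wc 2 2 w = (1 / \<rho> w) *\<^sub>R k2 w" by (rule entry[OF kint(2)]) (simp add: \<nu>(3) d\<nu>)
  ultimately have detW: "AE w in arc_measure. Re (det (W w)) = hdet (W0 w)"
  proof eventually_elim
    case (elim w)
    have "det (W w) = Wc 1 1 w * Wc 2 2 w - Wc 1 2 w * Wc 2 1 w" by (simp add: det_2 Wc_def)
    also have "\<dots> = (1 / \<rho> w)\<^sup>2 *\<^sub>R (k1 w * k2 w - hb w * kc w)"
      unfolding elim by (simp add: scaleR_conv_of_real power2_eq_square algebra_simps)
    also have "k1 w * k2 w - hb w * kc w = of_real (hdet (H w))"
      unfolding k1_def k2_def kc_def hdet_def h1_def h2_def hb_def
      by (simp add: complex_norm_square[symmetric])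
    finally show ?case by (simp add: W0_def hdet_scaleR)
  qed
  have Dm: "(\<lambda>w. Re (det (W w))) \<in> borel_measurable circle"
  proof -
    have "Wc x y \<in> borel_measurable circle" for x y
      using borel_measurable_integrable[OF Wint, of x y] by (simp cong: measurable_cong_sets)
    then have "(\<lambda>w. Re (Wc 1 1 w * Wc 2 2 w - Wc 1 2 w * Wc 2 1 w)) \<in> borel_measurable circle"
      by measurable
    then show ?thesis by (simp add: det_2 Wc_def)
  qed
  \<comment> \<open>ln det is dominated by the trace of \<open>W0\<close>, which is
    integrable.\<close>
  have fin: "(\<integral>\<^sup>+w. e2ennreal (ln_ereal (Re (det (W w)))) \<partial>arc_measure) < \<infinity>"
  proof -
    have "(\<integral>\<^sup>+w. e2ennreal (ln_ereal (Re (det (W w)))) \<partial>arc_measure) \<le> (\<integral>\<^sup>+w. ennreal (htr (W0 w)) \<partial>arc_measure)"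
    proof (rule nn_integral_mono_AE)
      show "AE w in arc_measure. e2ennreal (ln_ereal (Re (det (W w)))) \<le> ennreal (htr (W0 w))"
        using detW
      proof eventually_elim
        case (elim w)
        show ?case
        proof (cases "0 < hdet (W0 w)")
          case True
          have "ln (hdet (W0 w)) \<le> htr (W0 w)" using ln_hdet_le_htr[OF hpsd_W0 True] by simp
          then show ?thesis using True by (simp add: elim ln_ereal_def e2ennreal_ereal ennreal_leI)
        next
          case False
          then show ?thesis by (simp add: elim ln_ereal_def e2ennreal_neg)
        qed
      qed
    qed
    also have "\<dots> < \<infinity>"
      using integrable_htr_W0 nn_integral_eq_integral[OF integrable_htr_W0] htr_nonneg[OF hpsd_W0] by simp
    finally show ?thesis .
  qed
  have lnm: "(\<lambda>w. ln (Re (det (W w)))) \<in> borel_measurable arc_measure"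
    "(\<lambda>w. ln (hdet (W0 w))) \<in> borel_measurable arc_measure"
  proof -
    note [measurable] = Dm
    show "(\<lambda>w. ln (Re (det (W w)))) \<in> borel_measurable arc_measure" by measurable
    show "(\<lambda>w. ln (hdet (W0 w))) \<in> borel_measurable arc_measure"
      unfolding measurable_arc_iff by measurable
  qed
  have fin_iff: "(AE w in arc_measure. 0 < Re (det (W w))) \<and> integrable arc_measure (\<lambda>w. ln (Re (det (W w)))) \<longleftrightarrow> entropy_finite"
  proof -
    have "(AE w in arc_measure. 0 < Re (det (W w))) \<longleftrightarrow> (AE w in arc_measure. 0 < hdet (W0 w))"
      by (rule eventually_cong[OF detW]) simp
    moreover have "integrable arc_measure (\<lambda>w. ln (Re (det (W w)))) \<longleftrightarrow> integrable arc_measure (\<lambda>w. ln (hdet (W0 w)))"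
      by (rule integrable_cong_AE[OF lnm]) (use detW in eventually_elim, simp)
    ultimately show ?thesis unfolding entropy_finite_def by simp
  qed
  have "exp_ereal (log_det_integral W) = ereal (if entropy_finite then exp entropy else 0)"
  proof (cases entropy_finite)
    case True
    have "(LINT w|arc_measure. ln (Re (det (W w)))) = entropy"
      unfolding entropy_def
      by (rule integral_cong_AE[OF lnm]) (use detW in eventually_elim, simp)
    then show ?thesis using log_det_integral_cases(1)[OF Dm fin] fin_iff True by (simp add: exp_ereal_def)
  next
    case False
    then show ?thesis using log_det_integral_cases(2)[OF Dm fin] fin_iff by (simp add: exp_ereal_def)
  qed
  then show ?thesis using szego_limit by simp
qed

text \<open>Injectivity includes -\<infinity>, the only argument with value 0. Hence two frames
  sharing the same product have equal integrals also when the product vanishes.\<close>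

lemma exp_ereal_inject: "exp_ereal x = exp_ereal y \<Longrightarrow> x = y"
  by (cases x; cases y) (auto simp: exp_ereal_def zero_ereal_def)

theorem theorem8p1:
  fixes c :: "int \<Rightarrow> quat" and \<gamma> :: "nat \<Rightarrow> quat" and i j :: quat
    and \<mu> :: "complex set \<Rightarrow> quat"
    and M :: "complex set \<Rightarrow> complex^2^2" and W :: "complex \<Rightarrow> complex^2^2"
  assumes "nontrivial_positive_definite_seq c" and "c 0 = 1"
    and "verblunsky_coefficients c \<gamma>"
    and "i \<in> imag_units" and "j \<in> imag_units" and "orthogonal i j"
    and "q_positive i j \<mu>" and "\<forall>n. quat_moment i j \<mu> n = c n"
    and "corresponding_matrix_measure i j \<mu> M"
    and "rn_derivative M W"
  shows "(\<lambda>N. ereal (\<Prod>n<N. (1 - (norm (\<gamma> n))\<^sup>2)\<^sup>2)) \<longlonglongrightarrow> exp_ereal (log_det_integral W) \<and>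
    (\<forall>i' j' \<mu>' M' W'.
       i' \<in> imag_units \<longrightarrow> j' \<in> imag_units \<longrightarrow> orthogonal i' j' \<longrightarrow>
       q_positive i' j' \<mu>' \<longrightarrow> (\<forall>n. quat_moment i' j' \<mu>' n = c n) \<longrightarrow>
       corresponding_matrix_measure i' j' \<mu>' M' \<longrightarrow> rn_derivative M' W' \<longrightarrow>
       log_det_integral W = log_det_integral W')"
proof (intro conjI allI impI)
  show lim: "(\<lambda>N. ereal (\<Prod>n<N. (1 - (norm (\<gamma> n))\<^sup>2)\<^sup>2)) \<longlonglongrightarrow> exp_ereal (log_det_integral W)"
    by (rule verblunsky_product_limit[OF assms])
  fix i' j' \<mu>' M' W'
  assume "i' \<in> imag_units" "j' \<in> imag_units" "orthogonal i' j'" "q_positive i' j' \<mu>'"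
    "\<forall>n. quat_moment i' j' \<mu>' n = c n" "corresponding_matrix_measure i' j' \<mu>' M'" "rn_derivative M' W'"
  from verblunsky_product_limit[OF assms(1-3) this]
  have "exp_ereal (log_det_integral W) = exp_ereal (log_det_integral W')"
    by (rule LIMSEQ_unique[OF lim])
  then show "log_det_integral W = log_det_integral W'" by (rule exp_ereal_inject)
qed

end
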